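(* Consider the Le Corbeiller system $$\dot x=y+a,\qquad \dot y=-x+by\left(2-e^{y\epsilon^{-1}}\right),$$ and fix a large ball $B_r\subset\mathbb R^2$ of radius $r$. Suppose that $b\in(0,1)$ and $a>0$. Then there exists an $\epsilon_0>0$ such that for all $\epsilon\in(0,\epsilon_0)$ the system has a unique limit cycle $\Gamma_\epsilon$ in $B_r$. Furthermore, $\Gamma_\epsilon$ is attracting and $\Gamma_\epsilon\to\Gamma_0$ in Hausdorff distance as $\epsilon\to0^+$, where $\Gamma_0$ is the singular cycle defined in the context.
   Context: Here $0<\epsilon\ll 1$ is the singular perturbation parameter. "Large" means that $r$ is fixed (independently of $\epsilon$) sufficiently large, e.g. so that $B_r$, centred at the origin, contains $\Gamma_0$ in its interior; $\epsilon_0$ may depend on $r$ and the parameters. Singular cycle $\Gamma_0$: consider the linear system $\dot x=y+a,\ \dot y=-x+2by$ in $y<0$. It has a quadratic (visible fold) tangency with $\{y=0\}$ at $(0,0)$. Let $\Gamma^1$ be the orbit segment of this system obtained by flowing the tangency point $(0,0)$ forward until its first return to $\{y=0\}$, at a point $(x_d,0)$ with $x_d<0$. Let $\Gamma^2=[x_d,0]\times\{0\}$ be the segment of $\{y=0\}$ between $(x_d,0)$ and $(0,0)$. Then $\Gamma_0=\Gamma^1\cup\Gamma^2$. *)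

theory Defs
  imports "HOL-Analysis.Analysis"
begin

section \<open>Autonomous ordinary differential equations\<close>

definition solution_on ::
    "('a::real_normed_vector \<Rightarrow> 'a) \<Rightarrow> (real \<Rightarrow> 'a) \<Rightarrow> real set \<Rightarrow> bool" where
  "solution_on f \<phi> I \<longleftrightarrow> (\<forall>t\<in>I. (\<phi> has_vector_derivative f (\<phi> t)) (at t within I))"

definition periodic_orbit :: "('a::real_normed_vector \<Rightarrow> 'a) \<Rightarrow> 'a set \<Rightarrow> bool" where
  "periodic_orbit f C \<longleftrightarrow>
     (\<exists>\<phi> T. solution_on f \<phi> UNIV \<and> 0 < T \<and> (\<forall>t. \<phi> (t + T) = \<phi> t) \<and>
            (\<exists>t. \<phi> t \<noteq> \<phi> 0) \<and> C = range \<phi>)"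

text \<open>A limit cycle is an isolated periodic orbit: no other periodic orbit passes through some
  neighbourhood of it.\<close>

definition limit_cycle :: "('a::real_normed_vector \<Rightarrow> 'a) \<Rightarrow> 'a set \<Rightarrow> bool" where
  "limit_cycle f C \<longleftrightarrow> periodic_orbit f C \<and>
     (\<exists>U. open U \<and> C \<subseteq> U \<and> (\<forall>D. periodic_orbit f D \<and> D \<inter> U \<noteq> {} \<longrightarrow> D = C))"

text \<open>Attraction means asymptotic orbital stability. The existential quantifier over forward
  solutions is meant for locally Lipschitz \<open>f\<close>, for which the forward solution through a point
  is unique.\<close>

definition attracting :: "('a::real_normed_vector \<Rightarrow> 'a) \<Rightarrow> 'a set \<Rightarrow> bool" where
  "attracting f C \<longleftrightarrow>
     (\<forall>V. open V \<and> C \<subseteq> V \<longrightarrow>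
        (\<exists>U. open U \<and> C \<subseteq> U \<and>
           (\<forall>p\<in>U. \<exists>\<phi>. \<phi> 0 = p \<and> solution_on f \<phi> {0..} \<and> (\<forall>t\<ge>0. \<phi> t \<in> V) \<and>
                       ((\<lambda>t. infdist (\<phi> t) C) \<longlongrightarrow> 0) at_top)))"

text \<open>Real-valued, hence only meaningful for nonempty bounded sets.\<close>

definition hausdorff_distance :: "'a::metric_space set \<Rightarrow> 'a set \<Rightarrow> real" where
  "hausdorff_distance A B = max (SUP x\<in>A. infdist x B) (SUP y\<in>B. infdist y A)"


section \<open>The Le Corbeiller system and its singular cycle\<close>

definition le_corbeiller :: "real \<Rightarrow> real \<Rightarrow> real \<Rightarrow> real \<times> real \<Rightarrow> real \<times> real" where
  "le_corbeiller a b \<epsilon> = (\<lambda>(x, y). (y + a, - x + b * y * (2 - exp (y / \<epsilon>))))"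

definition linear_field :: "real \<Rightarrow> real \<Rightarrow> real \<times> real \<Rightarrow> real \<times> real" where
  "linear_field a b = (\<lambda>(x, y). (y + a, - x + 2 * b * y))"

text \<open>The linear system matters only in \<open>y < 0\<close>, but it is defined on the whole plane, so the
  orbit of the fold point is a globally defined and unique function of time. For \<open>a > 0\<close> and
  \<open>0 < b < 1\<close> it enters \<open>y < 0\<close> at time \<open>0\<^sup>+\<close> and stays there until \<open>return_time\<close>.\<close>

definition fold_orbit :: "real \<Rightarrow> real \<Rightarrow> real \<Rightarrow> real \<times> real" where
  "fold_orbit a b = (THE \<phi>. solution_on (linear_field a b) \<phi> UNIV \<and> \<phi> 0 = (0, 0))"

definition return_time :: "real \<Rightarrow> real \<Rightarrow> real" where
  "return_time a b = (LEAST t. 0 < t \<and> snd (fold_orbit a b t) = 0)"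

definition x_d :: "real \<Rightarrow> real \<Rightarrow> real" where
  "x_d a b = fst (fold_orbit a b (return_time a b))"

definition singular_cycle :: "real \<Rightarrow> real \<Rightarrow> (real \<times> real) set" where
  "singular_cycle a b = fold_orbit a b ` {0..return_time a b} \<union> {x_d a b..0} \<times> {0}"

end

theory Submission
  imports Defs
begin

text \<open>
The periodic orbit is a fixed point of a return map, and everything is reduced to one estimate for
that map: it is a contraction with factor \<open>1/2\<close>.

The nonlinearity \<open>f y = b y (2 - exp (y / \<epsilon>))\<close> is within \<open>\<epsilon>\<close> of \<open>2 b y\<close> for \<open>y \<le> 0\<close>, has slope at most 3
everywhere, and slope below \<open>- K\<close>, for any given \<open>K\<close>, above a height of order \<open>\<epsilon>\<close>. The slope bound from
above is one-sided but uniform in \<open>\<epsilon>\<close>, and by Gronwall's argument it implies that two solutions, or a solution and an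
approximate solution, separate at a rate independent of \<open>\<epsilon>\<close> (\<open>one_sided_gronwall\<close>). This single estimate replaces
a local analysis near the fold: an orbit which starts on a short section \<open>{- \<delta>} \<times> {0..h}\<close> near the fold
point shadows the orbit of the fold point of the linear system all the way to the drop
point \<open>(x_d, 0)\<close> (\<open>fold_shadowing\<close>). There it crosses \<open>y = 0\<close> upwards and is trapped in a thin strip
above \<open>y = 0\<close>, in which it moves to the right with speed about \<open>a\<close> back to the section (\<open>entry_phase\<close>,
\<open>slide_phase\<close>).

In the strip the vertical distance of two orbits is damped at rate \<open>K\<close>, for a time bounded below, whereas the
expansion during the whole turn, including the cost of synchronising the two orbits, is bounded
independently of \<open>\<epsilon>\<close> and \<open>K\<close>. So the return map is contracting once \<open>K\<close> is large
(\<open>return_map_contracts_aux\<close>), and has a unique fixed point. Its orbit is a cycle, which attracts a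
neighbourhood (\<open>flow_attracted\<close>), is isolated, and is Hausdorff close to the singular cycle
(\<open>hausdorff_cycle\<close>).

Uniqueness in the ball follows because every periodic orbit in it meets the section
(\<open>periodic_orbit_in_ball\<close>): the distance to the equilibrium increases along orbits except where \<open>y\<close> is
so large that \<open>f y\<close> is quite negative, and a periodic orbit that climbs so high has its highest
point on the nullcline \<open>x = f y\<close>, to the left of the section, from where it slides into the section.
Hence the orbit converges to the cycle, and, being periodic, coincides with it.

A flow is needed for the return map, but the field is not globally Lipschitz. The nonlinearity is therefore
frozen above height 2; the resulting system has a global flow by Picard's theorem and has the same
orbits below that height.\<close>

section \<open>Existence and uniqueness for globally Lipschitz fields\<close>

text \<open>Picard iteration needs no restriction to a short time interval here: with a global Lipschitz
constant the increments are bounded by the terms of an exponential series, so the iterates converge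
uniformly on every compact interval of times.\<close>

lemma picard_forward:
  fixes f :: "'a::euclidean_space \<Rightarrow> 'a"
  assumes lip: "L-lipschitz_on UNIV f"
  shows "\<exists>\<phi>. \<phi> 0 = p \<and> solution_on f \<phi> {0..}"
proof -
  define P where "P = rec_nat (\<lambda>t::real. p) (\<lambda>n \<psi> t. p + integral {0..t} (\<lambda>s. f (\<psi> s)))"
  have P0: "P 0 = (\<lambda>t. p)" and PS: "P (Suc n) = (\<lambda>t. p + integral {0..t} (\<lambda>s. f (P n s)))" for n
    by (simp_all add: P_def)
  have L0: "0 \<le> L" using lip by (rule lipschitz_on_nonneg)
  have fcont: "continuous_on S f" for S
    using lipschitz_on_continuous_on[OF lip] continuous_on_subset by blast
  have fcomp: "continuous_on S (\<lambda>s. f (\<psi> s))" if "continuous_on S \<psi>" for \<psi> :: "real \<Rightarrow> 'a" and S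
    using continuous_on_compose2[OF fcont[of UNIV] that] by auto
  have Pcont: "continuous_on {0..T} (P n)" for n and T :: real
  proof (induction n)
    case (Suc n)
    have "(\<lambda>s. f (P n s)) integrable_on {0..T}"
      by (intro integrable_continuous_real fcomp Suc)
    then show ?case
      unfolding PS by (intro continuous_intros indefinite_integral_continuous_1)
  qed (simp add: P0)
  have fPint: "(\<lambda>s. f (P n s)) integrable_on {0..T}" for n and T :: real
    by (intro integrable_continuous_real fcomp Pcont)
  define c where "c = (\<lambda>n. norm (f p) * L ^ n / fact (Suc n))"
  have step: "norm (P (Suc n) t - P n t) \<le> c n * t ^ Suc n" if "0 \<le> t" for n t
    using that
  proof (induction n arbitrary: t)
    case 0
    then show ?case by (simp add: PS P0 c_def)
  next
    case (Suc n)
    have pow: "((\<lambda>s. L * (c n * s ^ Suc n)) has_integral c (Suc n) * t ^ Suc (Suc n)) {0..t}"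
    proof -
      have "((\<lambda>s. L * (c n * s ^ Suc n)) has_integral
              c (Suc n) * t ^ Suc (Suc n) - c (Suc n) * 0 ^ Suc (Suc n)) {0..t}"
      proof (rule fundamental_theorem_of_calculus[OF Suc.prems])
        fix s :: real
        have "((\<lambda>s. c (Suc n) * s ^ Suc (Suc n)) has_real_derivative
                c (Suc n) * (real (Suc (Suc n)) * s ^ Suc n)) (at s within {0..t})"
          by (rule DERIV_cmult, rule derivative_eq_intros, rule derivative_eq_intros) auto
        also have "c (Suc n) * (real (Suc (Suc n)) * s ^ Suc n) = L * (c n * s ^ Suc n)"
        proof -
          have "c (Suc n) * real (Suc (Suc n)) = L * c n"
            unfolding c_def fact_Suc[of "Suc n"] by (simp del: fact_Suc)
          then show ?thesis by (metis mult.assoc)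
        qed
        finally show "((\<lambda>s. c (Suc n) * s ^ Suc (Suc n)) has_vector_derivative
                L * (c n * s ^ Suc n)) (at s within {0..t})"
          by (rule has_real_derivative_iff_has_vector_derivative[THEN iffD1])
      qed
      then show ?thesis by simp
    qed
    have "norm (P (Suc (Suc n)) t - P (Suc n) t)
        = norm (integral {0..t} (\<lambda>s. f (P (Suc n) s) - f (P n s)))"
      unfolding PS[of "Suc n"] PS[of n]
      using integral_diff[OF fPint[of "Suc n" t] fPint[of n t]] by (simp add: PS)
    also have "\<dots> \<le> integral {0..t} (\<lambda>s. L * (c n * s ^ Suc n))"
    proof (rule integral_norm_bound_integral)
      show "(\<lambda>s. f (P (Suc n) s) - f (P n s)) integrable_on {0..t}"
        by (intro integrable_diff fPint)
      show "(\<lambda>s. L * (c n * s ^ Suc n)) integrable_on {0..t}"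
        using pow by blast
      fix s assume s: "s \<in> {0..t}"
      have "norm (f (P (Suc n) s) - f (P n s)) \<le> L * norm (P (Suc n) s - P n s)"
        by (rule lipschitz_on_normD[OF lip]) auto
      also have "\<dots> \<le> L * (c n * s ^ Suc n)"
        using Suc.IH[of s] s L0 by (intro mult_left_mono) auto
      finally show "norm (f (P (Suc n) s) - f (P n s)) \<le> L * (c n * s ^ Suc n)" .
    qed
    also have "\<dots> = c (Suc n) * t ^ Suc (Suc n)"
      using pow by (rule integral_unique)
    finally show ?case .
  qed
  define \<phi> where "\<phi> = (\<lambda>t. p + (\<Sum>n. P (Suc n) t - P n t))"
  have ulim: "uniform_limit {0..T} P \<phi> sequentially" if T: "0 \<le> T" for T
  proof -
    have "uniform_limit {0..T} (\<lambda>n t. \<Sum>i<n. P (Suc i) t - P i t)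
            (\<lambda>t. \<Sum>i. P (Suc i) t - P i t) sequentially"
    proof (rule Weierstrass_m_test)
      fix n t assume t: "t \<in> {0..T}"
      have "norm (P (Suc n) t - P n t) \<le> c n * t ^ Suc n"
        using t by (intro step) auto
      also have "\<dots> \<le> c n * T ^ Suc n"
        using t L0 by (intro mult_left_mono power_mono) (auto simp: c_def)
      also have "\<dots> = norm (f p) * T * ((L * T) ^ n / fact (Suc n))"
        by (simp add: c_def power_mult_distrib)
      also have "\<dots> \<le> norm (f p) * T * ((L * T) ^ n / fact n)"
        using T L0 by (intro mult_left_mono divide_left_mono) (auto simp: fact_mono)
      finally show "norm (P (Suc n) t - P n t) \<le> norm (f p) * T * ((L * T) ^ n / fact n)" .
    next
      show "summable (\<lambda>n. norm (f p) * T * ((L * T) ^ n / fact n))"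
        using summable_exp[of "L * T"] by (intro summable_mult) (simp add: field_simps)
    qed
    then have "uniform_limit {0..T} (\<lambda>n t. p + (\<Sum>i<n. P (Suc i) t - P i t)) \<phi> sequentially"
      unfolding \<phi>_def by (intro uniform_limit_intros)
    moreover have "p + (\<Sum>i<n. P (Suc i) t - P i t) = P n t" for n t
      using sum_lessThan_telescope[of "\<lambda>i. P i t" n] by (simp add: P0)
    ultimately show ?thesis by simp
  qed
  have \<phi>cont: "continuous_on {0..T} \<phi>" if "0 \<le> T" for T
    by (rule uniform_limit_theorem[OF _ ulim[OF that]]) (auto simp: Pcont)
  have \<phi>eq: "\<phi> t = p + integral {0..t} (\<lambda>s. f (\<phi> s))" if t: "0 \<le> t" for t
  proof -
    have "uniform_limit {0..t} (\<lambda>n s. f (P n s)) (\<lambda>s. f (\<phi> s)) sequentially"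
      by (rule uniform_limit_compose_uniformly_continuous_on[OF ulim[OF t] lipschitz_on_uniformly_continuous[OF lip]])
        auto
    then obtain I J where I: "\<And>n. ((\<lambda>s. f (P n s)) has_integral I n) {0..t}"
      and J: "((\<lambda>s. f (\<phi> s)) has_integral J) {0..t}" and lim: "I \<longlonglongrightarrow> J"
      by (rule uniform_limit_integral[OF _ fcomp[OF Pcont] sequentially_bot]) blast
    have "(\<lambda>n. P (Suc n) t) \<longlonglongrightarrow> p + J"
      using lim by (simp add: PS integral_unique[OF I] tendsto_add)
    moreover have "(\<lambda>n. P (Suc n) t) \<longlonglongrightarrow> \<phi> t"
      using LIMSEQ_Suc[OF tendsto_uniform_limitI[OF ulim[OF t], of t]] t by simp
    ultimately show ?thesis
      using J LIMSEQ_unique integral_unique by metis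
  qed
  have "(\<phi> has_vector_derivative f (\<phi> t)) (at t within {0..})" if t: "0 \<le> t" for t
  proof -
    have "((\<lambda>u. integral {0..u} (\<lambda>s. f (\<phi> s))) has_vector_derivative f (\<phi> t)) (at t within {0..t+1})"
      using t by (intro integral_has_vector_derivative fcomp \<phi>cont) auto
    then have "((\<lambda>u. p + integral {0..u} (\<lambda>s. f (\<phi> s))) has_vector_derivative f (\<phi> t)) (at t within {0..t+1})"
      by (auto intro!: derivative_eq_intros)
    then have "(\<phi> has_vector_derivative f (\<phi> t)) (at t within {0..t+1})"
      by (rule has_vector_derivative_transform[rotated 2]) (use t in \<open>auto simp: \<phi>eq[symmetric]\<close>)
    moreover have "at t within {0..t+1} = at t within {0..}"
      by (rule at_within_nhd[where S = "{..<t+1}"]) auto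
    ultimately show ?thesis by simp
  qed
  moreover have "\<phi> 0 = p" using \<phi>eq[of 0] by simp
  ultimately show ?thesis unfolding solution_on_def by auto
qed

lemma solution_on_UNIV_iff:
  "solution_on f \<phi> UNIV \<longleftrightarrow> (\<forall>t. (\<phi> has_vector_derivative f (\<phi> t)) (at t))"
  by (simp add: solution_on_def)

lemma solution_on_subset: "solution_on f \<phi> I \<Longrightarrow> J \<subseteq> I \<Longrightarrow> solution_on f \<phi> J"
  unfolding solution_on_def using has_vector_derivative_within_subset by blast

lemma solution_on_shift:
  assumes "solution_on f \<phi> UNIV"
  shows "solution_on f (\<lambda>t. \<phi> (t + \<tau>)) UNIV"
  unfolding solution_on_UNIV_iff
proof
  fix t
  have "((\<phi> \<circ> (\<lambda>t. t + \<tau>)) has_vector_derivative 1 *\<^sub>R f (\<phi> (t + \<tau>))) (at t)"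
    using assms by (intro vector_diff_chain_at derivative_eq_intros)
      (auto simp: solution_on_UNIV_iff)
  then show "((\<lambda>t. \<phi> (t + \<tau>)) has_vector_derivative f (\<phi> (t + \<tau>))) (at t)"
    by (simp add: o_def)
qed

lemma solution_on_reverse:
  assumes "solution_on f \<phi> UNIV"
  shows "solution_on (\<lambda>x. - f x) (\<lambda>t. \<phi> (- t)) UNIV"
  unfolding solution_on_UNIV_iff
proof
  fix t
  have "((\<phi> \<circ> uminus) has_vector_derivative (- 1) *\<^sub>R f (\<phi> (- t))) (at t)"
    using assms by (intro vector_diff_chain_at derivative_eq_intros)
      (auto simp: solution_on_UNIV_iff)
  then show "((\<lambda>t. \<phi> (- t)) has_vector_derivative - f (\<phi> (- t))) (at t)"
    by (simp add: o_def)
qed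

text \<open>Backward solutions are forward solutions of the negated field; the two halves agree to first order
at time 0.\<close>

theorem picard_lindelof:
  fixes f :: "'a::euclidean_space \<Rightarrow> 'a"
  assumes lip: "L-lipschitz_on UNIV f"
  shows "\<exists>\<phi>. \<phi> 0 = p \<and> solution_on f \<phi> UNIV"
proof -
  obtain \<phi> where \<phi>: "\<phi> 0 = p" "solution_on f \<phi> {0..}"
    using picard_forward[OF lip] by blast
  have "L-lipschitz_on UNIV (\<lambda>x. - f x)" using lip by (rule lipschitz_on_minus)
  then obtain \<psi> where \<psi>: "\<psi> 0 = p" "solution_on (\<lambda>x. - f x) \<psi> {0..}"
    using picard_forward by blast
  have \<psi>': "((\<lambda>t. \<psi> (- t)) has_vector_derivative f (\<psi> (- t))) (at t within {..0})" if "t \<le> 0" for t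
  proof -
    have "(\<psi> has_vector_derivative - f (\<psi> (- t))) (at (- t) within uminus ` {..0})"
      using \<psi> that by (auto simp: solution_on_def)
    then have "((\<psi> \<circ> uminus) has_vector_derivative (- 1) *\<^sub>R (- f (\<psi> (- t)))) (at t within {..0})"
      by (intro vector_diff_chain_within) (auto intro!: derivative_eq_intros)
    then show ?thesis by (simp add: o_def)
  qed
  define \<zeta> where "\<zeta> = (\<lambda>t. if t \<in> {0..} then \<phi> t else \<psi> (- t))"
  have "(\<zeta> has_vector_derivative (if t \<in> {0..} then f (\<phi> t) else f (\<psi> (- t)))) (at t within UNIV)" for t
    unfolding \<zeta>_def
  proof (rule has_vector_derivative_If_within_closures[where T = "{..0}"])
    have *: "{0..} \<inter> {..0} = {0::real}" "{0..} \<union> {0::real} = {0..}" "{..0} \<union> {0::real} = {..0}"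
      by auto
    show "(\<phi> has_vector_derivative f (\<phi> t)) (at t within {0..} \<union> closure {0..} \<inter> closure {..0})"
      if "t \<in> {0..} \<union> closure {0..} \<inter> closure {..0}"
      using that \<phi> by (simp add: * solution_on_def insert_absorb)
    show "((\<lambda>t. \<psi> (- t)) has_vector_derivative f (\<psi> (- t))) (at t within {..0} \<union> closure {0..} \<inter> closure {..0})"
      if "t \<in> {..0} \<union> closure {0..} \<inter> closure {..0}"
      using that \<psi>'[of t] by (simp add: * insert_absorb)
  qed (use \<phi> \<psi> in auto)
  moreover have "(if t \<in> {0..} then f (\<phi> t) else f (\<psi> (- t))) = f (\<zeta> t)" for t
    by (simp add: \<zeta>_def)
  ultimately have "solution_on f \<zeta> UNIV" by (simp add: solution_on_UNIV_iff)
  then show ?thesis using \<phi> by (intro exI[of _ \<zeta>]) (auto simp: \<zeta>_def)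
qed

text \<open>Differentiability is only asked for in the interior, so that the lemma applies to one-sided
solutions too. The constant \<open>c\<close> may have either sign: positive values give Gronwall bounds,
negative ones give exponential contraction.\<close>

lemma linear_differential_inequality:
  fixes u u' :: "real \<Rightarrow> real"
  assumes "c \<noteq> 0" "t0 \<le> t1" and cont: "continuous_on {t0..t1} u"
    and der: "\<And>t. t0 < t \<Longrightarrow> t < t1 \<Longrightarrow> (u has_real_derivative u' t) (at t)"
    and le: "\<And>t. t0 < t \<Longrightarrow> t < t1 \<Longrightarrow> u' t \<le> c * u t + k"
  shows "u t1 + k / c \<le> exp (c * (t1 - t0)) * (u t0 + k / c)"
proof -
  define v where "v = (\<lambda>t. exp (- c * t) * (u t + k / c))"
  have "v t1 \<le> v t0"
  proof (rule DERIV_nonpos_imp_decreasing_open[OF \<open>t0 \<le> t1\<close>])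
    show "continuous_on {t0..t1} v"
      unfolding v_def by (intro continuous_intros cont)
    fix t assume t: "t0 < t" "t < t1"
    have "(v has_real_derivative exp (- c * t) * (u' t - (c * u t + k))) (at t)"
      unfolding v_def using \<open>c \<noteq> 0\<close>
      by (auto intro!: derivative_eq_intros der t simp: field_simps)
    then show "\<exists>y. (v has_real_derivative y) (at t) \<and> y \<le> 0"
      using le[OF t] by (intro exI conjI) (auto simp: mult_nonneg_nonpos)
  qed
  then have "exp (c * t1) * v t1 \<le> exp (c * t1) * v t0" by simp
  then show ?thesis
    by (simp add: v_def flip: mult.assoc exp_add) (simp add: algebra_simps)
qed

text \<open>The quantitative core of the whole argument. A one-sided Lipschitz bound controls how fast solutions
separate in forward time no matter how strongly they are attracted to each other, and for the
Le Corbeiller field this bound is uniform in \<open>\<epsilon>\<close> although the Lipschitz constants blow up. The curve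
\<open>\<psi>\<close> need only be an approximate solution, which is what allows comparison with the singular
orbit.\<close>

lemma one_sided_gronwall:
  fixes f :: "'a::real_inner \<Rightarrow> 'a"
  assumes one_sided: "\<And>p q. inner (p - q) (f p - f q) \<le> L * (norm (p - q))\<^sup>2"
    and "0 \<le> L" "t0 \<le> t1"
    and \<phi>: "solution_on f \<phi> {t0..t1}"
    and \<psi>: "\<And>t. t \<in> {t0..t1} \<Longrightarrow> (\<psi> has_vector_derivative \<psi>' t) (at t within {t0..t1})"
    and err: "\<And>t. t \<in> {t0..t1} \<Longrightarrow> norm (\<psi>' t - f (\<psi> t)) \<le> \<eta>"
  shows "(norm (\<phi> t1 - \<psi> t1))\<^sup>2 \<le> exp ((2 * L + 1) * (t1 - t0)) * ((norm (\<phi> t0 - \<psi> t0))\<^sup>2 + \<eta>\<^sup>2)"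
proof -
  define \<Delta> where "\<Delta> = (\<lambda>t. \<phi> t - \<psi> t)"
  define D where "D = (\<lambda>t. inner (\<Delta> t) (\<Delta> t))"
  have \<Delta>: "(\<Delta> has_vector_derivative f (\<phi> t) - \<psi>' t) (at t within {t0..t1})" if "t \<in> {t0..t1}" for t
    unfolding \<Delta>_def using \<phi> \<psi> that
    by (auto simp: solution_on_def intro!: derivative_intros)
  have cont: "continuous_on {t0..t1} D"
    unfolding D_def using \<Delta>
    by (intro continuous_intros; metis continuous_on_eq_continuous_within has_vector_derivative_continuous)
  have "D t1 + \<eta>\<^sup>2 / (2 * L + 1) \<le> exp ((2 * L + 1) * (t1 - t0)) * (D t0 + \<eta>\<^sup>2 / (2 * L + 1))"
  proof (rule linear_differential_inequality[OF _ \<open>t0 \<le> t1\<close> cont])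
    show "2 * L + 1 \<noteq> 0" using \<open>0 \<le> L\<close> by simp
    fix t assume t: "t0 < t" "t < t1"
    then have "(\<Delta> has_vector_derivative f (\<phi> t) - \<psi>' t) (at t)"
      using \<Delta>[of t] by (simp add: at_within_Icc_at)
    then show "(D has_real_derivative 2 * inner (\<Delta> t) (f (\<phi> t) - \<psi>' t)) (at t)"
      unfolding D_def has_vector_derivative_def has_field_derivative_def
      by (auto intro!: derivative_eq_intros ext simp: inner_commute algebra_simps)
    have "inner (\<Delta> t) (f (\<phi> t) - \<psi>' t)
        = inner (\<Delta> t) (f (\<phi> t) - f (\<psi> t)) - inner (\<Delta> t) (\<psi>' t - f (\<psi> t))"
      by (simp add: inner_diff_right)
    also have "\<dots> \<le> L * (norm (\<Delta> t))\<^sup>2 + norm (\<Delta> t) * norm (\<psi>' t - f (\<psi> t))"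
      using one_sided[of "\<phi> t" "\<psi> t"] Cauchy_Schwarz_ineq2[of "\<Delta> t" "\<psi>' t - f (\<psi> t)"]
      by (auto simp: \<Delta>_def abs_le_iff)
    also have "\<dots> \<le> L * (norm (\<Delta> t))\<^sup>2 + norm (\<Delta> t) * \<eta>"
      using err[of t] t by (intro add_left_mono mult_left_mono) auto
    also have "2 * \<dots> \<le> (2 * L + 1) * (norm (\<Delta> t))\<^sup>2 + \<eta>\<^sup>2"
      using sum_squares_bound[of "norm (\<Delta> t)" \<eta>] by (simp add: algebra_simps)
    finally show "2 * inner (\<Delta> t) (f (\<phi> t) - \<psi>' t) \<le> (2 * L + 1) * D t + \<eta>\<^sup>2"
      by (simp add: D_def dot_square_norm)
  qed
  moreover have k: "\<eta>\<^sup>2 / (2 * L + 1) \<le> \<eta>\<^sup>2" "0 \<le> \<eta>\<^sup>2 / (2 * L + 1)"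
    using \<open>0 \<le> L\<close> by (auto simp: field_simps)
  moreover have "exp ((2 * L + 1) * (t1 - t0)) * (D t0 + \<eta>\<^sup>2 / (2 * L + 1))
      \<le> exp ((2 * L + 1) * (t1 - t0)) * (D t0 + \<eta>\<^sup>2)"
    using k by (intro mult_left_mono) auto
  ultimately have "D t1 \<le> exp ((2 * L + 1) * (t1 - t0)) * (D t0 + \<eta>\<^sup>2)" by linarith
  then show ?thesis by (simp add: D_def \<Delta>_def dot_square_norm)
qed

lemma forward_uniqueness:
  fixes f :: "'a::real_inner \<Rightarrow> 'a"
  assumes one_sided: "\<And>p q. inner (p - q) (f p - f q) \<le> L * (norm (p - q))\<^sup>2" and "0 \<le> L"
    and "solution_on f \<phi> {0..}" "solution_on f \<psi> {0..}" "\<phi> 0 = \<psi> 0" "0 \<le> t"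
  shows "\<phi> t = \<psi> t"
proof -
  have "(norm (\<phi> t - \<psi> t))\<^sup>2 \<le> exp ((2 * L + 1) * (t - 0)) * ((norm (\<phi> 0 - \<psi> 0))\<^sup>2 + 0\<^sup>2)"
  proof (rule one_sided_gronwall[OF one_sided \<open>0 \<le> L\<close> \<open>0 \<le> t\<close>])
    show "solution_on f \<phi> {0..t}" using assms by (auto intro: solution_on_subset)
    show "(\<psi> has_vector_derivative f (\<psi> s)) (at s within {0..t})" if "s \<in> {0..t}" for s
      using solution_on_subset[of f \<psi> "{0..}" "{0..t}"] assms that by (auto simp: solution_on_def)
  qed simp
  then show ?thesis using assms by simp
qed

lemma lipschitz_uniqueness:
  fixes f :: "'a::real_inner \<Rightarrow> 'a"
  assumes lip: "L-lipschitz_on UNIV f"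
    and \<phi>: "solution_on f \<phi> UNIV" and \<psi>: "solution_on f \<psi> UNIV" and "\<phi> 0 = \<psi> 0"
  shows "\<phi> = \<psi>"
proof
  have L: "0 \<le> L" using lip by (rule lipschitz_on_nonneg)
  have osl: "inner (p - q) (g p - g q) \<le> L * (norm (p - q))\<^sup>2"
    if "L-lipschitz_on UNIV g" for g :: "'a \<Rightarrow> 'a" and p q
  proof -
    have "inner (p - q) (g p - g q) \<le> norm (p - q) * norm (g p - g q)" by (rule norm_cauchy_schwarz)
    also have "\<dots> \<le> norm (p - q) * (L * norm (p - q))"
      using lipschitz_on_normD[OF that, of p q] by (intro mult_left_mono) auto
    finally show ?thesis by (simp add: power2_eq_square mult_ac)
  qed
  fix t
  show "\<phi> t = \<psi> t"
  proof (cases "0 \<le> t")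
    case True
    then show ?thesis
      using forward_uniqueness[OF osl[OF lip] L, of \<phi> \<psi> t] assms solution_on_subset[of f _ UNIV]
      by blast
  next
    case False
    have "\<phi> (- (- t)) = \<psi> (- (- t))"
      using solution_on_reverse[OF \<phi>] solution_on_reverse[OF \<psi>] False \<open>\<phi> 0 = \<psi> 0\<close>
      by (intro forward_uniqueness[OF osl[OF lipschitz_on_minus[OF lip]] L,
            of "\<lambda>t. \<phi> (- t)" "\<lambda>t. \<psi> (- t)" "- t"])
        (auto intro: solution_on_subset)
    then show ?thesis by simp
  qed
qed


section \<open>Planar fields with a scalar nonlinearity, and barriers\<close>

text \<open>With \<open>u = y + a\<close> this is Rayleigh's equation \<open>u'' + u = d/dt g(u - a)\<close>; the Le Corbeiller system, its
linear limit, and the truncated system used to define a flow are all of this form.\<close>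

definition rayleigh_field :: "real \<Rightarrow> (real \<Rightarrow> real) \<Rightarrow> real \<times> real \<Rightarrow> real \<times> real" where
  "rayleigh_field a g = (\<lambda>(x, y). (y + a, - x + g y))"

lemma le_corbeiller_eq: "le_corbeiller a b \<epsilon> = rayleigh_field a (\<lambda>y. b * y * (2 - exp (y / \<epsilon>)))"
  by (simp add: le_corbeiller_def rayleigh_field_def)

lemma linear_field_eq: "linear_field a b = rayleigh_field a (\<lambda>y. 2 * b * y)"
  by (simp add: linear_field_def rayleigh_field_def)

lemma abs_fst_le_norm: "\<bar>fst z\<bar> \<le> norm z" and abs_snd_le_norm: "\<bar>snd z\<bar> \<le> norm z"
  for z :: "real \<times> real"
  using norm_fst_le[of "fst z" "snd z"] norm_snd_le[of "snd z" "fst z"] by simp_all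

text \<open>The rotational part of the field is skew and drops out, so only the slope of \<open>g\<close> from above
matters.\<close>

lemma rayleigh_one_sided:
  assumes "\<And>y z. (y - z) * (g y - g z) \<le> L * (y - z)\<^sup>2" "0 \<le> L"
  shows "inner (p - q) (rayleigh_field a g p - rayleigh_field a g q) \<le> L * (norm (p - q))\<^sup>2"
proof -
  obtain x y x' y' where pq: "p = (x, y)" "q = (x', y')" by fastforce
  have "inner (p - q) (rayleigh_field a g p - rayleigh_field a g q) = (y - y') * (g y - g y')"
    by (simp add: pq rayleigh_field_def algebra_simps)
  also have "\<dots> \<le> L * (y - y')\<^sup>2" by (rule assms)
  also have "\<dots> \<le> L * (norm (p - q))\<^sup>2"
    using \<open>0 \<le> L\<close> by (intro mult_left_mono) (auto simp: pq norm_Pair)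
  finally show ?thesis .
qed

lemma rayleigh_lipschitz:
  assumes "L-lipschitz_on UNIV g"
  shows "(2 + L)-lipschitz_on UNIV (rayleigh_field a g)"
proof (rule lipschitz_onI)
  have L: "0 \<le> L" using assms by (rule lipschitz_on_nonneg)
  then show "0 \<le> 2 + L" by simp
  fix p q :: "real \<times> real"
  obtain x y x' y' where pq: "p = (x, y)" "q = (x', y')" by fastforce
  have x: "\<bar>x - x'\<bar> \<le> norm (p - q)" and y: "\<bar>y - y'\<bar> \<le> norm (p - q)"
    using norm_fst_le[of "x - x'" "y - y'"] norm_snd_le[of "y - y'" "x - x'"] by (auto simp: pq)
  have "norm (rayleigh_field a g p - rayleigh_field a g q) \<le> \<bar>y - y'\<bar> + \<bar>(x' - x) + (g y - g y')\<bar>"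
    using norm_Pair_le[of "y - y'" "(x' - x) + (g y - g y')"] by (simp add: pq rayleigh_field_def algebra_simps)
  also have "\<dots> \<le> \<bar>y - y'\<bar> + (\<bar>x - x'\<bar> + L * \<bar>y - y'\<bar>)"
    using lipschitz_on_normD[OF assms, of y y'] by auto
  also have "\<dots> \<le> norm (p - q) + (norm (p - q) + L * norm (p - q))"
    using x y L by (intro add_mono mult_left_mono) auto
  finally show "dist (rayleigh_field a g p) (rayleigh_field a g q) \<le> (2 + L) * dist p q"
    by (simp add: dist_norm algebra_simps)
qed

lemma rayleigh_solution_on_iff:
  "solution_on (rayleigh_field a g) \<phi> I \<longleftrightarrow>
    (\<forall>t\<in>I. ((\<lambda>t. fst (\<phi> t)) has_real_derivative snd (\<phi> t) + a) (at t within I) \<and>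
         ((\<lambda>t. snd (\<phi> t)) has_real_derivative - fst (\<phi> t) + g (snd (\<phi> t))) (at t within I))"
  (is "?l \<longleftrightarrow> ?r")
proof
  assume ?l
  then show ?r
    unfolding solution_on_def has_real_derivative_iff_has_vector_derivative
    using bounded_linear.has_vector_derivative[OF bounded_linear_fst]
      bounded_linear.has_vector_derivative[OF bounded_linear_snd]
    by (fastforce simp: rayleigh_field_def case_prod_beta)
next
  assume ?r
  then show ?l
    unfolding solution_on_def has_real_derivative_iff_has_vector_derivative
    using has_vector_derivative_Pair[of "\<lambda>t. fst (\<phi> t)" _ _ I "\<lambda>t. snd (\<phi> t)"]
    by (simp add: rayleigh_field_def case_prod_beta)
qed

text \<open>Two barriers have to be treated together: that the orbit stays below the upper one is only known
while it stays above the lower one, and conversely. Hence the inward condition at a touching time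
may use both inequalities at all earlier times.\<close>

lemma joint_barrier:
  fixes w1 w2 d1 d2 :: "real \<Rightarrow> real"
  assumes der1: "\<And>t. t \<in> {t0..t1} \<Longrightarrow> (w1 has_real_derivative d1 t) (at t)"
    and der2: "\<And>t. t \<in> {t0..t1} \<Longrightarrow> (w2 has_real_derivative d2 t) (at t)"
    and init: "0 \<le> w1 t0" "0 \<le> w2 t0"
    and inward1: "\<And>t. t \<in> {t0..t1} \<Longrightarrow> \<forall>s\<in>{t0..t}. 0 \<le> w1 s \<and> 0 \<le> w2 s \<Longrightarrow> w1 t = 0 \<Longrightarrow> 0 < d1 t"
    and inward2: "\<And>t. t \<in> {t0..t1} \<Longrightarrow> \<forall>s\<in>{t0..t}. 0 \<le> w1 s \<and> 0 \<le> w2 s \<Longrightarrow> w2 t = 0 \<Longrightarrow> 0 < d2 t"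
    and "t \<in> {t0..t1}"
  shows "0 \<le> w1 t \<and> 0 \<le> w2 t"
proof (rule ccontr)
  assume neg: "\<not> ?thesis"
  define B where "B = {s \<in> {t0..t1}. w1 s < 0 \<or> w2 s < 0}"
  define m where "m = Inf B"
  have tB: "t \<in> B" using neg \<open>t \<in> {t0..t1}\<close> by (auto simp: B_def)
  have bdd: "bdd_below B" unfolding B_def by (rule bdd_belowI[of _ t0]) auto
  have m: "t0 \<le> m" "m \<le> t1"
  proof -
    show "t0 \<le> m" unfolding m_def using tB by (intro cInf_greatest) (auto simp: B_def)
    have "m \<le> t" unfolding m_def using tB bdd by (rule cInf_lower)
    then show "m \<le> t1" using \<open>t \<in> {t0..t1}\<close> by simp
  qed
  have before: "s \<notin> B" if "s < m" for s
    using that cInf_lower[OF _ bdd, of s] by (metis m_def not_le)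
  have keep: "0 \<le> w m" if "0 \<le> w t0" "isCont w m" and nn: "\<And>s. t0 \<le> s \<Longrightarrow> s < m \<Longrightarrow> 0 \<le> w s"
    for w :: "real \<Rightarrow> real"
  proof (cases "m = t0")
    case False
    show ?thesis
    proof (rule tendsto_lowerbound)
      show "(w \<longlongrightarrow> w m) (at_left m)"
        using that by (simp add: isCont_def filterlim_at_split)
      show "\<forall>\<^sub>F s in at_left m. 0 \<le> w s"
        unfolding eventually_at_left_field using False m nn by (auto intro!: exI[of _ t0])
    qed simp
  qed (use that in simp)
  have w: "0 \<le> w1 m" "0 \<le> w2 m"
  proof -
    have old: "0 \<le> w1 s \<and> 0 \<le> w2 s" if "t0 \<le> s" "s < m" for s
      using before[OF that(2)] that m by (auto simp: B_def not_less)
    show "0 \<le> w1 m" using keep[OF init(1) DERIV_isCont[OF der1]] old m by simp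
    show "0 \<le> w2 m" using keep[OF init(2) DERIV_isCont[OF der2]] old m by simp
  qed
  then have hist: "\<forall>s\<in>{t0..m}. 0 \<le> w1 s \<and> 0 \<le> w2 s"
  proof (intro ballI)
    fix s assume "s \<in> {t0..m}"
    then show "0 \<le> w1 s \<and> 0 \<le> w2 s"
      using before[of s] w m by (cases "s = m") (auto simp: B_def not_less)
  qed
  have right: "\<exists>e>0. \<forall>s\<in>{m..<m+e}. 0 \<le> w s"
    if nonneg: "0 \<le> w m" and der: "(w has_real_derivative d) (at m)" and pos: "w m = 0 \<Longrightarrow> 0 < d" for w d
  proof (cases "w m = 0")
    case True
    then obtain e where "e > 0" "\<forall>h>0. h < e \<longrightarrow> w m < w (m + h)"
      using DERIV_pos_inc_right[OF der pos[OF True]] by blast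
    then have "0 \<le> w s" if "s \<in> {m..<m+e}" for s
      using True that by (cases "s = m") (auto dest!: spec[of _ "s - m"])
    then show ?thesis using \<open>e > 0\<close> by blast
  next
    case False
    have "w m > 0" and "isCont w m" using nonneg DERIV_isCont[OF der] False by auto
    then have "\<forall>\<^sub>F s in at m. 0 < w s"
      by (intro order_tendstoD(1)[of w "w m"]) (auto simp: isCont_def)
    then obtain e where "e > 0" "\<forall>s. s \<noteq> m \<and> dist s m < e \<longrightarrow> 0 < w s"
      by (auto simp: eventually_at)
    then have "0 \<le> w s" if "s \<in> {m..<m+e}" for s
      using nonneg that by (cases "s = m") (auto simp: dist_real_def less_imp_le)
    then show ?thesis using \<open>e > 0\<close> by blast
  qed
  obtain e1 where e1: "e1 > 0" "\<forall>s\<in>{m..<m+e1}. 0 \<le> w1 s"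
    using right[OF w(1) der1 inward1[OF _ hist]] m by auto
  obtain e2 where e2: "e2 > 0" "\<forall>s\<in>{m..<m+e2}. 0 \<le> w2 s"
    using right[OF w(2) der2 inward2[OF _ hist]] m by auto
  have "m + min e1 e2 \<le> s" if "s \<in> B" for s
  proof (rule ccontr)
    assume "\<not> ?thesis"
    moreover have "m \<le> s" using before[of s] that by (meson not_le)
    ultimately have "0 \<le> w1 s" "0 \<le> w2 s" using e1(2) e2(2) by auto
    then show False using that by (auto simp: B_def)
  qed
  then have "m + min e1 e2 \<le> m" unfolding m_def using tB by (intro cInf_greatest) auto
  then show False using e1(1) e2(1) by simp
qed

section \<open>The orbit of the fold point\<close>

text \<open>The explicit solution of the linear system through the fold point; \<open>sqrt (1 - b\<^sup>2)\<close> is its rotation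
frequency. The height \<open>y\<close> and its derivative determine \<open>x\<close> through \<open>y' = - x + 2 b y\<close>.\<close>

definition fold_velocity :: "real \<Rightarrow> real \<Rightarrow> real \<Rightarrow> real" where
  "fold_velocity a b t = - (a / sqrt (1 - b\<^sup>2)) * (exp (b * t) * sin (sqrt (1 - b\<^sup>2) * t))"

definition fold_height :: "real \<Rightarrow> real \<Rightarrow> real \<Rightarrow> real" where
  "fold_height a b t = a * (exp (b * t) * (cos (sqrt (1 - b\<^sup>2) * t)
     - b / sqrt (1 - b\<^sup>2) * sin (sqrt (1 - b\<^sup>2) * t))) - a"

context
  fixes a b :: real
  assumes b: "0 < b" "b < 1" and a: "0 < a"
begin

private lemma omega: "0 < sqrt (1 - b\<^sup>2)" "(sqrt (1 - b\<^sup>2))\<^sup>2 = 1 - b\<^sup>2"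
proof -
  have "b\<^sup>2 < 1" using b by (simp add: abs_square_less_1)
  then show "0 < sqrt (1 - b\<^sup>2)" "(sqrt (1 - b\<^sup>2))\<^sup>2 = 1 - b\<^sup>2" by simp_all
qed

lemma fold_height_deriv: "(fold_height a b has_real_derivative fold_velocity a b t) (at t)"
proof -
  define w where "w = sqrt (1 - b\<^sup>2)"
  have w: "0 < w" "w * w = 1 - b * b" using omega by (auto simp: w_def power2_eq_square)
  define S C E where "S = sin (w * t)" and "C = cos (w * t)" and "E = exp (b * t)"
  have "((\<lambda>t. a * (exp (b * t) * (cos (w * t) - k * sin (w * t))) - a) has_real_derivative
      a * (b * E * (C - k * S) + E * (- w * S - k * (w * C)))) (at t)" for k
    unfolding S_def C_def E_def by (auto intro!: derivative_eq_intros simp: algebra_simps)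
  then have "(fold_height a b has_real_derivative
      a * (b * E * (C - b / w * S) + E * (- w * S - b / w * (w * C)))) (at t)"
    unfolding fold_height_def[abs_def] w_def[symmetric] .
  also have "a * (b * E * (C - b / w * S) + E * (- w * S - b / w * (w * C))) = - (a / w) * (E * S)"
  proof -
    have "w * (a * (b * E * (C - b / w * S) + E * (- w * S - b / w * (w * C)))) = - a * E * S * (b * b + w * w)"
      using w(1) by (simp add: algebra_simps)
    also have "\<dots> = - a * E * S" using w by simp
    finally show ?thesis using w(1) by (simp add: field_simps)
  qed
  finally show ?thesis by (simp add: fold_velocity_def S_def E_def w_def)
qed

lemma fold_velocity_deriv:
  "(fold_velocity a b has_real_derivative 2 * b * fold_velocity a b t - (fold_height a b t + a)) (at t)"
proof -
  define w where "w = sqrt (1 - b\<^sup>2)"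
  have w: "0 < w" using omega by (auto simp: w_def)
  define S C E where "S = sin (w * t)" and "C = cos (w * t)" and "E = exp (b * t)"
  have "((\<lambda>t. - k * (exp (b * t) * sin (w * t))) has_real_derivative
      - k * (b * E * S + E * (w * C))) (at t)" for k
    unfolding S_def C_def E_def by (auto intro!: derivative_eq_intros simp: algebra_simps)
  then have "(fold_velocity a b has_real_derivative - (a / w) * (b * E * S + E * (w * C))) (at t)"
    unfolding fold_velocity_def[abs_def] w_def[symmetric] .
  also have "- (a / w) * (b * E * S + E * (w * C)) = 2 * b * (- (a / w) * (E * S)) - (a * (E * (C - b / w * S)) - a + a)"
  proof -
    have "w * (- (a / w) * (b * E * S + E * (w * C))) =
        w * (2 * b * (- (a / w) * (E * S)) - (a * (E * (C - b / w * S)) - a + a))"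
      using w by (simp add: algebra_simps)
    then show ?thesis using w by (metis mult_left_cancel less_irrefl)
  qed
  finally show ?thesis
    unfolding fold_velocity_def[of a b t] fold_height_def S_def C_def E_def w_def .
qed

lemma fold_orbit_eq: "fold_orbit a b = (\<lambda>t. (2 * b * fold_height a b t - fold_velocity a b t, fold_height a b t))"
  (is "_ = ?\<phi>")
  unfolding fold_orbit_def
proof (rule the_equality)
  have "solution_on (linear_field a b) ?\<phi> UNIV"
    unfolding linear_field_eq rayleigh_solution_on_iff
    by (auto intro!: derivative_eq_intros fold_height_deriv fold_velocity_deriv)
  moreover have "?\<phi> 0 = (0, 0)" by (simp add: fold_height_def fold_velocity_def)
  ultimately show *: "solution_on (linear_field a b) ?\<phi> UNIV \<and> ?\<phi> 0 = (0, 0)" ..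
  have lip: "(2 + 2 * b)-lipschitz_on UNIV (linear_field a b)"
    unfolding linear_field_eq
    by (intro rayleigh_lipschitz lipschitz_onI) (use b in \<open>auto simp: dist_real_def abs_mult simp flip: right_diff_distrib\<close>)
  show "\<psi> = ?\<phi>" if "solution_on (linear_field a b) \<psi> UNIV \<and> \<psi> 0 = (0, 0)" for \<psi>
    by (rule lipschitz_uniqueness[OF lip]) (use that * in auto)
qed

lemma fold_orbit_solution: "solution_on (linear_field a b) (fold_orbit a b) UNIV"
  unfolding linear_field_eq rayleigh_solution_on_iff fold_orbit_eq
    by (auto intro!: derivative_eq_intros fold_height_deriv fold_velocity_deriv)

lemma fold_orbit_0: "fold_orbit a b 0 = (0, 0)"
  by (simp add: fold_orbit_eq fold_height_def fold_velocity_def)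

text \<open>The velocity has the sign of \<open>- sin\<close>, so the height decreases during the first half turn and increases
during the second, at whose end the expanding factor has carried it above 0. It therefore
vanishes exactly once after time 0, with positive velocity, and there \<open>x = - y'\<close> is negative.\<close>

lemma fold_return:
  shows "0 < return_time a b" and "fold_orbit a b (return_time a b) = (x_d a b, 0)"
    and "\<And>t. 0 < t \<Longrightarrow> t < return_time a b \<Longrightarrow> snd (fold_orbit a b t) < 0"
    and "x_d a b < 0"
proof -
  define w where "w = sqrt (1 - b\<^sup>2)"
  have w: "0 < w" using omega by (simp add: w_def)
  let ?y = "fold_height a b" and ?v = "fold_velocity a b"
  have v: "?v t = - (a / w) * (exp (b * t) * sin (w * t))" for t
    by (simp add: fold_velocity_def w_def)
  have vneg: "?v t < 0" if "0 < t" "t < pi / w" for t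
  proof -
    have "0 < sin (w * t)" using that w by (intro sin_gt_zero) (auto simp: field_simps)
    then show ?thesis using a w by (simp add: v)
  qed
  have vpos: "0 < ?v t" if "pi / w < t" "t < 2 * pi / w" for t
  proof -
    have "sin (w * t) < 0" using that w by (intro sin_lt_zero) (auto simp: field_simps)
    then show ?thesis using a w by (simp add: v mult_pos_neg field_simps)
  qed
  have cont: "continuous_on S ?y" for S
    using fold_height_deriv by (meson DERIV_continuous continuous_at_imp_continuous_on)
  have down: "?y t < 0" if "0 < t" "t \<le> pi / w" for t
  proof -
    have "?y t < ?y 0"
    proof (rule DERIV_neg_imp_decreasing_open[OF that(1) _ cont])
      fix z assume "0 < z" "z < t"
      then show "\<exists>d. (?y has_real_derivative d) (at z) \<and> d < 0"
        using that vneg[of z] fold_height_deriv[of z] by (intro exI[of _ "?v z"]) auto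
    qed
    then show ?thesis by (simp add: fold_height_def)
  qed
  have up: "?y s < ?y t" if "pi / w \<le> s" "s < t" "t \<le> 2 * pi / w" for s t
  proof (rule DERIV_pos_imp_increasing_open[OF that(2) _ cont])
    fix z assume "s < z" "z < t"
    then show "\<exists>d. (?y has_real_derivative d) (at z) \<and> 0 < d"
      using that vpos[of z] fold_height_deriv[of z] by (intro exI[of _ "?v z"]) auto
  qed
  have "0 < ?y (2 * pi / w)"
  proof -
    have "?y (2 * pi / w) = a * exp (b * (2 * pi / w)) - a"
      using w by (simp add: fold_height_def w_def[symmetric])
    moreover have "1 < exp (b * (2 * pi / w))" using b w by simp
    ultimately show ?thesis using a by simp
  qed
  moreover have piw: "0 < pi / w" "pi / w \<le> 2 * pi / w" using w by (auto simp: field_simps)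
  ultimately obtain T where T: "pi / w \<le> T" "T \<le> 2 * pi / w" "?y T = 0"
    using IVT'[of ?y "pi / w" 0 "2 * pi / w"] cont down[of "pi / w"] by force
  have T1: "pi / w < T" using T down[of T] piw by fastforce
  have T2: "T < 2 * pi / w" using T \<open>0 < ?y (2 * pi / w)\<close> by (cases "T = 2 * pi / w") auto
  have below: "?y t < 0" if "0 < t" "t < T" for t
    using down[of t] up[of t T] that T by (cases "t \<le> pi / w") auto
  have R: "return_time a b = T"
    unfolding return_time_def
  proof (rule Least_equality)
    show "0 < T \<and> snd (fold_orbit a b T) = 0" using T T1 piw by (simp add: fold_orbit_eq)
    show "T \<le> t" if "0 < t \<and> snd (fold_orbit a b t) = 0" for t
      using below[of t] that by (force simp: fold_orbit_eq)
  qed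
  show "0 < return_time a b" using R T1 piw by simp
  show "fold_orbit a b (return_time a b) = (x_d a b, 0)"
    by (simp add: x_d_def R) (simp add: fold_orbit_eq T)
  show "snd (fold_orbit a b t) < 0" if "0 < t" "t < return_time a b" for t
    using below that R by (simp add: fold_orbit_eq)
  show "x_d a b < 0"
    using vpos[OF T1 T2] by (simp add: x_d_def R) (simp add: fold_orbit_eq T)
qed

end


section \<open>One turn around the cycle\<close>

text \<open>The set of hitting times is compact, so there is a first one, and the intermediate value theorem
rules out values above \<open>c\<close> before it.\<close>

lemma first_hit:
  fixes f :: "real \<Rightarrow> real"
  assumes "u \<le> v" "f u \<le> c" "c \<le> f v" and cont: "continuous_on {u..v} f"
  shows "\<exists>t\<in>{u..v}. f t = c \<and> (\<forall>s\<in>{u..t}. f s \<le> c)"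
proof -
  define Z where "Z = {u..v} \<inter> f -` {c}"
  have "closed Z" unfolding Z_def by (rule continuous_closed_preimage[OF cont]) auto
  then have "compact Z" by (auto simp: compact_eq_bounded_closed Z_def intro: bounded_subset[of "{u..v}"])
  moreover have "Z \<noteq> {}" using IVT'[of f u c v] assms by (auto simp: Z_def)
  ultimately obtain t where t: "t \<in> Z" "\<And>s. s \<in> Z \<Longrightarrow> t \<le> s" using compact_attains_inf by metis
  have "f s \<le> c" if s: "s \<in> {u..t}" for s
  proof (rule ccontr)
    assume "\<not> f s \<le> c"
    then have "\<exists>z\<ge>u. z \<le> s \<and> f z = c"
      using s t(1) assms(2) by (intro IVT' continuous_on_subset[OF cont]) (auto simp: Z_def)
    then obtain z where z: "u \<le> z" "z \<le> s" "f z = c" by blast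
    then have "t \<le> z" using s t(1) by (intro t(2)) (auto simp: Z_def)
    then have "z = s" using z s by auto
    with z \<open>\<not> f s \<le> c\<close> show False by simp
  qed
  then show ?thesis using t(1) by (auto simp: Z_def)
qed

locale lipschitz_rayleigh =
  fixes a :: real and g :: "real \<Rightarrow> real" and L :: real
  assumes a_pos: "0 < a"
    and g_lipschitz: "L-lipschitz_on UNIV g"
    and g_one_sided: "\<And>y z. (y - z) * (g y - g z) \<le> 3 * (y - z)\<^sup>2"
begin

definition flow :: "real \<times> real \<Rightarrow> real \<Rightarrow> real \<times> real" where
  "flow p = (SOME \<phi>. \<phi> 0 = p \<and> solution_on (rayleigh_field a g) \<phi> UNIV)"

lemma flow_solves: "flow p 0 = p" "solution_on (rayleigh_field a g) (flow p) UNIV"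
  using someI_ex[OF picard_lindelof[OF rayleigh_lipschitz[OF g_lipschitz, of a], of p]]
  by (auto simp: flow_def)

lemma flow_unique: "solution_on (rayleigh_field a g) \<phi> UNIV \<Longrightarrow> \<phi> = flow (\<phi> 0)"
  by (rule lipschitz_uniqueness[OF rayleigh_lipschitz[OF g_lipschitz]]) (auto simp: flow_solves)

lemma flow_add: "flow p (s + t) = flow (flow p s) t"
  using flow_unique[OF solution_on_shift[OF flow_solves(2), of p s]]
  by (metis add.commute add_0)

lemma flow_X: "((\<lambda>t. fst (flow p t)) has_real_derivative snd (flow p t) + a) (at t)"
  and flow_Y: "((\<lambda>t. snd (flow p t)) has_real_derivative - fst (flow p t) + g (snd (flow p t))) (at t)"
  using flow_solves(2)[of p] by (auto simp: rayleigh_solution_on_iff)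

lemma flow_continuous: "continuous_on S (flow p)"
  using flow_solves(2)[of p] unfolding solution_on_UNIV_iff
  by (meson continuous_at_imp_continuous_on has_vector_derivative_continuous)

lemma field_one_sided:
  "inner (p - q) (rayleigh_field a g p - rayleigh_field a g q) \<le> 3 * (norm (p - q))\<^sup>2"
  by (rule rayleigh_one_sided[OF g_one_sided]) simp

lemma flow_expansion:
  assumes "0 \<le> t" "t \<le> T"
  shows "norm (flow p t - flow q t) \<le> exp (4 * T) * norm (p - q)"
proof -
  have "(norm (flow p t - flow q t))\<^sup>2 \<le> exp ((2 * 3 + 1) * (t - 0)) * ((norm (flow p 0 - flow q 0))\<^sup>2 + 0\<^sup>2)"
  proof (rule one_sided_gronwall[OF field_one_sided, where \<psi>' = "\<lambda>t. rayleigh_field a g (flow q t)"])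
    show "solution_on (rayleigh_field a g) (flow p) {0..t}"
      using flow_solves(2) by (rule solution_on_subset) auto
    show "(flow q has_vector_derivative rayleigh_field a g (flow q u)) (at u within {0..t})" for u
      using flow_solves(2)[of q] by (auto simp: solution_on_UNIV_iff intro: has_vector_derivative_at_within)
  qed (use assms in auto)
  also have "\<dots> = exp (7 * t) * (norm (p - q))\<^sup>2" by (simp add: flow_solves)
  also have "\<dots> \<le> exp (8 * T) * (norm (p - q))\<^sup>2"
    using assms by (intro mult_right_mono) auto
  also have "\<dots> = (exp (4 * T) * norm (p - q))\<^sup>2"
    by (simp add: power_mult_distrib flip: exp_double)
  finally show ?thesis by (rule power2_le_imp_le) auto
qed

lemma X_lower:
  assumes "u \<le> v" "\<And>t. t \<in> {u..v} \<Longrightarrow> c \<le> snd (flow p t)"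
  shows "(c + a) * (v - u) \<le> fst (flow p v) - fst (flow p u)"
proof (cases "u = v")
  case False
  then obtain z where z: "u < z" "z < v" "fst (flow p v) - fst (flow p u) = (v - u) * (snd (flow p z) + a)"
    using MVT2[of u v "\<lambda>t. fst (flow p t)" "\<lambda>t. snd (flow p t) + a"] assms(1) flow_X by auto
  then show ?thesis using assms(2)[of z] assms(1) by (simp add: mult_left_mono mult.commute)
qed simp

lemma X_upper:
  assumes "u \<le> v" "\<And>t. t \<in> {u..v} \<Longrightarrow> snd (flow p t) \<le> c"
  shows "fst (flow p v) - fst (flow p u) \<le> (c + a) * (v - u)"
proof (cases "u = v")
  case False
  then obtain z where z: "u < z" "z < v" "fst (flow p v) - fst (flow p u) = (v - u) * (snd (flow p z) + a)"
    using MVT2[of u v "\<lambda>t. fst (flow p t)" "\<lambda>t. snd (flow p t) + a"] assms(1) flow_X by auto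
  then show ?thesis using assms(2)[of z] assms(1) by (simp add: mult_left_mono mult.commute)
qed simp

end

text \<open>Upper bound for the duration of one turn: after the fold orbit has returned, \<open>x\<close> increases at
speed at least \<open>a / 2\<close>.\<close>

definition turn_time :: "real \<Rightarrow> real \<Rightarrow> real" where
  "turn_time a b = return_time a b + 2 * (1 - x_d a b) / a"

text \<open>Lower bound for the time spent under strong damping: \<open>x\<close> has to cover at least a quarter of
\<open>[x_d, 0]\<close> at speed at most \<open>a + 1\<close>.\<close>

definition slide_time :: "real \<Rightarrow> real \<Rightarrow> real" where
  "slide_time a b = (- x_d a b / 4) / (a + 1)"

text \<open>What one turn needs to know about the nonlinearity \<open>g\<close>. The section is \<open>{- \<delta>} \<times> {0..h}\<close>, a short
transversal to the sliding motion just before the fold; \<open>\<kappa>\<close> bounds the distance to the fold orbit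
during the excursion into \<open>y < 0\<close>. Below 0, \<open>g\<close> is linear up to \<open>e\<close>. The level \<open>s\<close> is where the strong
damping begins and is a lower barrier for the sliding motion (\<open>g_floor\<close>); the level \<open>h\<close> is
an upper barrier (\<open>g_roof\<close>) for \<open>x \<ge> - M\<close>. Condition \<open>g_entry\<close> makes \<open>y\<close> grow at a definite rate from
\<open>- \<kappa>\<close> to \<open>s\<close> while \<open>x\<close> is near the drop point, and \<open>entry_short\<close> keeps \<open>x\<close> below
\<open>x_d / 2\<close> meanwhile.\<close>

locale relaxation_loop = lipschitz_rayleigh a g L
  for a :: real and g :: "real \<Rightarrow> real" and L :: real +
  fixes b B e \<delta> h \<kappa> s M :: real
  assumes b_range: "0 < b" "b < 1"
    and fold_bound: "\<And>t. t \<in> {0..return_time a b} \<Longrightarrow> norm (fold_orbit a b t) \<le> B"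
    and g_linear: "\<And>y. y \<le> 0 \<Longrightarrow> \<bar>g y - 2 * b * y\<bar> \<le> e"
    and g_entry: "\<And>y. - \<kappa> \<le> y \<Longrightarrow> y \<le> s \<Longrightarrow> x_d a b / 4 < g y"
    and g_floor: "- \<delta> < g s"
    and g_roof: "g h < - M"
    and M_large: "B + 1 \<le> M"
    and sizes: "0 < \<delta>" "\<delta> \<le> \<kappa>" "0 < s" "s < h" "h \<le> \<kappa>" "\<kappa> \<le> 1" "\<kappa> \<le> a / 2" "\<kappa> \<le> - x_d a b / 4" "0 \<le> e" "e \<le> 1"
    and entry_short: "\<kappa> * (1 + 8 * (a + 1) / (- x_d a b)) \<le> - x_d a b / 2"
    and close: "exp (7 * return_time a b) * (\<delta>\<^sup>2 + h\<^sup>2 + e\<^sup>2) \<le> \<kappa>\<^sup>2"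
begin

abbreviation "Tr \<equiv> return_time a b"
abbreviation "xd \<equiv> x_d a b"
abbreviation "X q t \<equiv> fst (flow (- \<delta>, q) t)"
abbreviation "Y q t \<equiv> snd (flow (- \<delta>, q) t)"

abbreviation "T_max \<equiv> turn_time a b"
abbreviation "t_slide \<equiv> slide_time a b"

text \<open>The time at which the rising lower barrier \<open>- \<kappa> + (- xd / 4) * (t - Tr)\<close> reaches the level \<open>s\<close>.\<close>

definition "t_entry = Tr + (\<kappa> + s) * 4 / (- xd)"

lemmas fold_facts = fold_return[OF b_range a_pos]

text \<open>The section lies within \<open>\<delta> + h\<close> of the fold point, so an orbit starting on it can be compared with
the fold orbit from time 0 on, wherever it actually leaves \<open>y \<ge> 0\<close>: the one-sided estimate is not
affected by the strong damping there.\<close>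

lemma fold_shadowing:
  assumes q: "q \<in> {0..h}" and t: "t \<in> {0..Tr}"
  shows "norm (flow (- \<delta>, q) t - fold_orbit a b t) \<le> \<kappa>"
proof -
  let ?w = "fold_orbit a b"
  have "(norm (flow (- \<delta>, q) t - ?w t))\<^sup>2
      \<le> exp ((2 * 3 + 1) * (t - 0)) * ((norm (flow (- \<delta>, q) 0 - ?w 0))\<^sup>2 + e\<^sup>2)"
  proof (rule one_sided_gronwall[OF field_one_sided, where \<psi>' = "\<lambda>t. linear_field a b (?w t)"])
    show "solution_on (rayleigh_field a g) (flow (- \<delta>, q)) {0..t}"
      using flow_solves(2) by (rule solution_on_subset) auto
    fix u assume u: "u \<in> {0..t}"
    show "(?w has_vector_derivative linear_field a b (?w u)) (at u within {0..t})"
      using fold_orbit_solution[OF b_range a_pos]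
      by (auto simp: solution_on_UNIV_iff intro: has_vector_derivative_at_within)
    have "snd (?w u) \<le> 0"
      using u t fold_facts(3)[of u] fold_facts(2) fold_orbit_0[OF b_range a_pos]
      by (cases "u = 0"; cases "u = Tr") auto
    then show "norm (linear_field a b (?w u) - rayleigh_field a g (?w u)) \<le> e"
      using g_linear[of "snd (?w u)"]
      by (simp add: linear_field_def rayleigh_field_def case_prod_beta norm_Pair abs_minus_commute)
  qed (use t in auto)
  also have "(norm (flow (- \<delta>, q) 0 - ?w 0))\<^sup>2 = \<delta>\<^sup>2 + q\<^sup>2"
    by (simp add: flow_solves fold_orbit_0[OF b_range a_pos] norm_Pair)
  also have "exp ((2 * 3 + 1) * (t - 0)) * (\<delta>\<^sup>2 + q\<^sup>2 + e\<^sup>2) \<le> exp (7 * Tr) * (\<delta>\<^sup>2 + h\<^sup>2 + e\<^sup>2)"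
    using q t sizes by (intro mult_mono add_mono power_mono) auto
  also have "\<dots> \<le> \<kappa>\<^sup>2" by (rule close)
  finally show ?thesis by (rule power2_le_imp_le) (use sizes in auto)
qed

lemma xd_bound: "- B \<le> xd"
  using fold_bound[of Tr] fold_facts(1,2) norm_fst_le[of xd "0::real"] by simp

lemma roof_before_return:
  assumes q: "q \<in> {0..h}" and t: "t \<in> {0..Tr}"
  shows "Y q t \<le> h"
proof -
  have "0 \<le> h - Y q t \<and> 0 \<le> h - Y q t"
  proof (rule joint_barrier[where ?t0.0 = 0 and ?t1.0 = Tr and ?w1.0 = "\<lambda>t. h - Y q t" and ?w2.0 = "\<lambda>t. h - Y q t"])
    fix u assume u: "u \<in> {0..Tr}"
    show "((\<lambda>t. h - Y q t) has_real_derivative X q u - g (Y q u)) (at u)"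
      by (auto intro!: derivative_eq_intros flow_Y)
    then show "((\<lambda>t. h - Y q t) has_real_derivative X q u - g (Y q u)) (at u)" .
    assume "h - Y q u = 0"
    then have "Y q u = h" by simp
    have "\<bar>X q u\<bar> \<le> norm (flow (- \<delta>, q) u)" by (metis norm_fst_le prod.collapse real_norm_def)
    also have "\<dots> \<le> norm (fold_orbit a b u) + norm (flow (- \<delta>, q) u - fold_orbit a b u)"
      by (rule norm_triangle_sub)
    also have "\<dots> \<le> B + 1" using fold_bound[OF u] fold_shadowing[OF q u] sizes by simp
    finally show "0 < X q u - g (Y q u)" using g_roof M_large \<open>Y q u = h\<close> by auto
    then show "0 < X q u - g (Y q u)" .
  qed (use q t in \<open>auto simp: flow_solves\<close>)
  then show ?thesis by simp
qed

lemma at_return: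
  assumes q: "q \<in> {0..h}"
  shows "\<bar>X q Tr - xd\<bar> \<le> \<kappa>" "\<bar>Y q Tr\<bar> \<le> \<kappa>" "Y q Tr \<le> h"
proof -
  have "norm (flow (- \<delta>, q) Tr - (xd, 0)) \<le> \<kappa>"
    using fold_shadowing[OF q, of Tr] fold_facts(1,2) by simp
  then show "\<bar>X q Tr - xd\<bar> \<le> \<kappa>" "\<bar>Y q Tr\<bar> \<le> \<kappa>"
    using norm_fst_le[of "X q Tr - xd" "Y q Tr"] norm_snd_le[of "Y q Tr" "X q Tr - xd"]
    by (auto simp: minus_prod_def case_prod_beta)
  show "Y q Tr \<le> h" using roof_before_return[OF q] fold_facts(1) by simp
qed

lemma entry_short_sum: "\<kappa> + \<kappa> * (8 * (a + 1) / (- xd)) \<le> - xd / 2"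
  using entry_short by (simp only: distrib_left mult_1_right)

text \<open>From the return time of the fold orbit until \<open>t_entry\<close> the orbit crosses \<open>y = 0\<close> upwards: since
\<open>x \<le> xd / 2\<close>, the height grows faster than the linear barrier wherever it meets it.\<close>

lemma entry_phase:
  assumes q: "q \<in> {0..h}" and t: "t \<in> {Tr..t_entry}"
  shows "- \<kappa> + (- xd / 4) * (t - Tr) \<le> Y q t" "Y q t \<le> h" "xd - \<kappa> \<le> X q t" "X q t \<le> xd / 2"
proof -
  have xd: "xd < 0" by (rule fold_facts)
  have X: "xd - \<kappa> \<le> X q u" "X q u \<le> xd / 2"
    if u: "u \<in> {Tr..t_entry}" and
      hist: "\<forall>v\<in>{Tr..u}. 0 \<le> Y q v + \<kappa> - (- xd / 4) * (v - Tr) \<and> 0 \<le> h - Y q v" for u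
  proof -
    have "- (a / 2) \<le> Y q v" if "v \<in> {Tr..u}" for v
    proof -
      have "0 \<le> (- xd / 4) * (v - Tr)" using xd that by (intro mult_nonneg_nonneg) auto
      then show ?thesis using hist that sizes by force
    qed
    then have "(- (a / 2) + a) * (u - Tr) \<le> X q u - X q Tr" using u by (intro X_lower) auto
    moreover have "0 \<le> (- (a / 2) + a) * (u - Tr)" using u a_pos by (intro mult_nonneg_nonneg) auto
    ultimately show "xd - \<kappa> \<le> X q u" using at_return(1)[OF q] by linarith
    have "X q u - X q Tr \<le> (1 + a) * (u - Tr)"
      using u hist sizes by (intro X_upper) force+
    also have "\<dots> \<le> (1 + a) * ((\<kappa> + s) * 4 / (- xd))"
      using u a_pos by (intro mult_left_mono) (auto simp: t_entry_def)
    also have "\<dots> \<le> (1 + a) * ((2 * \<kappa>) * 4 / (- xd))"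
      using a_pos xd sizes by (intro mult_left_mono divide_right_mono) auto
    also have "\<dots> = \<kappa> * (8 * (a + 1) / (- xd))" by simp
    finally show "X q u \<le> xd / 2"
      using at_return(1)[OF q] entry_short_sum by linarith
  qed
  have main: "0 \<le> Y q u + \<kappa> - (- xd / 4) * (u - Tr) \<and> 0 \<le> h - Y q u" if "u \<in> {Tr..t_entry}" for u
  proof (rule joint_barrier[OF _ _ _ _ _ _ that])
    fix v assume v: "v \<in> {Tr..t_entry}"
    show "((\<lambda>t. Y q t + \<kappa> - (- xd / 4) * (t - Tr)) has_real_derivative
        - X q v + g (Y q v) - (- xd / 4)) (at v)"
      by (auto intro!: derivative_eq_intros flow_Y)
    show "((\<lambda>t. h - Y q t) has_real_derivative X q v - g (Y q v)) (at v)"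
      by (auto intro!: derivative_eq_intros flow_Y)
    assume hist: "\<forall>u\<in>{Tr..v}. 0 \<le> Y q u + \<kappa> - (- xd / 4) * (u - Tr) \<and> 0 \<le> h - Y q u"
    note Xv = X[OF v hist]
    { assume "Y q v + \<kappa> - (- xd / 4) * (v - Tr) = 0"
      then have Yv: "Y q v = - \<kappa> + (- xd / 4) * (v - Tr)" by simp
      have "(- xd / 4) * (v - Tr) \<le> (- xd / 4) * ((\<kappa> + s) * 4 / (- xd))"
        using v xd by (intro mult_left_mono) (auto simp: t_entry_def)
      also have "\<dots> = \<kappa> + s" using xd by (simp add: field_simps)
      finally have "Y q v \<le> s" using Yv by simp
      moreover have "- \<kappa> \<le> Y q v"
        unfolding Yv using v xd by (simp add: mult_nonpos_nonneg)
      ultimately have "xd / 4 < g (Y q v)" by (intro g_entry)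
      then show "0 < - X q v + g (Y q v) - (- xd / 4)" using Xv by simp }
    { assume "h - Y q v = 0"
      then have "Y q v = h" by simp
      then show "0 < X q v - g (Y q v)" using Xv g_roof M_large xd_bound sizes by simp }
  next
    show "0 \<le> Y q Tr + \<kappa> - - xd / 4 * (Tr - Tr)" using at_return[OF q] by simp
    show "0 \<le> h - Y q Tr" using at_return[OF q] by simp
  qed
  show "- \<kappa> + (- xd / 4) * (t - Tr) \<le> Y q t" "Y q t \<le> h" using main[OF t] by auto
  show "xd - \<kappa> \<le> X q t" "X q t \<le> xd / 2" using X[OF t] main t by auto
qed

lemma t_entry_gt: "Tr < t_entry"
proof -
  have "0 < (\<kappa> + s) * 4 / (- xd)" using sizes fold_facts(4) by (intro divide_pos_pos) auto
  then show ?thesis by (simp add: t_entry_def)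
qed

text \<open>At height \<open>s\<close> the field points upwards because \<open>x \<le> - \<delta> < g s\<close>, and at height \<open>h\<close> it points
downwards because \<open>x \<ge> - M > g h\<close>.\<close>

lemma slide_phase:
  assumes q: "q \<in> {0..h}" and T: "\<And>t. t \<in> {t_entry..T} \<Longrightarrow> X q t \<le> - \<delta>"
    and t: "t \<in> {t_entry..T}"
  shows "s \<le> Y q t" "Y q t \<le> h" "xd - \<kappa> \<le> X q t"
proof -
  have xd: "xd < 0" by (rule fold_facts)
  have X: "xd - \<kappa> \<le> X q u"
    if u: "u \<in> {t_entry..T}" and hist: "\<forall>v\<in>{t_entry..u}. 0 \<le> Y q v - s \<and> 0 \<le> h - Y q v" for u
  proof -
    have "(0 + a) * (u - t_entry) \<le> X q u - X q t_entry"
    proof (intro X_lower)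
      show "0 \<le> Y q v" if "v \<in> {t_entry..u}" for v
        using bspec[OF hist that] sizes by linarith
    qed (use u in simp)
    moreover have "0 \<le> (0 + a) * (u - t_entry)" using u a_pos by simp
    ultimately show "xd - \<kappa> \<le> X q u" using entry_phase(3)[OF q, of t_entry] t_entry_gt by simp
  qed
  have main: "0 \<le> Y q u - s \<and> 0 \<le> h - Y q u" if "u \<in> {t_entry..T}" for u
  proof (rule joint_barrier[OF _ _ _ _ _ _ that])
    fix v assume v: "v \<in> {t_entry..T}"
    show "((\<lambda>t. Y q t - s) has_real_derivative - X q v + g (Y q v)) (at v)"
      by (auto intro!: derivative_eq_intros flow_Y)
    show "((\<lambda>t. h - Y q t) has_real_derivative X q v - g (Y q v)) (at v)"
      by (auto intro!: derivative_eq_intros flow_Y)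
    assume hist: "\<forall>u\<in>{t_entry..v}. 0 \<le> Y q u - s \<and> 0 \<le> h - Y q u"
    { assume "Y q v - s = 0"
      then show "0 < - X q v + g (Y q v)" using T[OF v] g_floor by simp }
    { assume "h - Y q v = 0"
      then have "Y q v = h" by simp
      then show "0 < X q v - g (Y q v)" using X[OF v hist] g_roof M_large xd_bound sizes by simp }
  next
    have "- \<kappa> + (- xd / 4) * (t_entry - Tr) = s" using xd by (simp add: t_entry_def field_simps)
    then show "0 \<le> Y q t_entry - s" "0 \<le> h - Y q t_entry"
      using entry_phase(1,2)[OF q, of t_entry] t_entry_gt by auto
  qed
  show "s \<le> Y q t" "Y q t \<le> h" using main[OF t] by auto
  show "xd - \<kappa> \<le> X q t" using X[OF t] main t by auto
qed

text \<open>In the strip \<open>x\<close> grows at speed at least \<open>a\<close>, so it cannot stay below \<open>- \<delta>\<close> until \<open>T_max\<close>.\<close>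

lemma return_exists:
  assumes q: "q \<in> {0..h}"
  shows "\<exists>t1\<in>{t_entry..T_max}. X q t1 = - \<delta> \<and> (\<forall>t\<in>{t_entry..t1}. X q t \<le> - \<delta>)"
proof -
  have xd: "xd < 0" by (rule fold_facts)
  define E where "E = t_entry - Tr"
  have E: "0 \<le> E" using t_entry_gt by (simp add: E_def)
  have "E = (\<kappa> + s) * 4 / (- xd)" by (simp add: E_def t_entry_def)
  also have "\<dots> \<le> (2 * \<kappa>) * 4 / (- xd)"
    using sizes xd by (intro divide_right_mono) auto
  finally have "E * (a + 1) \<le> (2 * \<kappa>) * 4 / (- xd) * (a + 1)"
    using a_pos by (intro mult_right_mono) auto
  also have "\<dots> = \<kappa> * (8 * (a + 1) / (- xd))" by simp
  finally have aE: "a * E \<le> - xd / 2" using entry_short_sum E sizes by (simp add: algebra_simps)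
  have aT: "a * (T_max - Tr) = 2 * (1 - xd)" using a_pos by (simp add: turn_time_def)
  have le: "t_entry \<le> T_max"
  proof (rule ccontr)
    assume "\<not> ?thesis"
    then have "a * (T_max - Tr) \<le> a * E" using a_pos by (intro mult_left_mono) (auto simp: E_def)
    then show False using aE aT xd by simp
  qed
  have "\<exists>v\<in>{t_entry..T_max}. - \<delta> \<le> X q v"
  proof (rule ccontr)
    assume none: "\<not> ?thesis"
    then have low: "X q t \<le> - \<delta>" if "t \<in> {t_entry..T_max}" for t using that by force
    have "(s + a) * (T_max - t_entry) \<le> X q T_max - X q t_entry"
      using le slide_phase(1)[OF q low] by (intro X_lower) auto
    moreover have "a * (T_max - t_entry) \<le> (s + a) * (T_max - t_entry)"
      using sizes le by (intro mult_right_mono) auto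
    moreover have "a * (T_max - t_entry) = 2 * (1 - xd) - a * E"
      using aT by (simp add: E_def algebra_simps)
    ultimately have "2 * (1 - xd) - a * E \<le> X q T_max - X q t_entry" by (metis order_trans)
    then have "2 * (1 - xd) + xd / 2 \<le> X q T_max - X q t_entry" using aE by (simp add: field_simps)
    moreover have "xd - \<kappa> \<le> X q t_entry" using entry_phase(3)[OF q, of t_entry] t_entry_gt by simp
    ultimately have "- \<delta> \<le> X q T_max" using sizes(1,2,6) xd by argo
    then show False using none le by auto
  qed
  then obtain v where v: "v \<in> {t_entry..T_max}" "- \<delta> \<le> X q v" by blast
  have "\<exists>t1\<in>{t_entry..v}. X q t1 = - \<delta> \<and> (\<forall>t\<in>{t_entry..t1}. X q t \<le> - \<delta>)"
  proof (rule first_hit)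
    show "X q t_entry \<le> - \<delta>" using entry_phase(4)[OF q, of t_entry] t_entry_gt sizes by simp
    show "continuous_on {t_entry..v} (X q)" by (intro continuous_intros flow_continuous)
  qed (use v in auto)
  then show ?thesis using v by auto
qed

definition ret :: "real \<Rightarrow> real" where
  "ret q = (SOME t1. t1 \<in> {t_entry..T_max} \<and> X q t1 = - \<delta> \<and> (\<forall>t\<in>{t_entry..t1}. X q t \<le> - \<delta>))"

definition return_map :: "real \<Rightarrow> real" where "return_map q = Y q (ret q)"

lemma ret_facts:
  assumes q: "q \<in> {0..h}"
  shows "t_entry \<le> ret q" "ret q \<le> T_max" "X q (ret q) = - \<delta>"
    and "\<And>t. t \<in> {t_entry..ret q} \<Longrightarrow> X q t \<le> - \<delta>"
    and "flow (- \<delta>, q) (ret q) = (- \<delta>, return_map q)"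
proof -
  have "\<exists>t1. t1 \<in> {t_entry..T_max} \<and> X q t1 = - \<delta> \<and> (\<forall>t\<in>{t_entry..t1}. X q t \<le> - \<delta>)"
    using return_exists[OF q] by blast
  from someI_ex[OF this]
  show *: "t_entry \<le> ret q" "ret q \<le> T_max" "X q (ret q) = - \<delta>"
    and "\<And>t. t \<in> {t_entry..ret q} \<Longrightarrow> X q t \<le> - \<delta>"
    unfolding ret_def[symmetric] by auto
  show "flow (- \<delta>, q) (ret q) = (- \<delta>, return_map q)"
    using *(3) by (simp add: return_map_def prod_eq_iff)
qed

lemma T_max_pos: "0 < T_max" "Tr < T_max"
  using a_pos fold_facts(1,4) by (auto simp: turn_time_def intro!: add_pos_nonneg divide_pos_pos)

lemma ret_slide:
  assumes q: "q \<in> {0..h}"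
  shows "t_slide \<le> ret q - t_entry"
    and "\<And>t. t \<in> {t_entry..ret q} \<Longrightarrow> s \<le> Y q t"
    and "\<And>t. t \<in> {Tr..ret q} \<Longrightarrow> - \<kappa> \<le> Y q t"
    and "\<And>t. t \<in> {0..ret q} \<Longrightarrow> Y q t \<le> h"
    and "\<And>t. t \<in> {Tr..ret q} \<Longrightarrow> xd - \<kappa> \<le> X q t"
    and "\<And>t. t \<in> {Tr..ret q} \<Longrightarrow> X q t \<le> - \<delta>"
proof -
  note r = ret_facts[OF q] and slide = slide_phase[OF q ret_facts(4)[OF q]]
  show "s \<le> Y q t" if "t \<in> {t_entry..ret q}" for t using slide that by blast
  have split: "t \<in> {0..Tr} \<or> t \<in> {Tr..t_entry} \<or> t \<in> {t_entry..ret q}" if "t \<in> {0..ret q}" for t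
    using that by auto
  have split': "t \<in> {Tr..t_entry} \<or> t \<in> {t_entry..ret q}" if "t \<in> {Tr..ret q}" for t
    using that by auto
  show roof: "Y q t \<le> h" if "t \<in> {0..ret q}" for t
    using split[OF that] roof_before_return[OF q] entry_phase(2)[OF q] slide by blast
  show "xd - \<kappa> \<le> X q t" if "t \<in> {Tr..ret q}" for t
    using split'[OF that] entry_phase(3)[OF q] slide by blast
  show "X q t \<le> - \<delta>" if "t \<in> {Tr..ret q}" for t
    using split'[OF that] entry_phase(4)[OF q, of t] r(4)[of t] sizes by force
  show "- \<kappa> \<le> Y q t" if "t \<in> {Tr..ret q}" for t
    using split'[OF that]
  proof
    assume t: "t \<in> {Tr..t_entry}"
    then have "0 \<le> (- xd / 4) * (t - Tr)"
      using fold_facts(4) by (intro mult_nonneg_nonneg) auto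
    then show ?thesis using entry_phase(1)[OF q t] by simp
  next
    assume "t \<in> {t_entry..ret q}"
    then have "s \<le> Y q t" using slide(1) by blast
    then show ?thesis using sizes by linarith
  qed
  have "X q (ret q) - X q t_entry \<le> (1 + a) * (ret q - t_entry)"
  proof (rule X_upper)
    show "Y q t \<le> 1" if "t \<in> {t_entry..ret q}" for t
      using roof[of t] that sizes t_entry_gt fold_facts(1) by simp
  qed (rule r(1))
  moreover have "X q t_entry \<le> xd / 2" using entry_phase(4)[OF q, of t_entry] t_entry_gt by simp
  ultimately have "- xd / 4 \<le> (1 + a) * (ret q - t_entry)" using r(3) sizes by simp
  then show "t_slide \<le> ret q - t_entry"
    unfolding slide_time_def using a_pos by (subst pos_divide_le_eq) (auto simp: mult.commute add.commute)
qed

text \<open>The upper bound is strict because at height \<open>h\<close> the orbit would be descending, and so would have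
been above \<open>h\<close> shortly before. Strictness puts the fixed point in the interior of the section.\<close>

lemma return_map_range:
  assumes q: "q \<in> {0..h}"
  shows "s \<le> return_map q" "return_map q < h"
proof -
  have T: "Tr < ret q" "0 < Tr" using ret_facts(1)[OF q] t_entry_gt fold_facts(1) by auto
  show "s \<le> return_map q"
    unfolding return_map_def using ret_facts(1)[OF q] by (intro ret_slide(2)[OF q]) simp
  show "return_map q < h"
  proof (rule ccontr)
    assume "\<not> ?thesis"
    then have Yh: "Y q (ret q) = h" using ret_slide(4)[OF q, of "ret q"] T by (simp add: return_map_def)
    have "\<delta> + g h < 0" using g_roof M_large xd_bound sizes by simp
    then obtain d where d: "0 < d" "\<And>u. 0 < u \<Longrightarrow> u < d \<Longrightarrow> Y q (ret q) < Y q (ret q - u)"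
      using DERIV_neg_dec_left[OF flow_Y[of "(- \<delta>, q)" "ret q"]] unfolding Yh ret_facts(3)[OF q] by force
    define u where "u = min (d / 2) (ret q)"
    have "0 < u" "u < d" "u \<le> ret q" using d(1) T by (auto simp: u_def)
    then show False using d(2)[of u] ret_slide(4)[OF q, of "ret q - u"] Yh by simp
  qed
qed

end


section \<open>Contraction of the return map\<close>

text \<open>An upper bound for the factor by which two orbits can separate during one turn.\<close>

definition expansion :: "real \<Rightarrow> real \<Rightarrow> real" where
  "expansion a b = exp (4 * turn_time a b)"

text \<open>An upper bound for the factor by which two orbits can separate during one turn after one of them has been shifted in time
so that both return simultaneously: \<open>4 * B + a + 5\<close> bounds the speed halfway along the fold orbit
and \<open>2 / a\<close> converts a distance at the section into a time lag.\<close>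

definition shift_factor :: "real \<Rightarrow> real \<Rightarrow> real \<Rightarrow> real" where
  "shift_factor a b B = expansion a b * (expansion a b * (1 + (4 * B + a + 5) * (2 / a)))"

text \<open>The constants \<open>expansion\<close> and \<open>shift_factor\<close> depend on neither the damping rate \<open>K\<close> nor the section, so
\<open>K\<close> can be chosen after them and the section height after \<open>K\<close>.\<close>

locale contracting_loop = relaxation_loop a g L b B e \<delta> h \<kappa> s M
  for a :: real and g :: "real \<Rightarrow> real" and L b B e \<delta> h \<kappa> s M :: real +
  fixes m K :: real
  assumes mid_depth: "\<And>t. t \<in> {return_time a b / 4..3 * return_time a b / 4} \<Longrightarrow> snd (fold_orbit a b t) \<le> - m"
    and kappa_mid: "\<kappa> < m"
    and K_pos: "0 < K"
    and g_contracting: "\<And>y z. y \<in> {s..h} \<Longrightarrow> z \<in> {s..h} \<Longrightarrow> (y - z) * (g y - g z) \<le> - K * (y - z)\<^sup>2"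
    and shift_small: "2 * expansion a b * h / a \<le> return_time a b / 4"
    and K_large: "(shift_factor a b B)\<^sup>2 * (exp (- K * slide_time a b) + 1 / K\<^sup>2) \<le> 1 / 4"
begin

abbreviation "N \<equiv> expansion a b"

lemma B_nonneg: "0 \<le> B"
  using fold_bound[of 0] fold_facts(1) norm_ge_zero by (metis atLeastAtMost_iff less_imp_le order_refl order_trans)

lemma N_ge_1: "1 \<le> N"
  using T_max_pos by (simp add: expansion_def)

text \<open>Halfway along the excursion the orbit is in \<open>y < 0\<close>, where the field is bounded independently
of \<open>\<epsilon>\<close>. This is where a time shift costs only a bounded multiple of its length; on the
section itself the field may be exponentially large.\<close>

lemma mid_speed:
  assumes q: "q \<in> {0..h}" and u: "0 \<le> u" "u \<le> Tr / 4"
  shows "norm (flow (- \<delta>, q) (Tr / 2 + u) - flow (- \<delta>, q) (Tr / 2)) \<le> (4 * B + a + 5) * u"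
proof -
  have Tr: "0 < Tr" by (rule fold_facts)
  have speed: "norm (rayleigh_field a g (flow (- \<delta>, q) t)) \<le> 4 * B + a + 5"
    if t: "t \<in> {Tr / 2..Tr / 2 + u}" for t
  proof -
    let ?p = "flow (- \<delta>, q) t" and ?w = "fold_orbit a b t"
    have t': "t \<in> {0..Tr}" "t \<in> {Tr / 4..3 * Tr / 4}" using t u Tr by auto
    have near: "norm (?p - ?w) \<le> \<kappa>" by (rule fold_shadowing[OF q t'(1)])
    have "norm ?p \<le> norm ?w + norm (?p - ?w)" by (rule norm_triangle_sub)
    then have p: "norm ?p \<le> B + 1" using fold_bound[OF t'(1)] near sizes by linarith
    have X: "\<bar>fst ?p\<bar> \<le> B + 1" and Y: "\<bar>snd ?p\<bar> \<le> B + 1"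
      using p abs_fst_le_norm[of ?p] abs_snd_le_norm[of ?p] by linarith+
    have "\<bar>snd ?p - snd ?w\<bar> \<le> \<kappa>"
      using near abs_snd_le_norm[of "?p - ?w"] unfolding snd_diff by linarith
    then have "snd ?p \<le> 0" using mid_depth[OF t'(2)] kappa_mid by linarith
    define G where "G = 2 * b * snd ?p"
    have gG: "\<bar>g (snd ?p) - G\<bar> \<le> 1"
      using \<open>snd ?p \<le> 0\<close> g_linear[of "snd ?p"] sizes(10) unfolding G_def by linarith
    have G: "\<bar>G\<bar> \<le> 2 * (B + 1)"
    proof -
      have "b * \<bar>snd ?p\<bar> \<le> 1 * (B + 1)" using b_range Y by (intro mult_mono) auto
      then show ?thesis using b_range by (simp add: G_def abs_mult)
    qed
    have tri: "norm (rayleigh_field a g ?p) \<le> \<bar>snd ?p + a\<bar> + \<bar>- fst ?p + g (snd ?p)\<bar>"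
      using norm_Pair_le[of "snd ?p + a" "- fst ?p + g (snd ?p)"]
      by (simp add: rayleigh_field_def case_prod_beta)
    have Ya: "\<bar>snd ?p + a\<bar> \<le> B + 1 + a" using Y a_pos by linarith
    have Xg: "\<bar>- fst ?p + g (snd ?p)\<bar> \<le> (B + 1) + (2 * (B + 1) + 1)"
      using X gG G by linarith
    show ?thesis using tri Ya Xg by argo
  qed
  have "norm (flow (- \<delta>, q) (Tr / 2 + u) - flow (- \<delta>, q) (Tr / 2))
      \<le> (4 * B + a + 5) * norm ((Tr / 2 + u) - Tr / 2)"
  proof (rule differentiable_bound[where S = "{Tr / 2..Tr / 2 + u}"
        and f' = "\<lambda>t x. x *\<^sub>R rayleigh_field a g (flow (- \<delta>, q) t)"])
    fix t assume t: "t \<in> {Tr / 2..Tr / 2 + u}"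
    show "(flow (- \<delta>, q) has_derivative (\<lambda>x. x *\<^sub>R rayleigh_field a g (flow (- \<delta>, q) t)))
        (at t within {Tr / 2..Tr / 2 + u})"
      using flow_solves(2)[of "(- \<delta>, q)"]
      unfolding solution_on_UNIV_iff has_vector_derivative_def by (blast intro: has_derivative_at_withinI)
    show "onorm (\<lambda>x. x *\<^sub>R rayleigh_field a g (flow (- \<delta>, q) t)) \<le> 4 * B + a + 5"
    proof (rule onorm_le)
      show "norm (x *\<^sub>R rayleigh_field a g (flow (- \<delta>, q) t)) \<le> (4 * B + a + 5) * norm x" for x :: real
        using mult_left_mono[OF speed[OF t], of "\<bar>x\<bar>"] by (simp add: mult.commute)
    qed
  qed (use u in auto)
  then show ?thesis using u by simp
qed

text \<open>Shift the second orbit in time so that both orbits return to \<open>x = - \<delta>\<close> at the same moment. The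
lag is proportional to the initial distance, so is the distance halfway along the excursion, and
so, by the one-sided estimate, is the distance from then on. During the slide the vertical
difference \<open>w\<close> satisfies \<open>w' = - v + R\<close> with \<open>R\<close> damping at rate \<open>K\<close>, while the horizontal difference
\<open>v\<close> stays proportional to the initial distance; so at the return, where the whole difference is
vertical, it has become small.\<close>

lemma return_map_contracts_aux:
  assumes q1: "q1 \<in> {0..h}" and q2: "q2 \<in> {0..h}" and le: "ret q1 \<le> ret q2"
  shows "\<bar>return_map q1 - return_map q2\<bar> \<le> \<bar>q1 - q2\<bar> / 2"
proof -
  define d where "d = \<bar>q1 - q2\<bar>"
  define t1 where "t1 = ret q1"
  define u where "u = ret q2 - ret q1"
  define C where "C = shift_factor a b B"
  have Tr: "0 < Tr" by (rule fold_facts)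
  note r1 = ret_facts[OF q1] and r2 = ret_facts[OF q2]
  have t1: "Tr < t1" "t_entry \<le> t1" "t1 \<le> T_max" using r1 t_entry_gt by (auto simp: t1_def)
  have u0: "0 \<le> u" using le by (simp add: u_def)
  have d0: "0 \<le> d" and dh: "d \<le> h" using q1 q2 by (auto simp: d_def)
  have dist: "norm ((- \<delta>, q1) - (- \<delta>, q2)) = d" by (simp add: d_def norm_Pair)
  have close12: "norm (flow (- \<delta>, q1) t - flow (- \<delta>, q2) t) \<le> N * d" if "0 \<le> t" "t \<le> T_max" for t
    using flow_expansion[OF that, of "(- \<delta>, q1)" "(- \<delta>, q2)"] dist by (simp add: expansion_def)
  \<comment> \<open>the lag is at most proportional to the initial distance\<close>
  have u: "u \<le> 2 / a * (N * d)"
  proof -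
    have "(- (a / 2) + a) * (ret q2 - t1) \<le> X q2 (ret q2) - X q2 t1"
    proof (rule X_lower)
      show "t1 \<le> ret q2" using le by (simp add: t1_def)
      show "- (a / 2) \<le> Y q2 t" if "t \<in> {t1..ret q2}" for t
        using ret_slide(3)[OF q2, of t] that t1 sizes by simp
    qed
    moreover have "X q1 t1 - X q2 t1 \<le> N * d"
    proof -
      have "\<bar>X q1 t1 - X q2 t1\<bar> \<le> norm (flow (- \<delta>, q1) t1 - flow (- \<delta>, q2) t1)"
        unfolding fst_diff[symmetric] by (rule abs_fst_le_norm)
      then show ?thesis using close12[of t1] t1 Tr by simp
    qed
    ultimately have "a / 2 * u \<le> N * d" using r1(3) r2(3) by (simp add: u_def t1_def)
    then show ?thesis using a_pos by (simp add: field_simps)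
  qed
  have u_small: "u \<le> Tr / 4"
  proof -
    have "2 / a * (N * d) \<le> 2 / a * (N * h)" using dh a_pos N_ge_1 by (intro mult_left_mono) auto
    also have "\<dots> \<le> Tr / 4" using shift_small by (simp add: mult_ac)
    finally show ?thesis using u by linarith
  qed
  \<comment> \<open>after the time shift both orbits arrive simultaneously\<close>
  define \<psi> where "\<psi> t = flow (- \<delta>, q2) (t + u)" for t
  have start: "norm (flow (- \<delta>, q1) (Tr / 2) - \<psi> (Tr / 2)) \<le> N * (1 + (4 * B + a + 5) * (2 / a)) * d"
  proof -
    have "norm (flow (- \<delta>, q1) (Tr / 2) - \<psi> (Tr / 2))
        \<le> norm (flow (- \<delta>, q1) (Tr / 2) - flow (- \<delta>, q2) (Tr / 2))
          + norm (flow (- \<delta>, q2) (Tr / 2) - \<psi> (Tr / 2))"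
      using norm_triangle_ineq[of "flow (- \<delta>, q1) (Tr / 2) - flow (- \<delta>, q2) (Tr / 2)"
          "flow (- \<delta>, q2) (Tr / 2) - \<psi> (Tr / 2)"] by simp
    also have "norm (flow (- \<delta>, q2) (Tr / 2) - \<psi> (Tr / 2)) \<le> (4 * B + a + 5) * u"
      using mid_speed[OF q2 u0 u_small] by (simp add: \<psi>_def norm_minus_commute)
    also have "\<dots> \<le> (4 * B + a + 5) * (2 / a * (N * d))"
      using u B_nonneg a_pos by (intro mult_left_mono) auto
    also have "norm (flow (- \<delta>, q1) (Tr / 2) - flow (- \<delta>, q2) (Tr / 2)) \<le> N * d"
      using Tr T_max_pos by (intro close12) auto
    finally have "norm (flow (- \<delta>, q1) (Tr / 2) - \<psi> (Tr / 2))
        \<le> N * d + (4 * B + a + 5) * (2 / a * (N * d))" by simp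
    moreover have "N * d + S * (k * (N * d)) = N * (1 + S * k) * d" for S k
      by (simp add: algebra_simps)
    ultimately show ?thesis by metis
  qed
  have near: "norm (flow (- \<delta>, q1) t - \<psi> t) \<le> C * d" if t: "Tr / 2 \<le> t" "t \<le> t1" for t
  proof -
    have "flow (- \<delta>, q1) t = flow (flow (- \<delta>, q1) (Tr / 2)) (t - Tr / 2)"
      by (simp flip: flow_add)
    moreover have "\<psi> t = flow (\<psi> (Tr / 2)) (t - Tr / 2)"
      using flow_add[of "(- \<delta>, q2)" "Tr / 2 + u" "t - Tr / 2"] by (simp add: \<psi>_def add.commute)
    ultimately have "norm (flow (- \<delta>, q1) t - \<psi> t)
        \<le> N * norm (flow (- \<delta>, q1) (Tr / 2) - \<psi> (Tr / 2))"
      using flow_expansion[of "t - Tr / 2" T_max "flow (- \<delta>, q1) (Tr / 2)" "\<psi> (Tr / 2)"] t t1 Tr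
      by (simp add: expansion_def)
    also have "\<dots> \<le> N * (N * (1 + (4 * B + a + 5) * (2 / a)) * d)"
      using start N_ge_1 by (intro mult_left_mono) auto
    finally show ?thesis by (simp add: C_def shift_factor_def mult_ac)
  qed
  define w where "w t = Y q1 t - snd (\<psi> t)" for t
  define v where "v t = X q1 t - fst (\<psi> t)" for t
  have vw: "\<bar>v t\<bar> \<le> C * d" "\<bar>w t\<bar> \<le> C * d" if t: "t_entry \<le> t" "t \<le> t1" for t
  proof -
    have "norm (flow (- \<delta>, q1) t - \<psi> t) \<le> C * d" using near[of t] t t_entry_gt Tr by simp
    then show "\<bar>v t\<bar> \<le> C * d" "\<bar>w t\<bar> \<le> C * d"
      using abs_fst_le_norm[of "flow (- \<delta>, q1) t - \<psi> t"] abs_snd_le_norm[of "flow (- \<delta>, q1) t - \<psi> t"]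
      unfolding v_def w_def fst_diff snd_diff by linarith+
  qed
  define R where "R t = g (Y q1 t) - g (snd (\<psi> t))" for t
  have \<psi>Y: "((\<lambda>t. snd (\<psi> t)) has_real_derivative - fst (\<psi> t) + g (snd (\<psi> t))) (at t)" for t
    using solution_on_shift[OF flow_solves(2), of "(- \<delta>, q2)" u]
    by (simp add: rayleigh_solution_on_iff \<psi>_def)
  have dw: "((\<lambda>t. (w t)\<^sup>2) has_real_derivative 2 * w t * (- v t + R t)) (at t)" for t
    unfolding w_def v_def R_def
    by (auto intro!: derivative_eq_intros flow_Y \<psi>Y simp: algebra_simps)
  have "(w t1)\<^sup>2 + (C * d)\<^sup>2 / K / (- K)
      \<le> exp (- K * (t1 - t_entry)) * ((w t_entry)\<^sup>2 + (C * d)\<^sup>2 / K / (- K))"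
  proof (rule linear_differential_inequality)
    show "continuous_on {t_entry..t1} (\<lambda>t. (w t)\<^sup>2)"
      using dw by (meson DERIV_continuous continuous_at_imp_continuous_on)
    fix t assume t: "t_entry < t" "t < t1"
    show "((\<lambda>t. (w t)\<^sup>2) has_real_derivative 2 * w t * (- v t + R t)) (at t)" by (rule dw)
    have "Y q1 t \<in> {s..h}" "snd (\<psi> t) \<in> {s..h}"
      using ret_slide(2,4)[OF q1, of t] ret_slide(2,4)[OF q2, of "t + u"] t u0 t_entry_gt Tr
      by (auto simp: \<psi>_def u_def t1_def)
    then have "w t * R t \<le> - K * (w t)\<^sup>2" unfolding w_def R_def by (rule g_contracting)
    moreover have "- (w t * v t) \<le> \<bar>w t\<bar> * (C * d)"
      using vw(1)[of t] t by (intro order_trans[OF _ mult_left_mono[of "\<bar>v t\<bar>" "C * d" "\<bar>w t\<bar>"]])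
        (simp_all flip: abs_mult)
    \<comment> \<open>Young inequality: half of the damping \<open>2 * K * (w t)\<^sup>2\<close> absorbs the forcing.\<close>
    moreover have "2 * (\<bar>w t\<bar> * (C * d)) \<le> K * (w t)\<^sup>2 + (C * d)\<^sup>2 / K"
    proof -
      have "0 \<le> (K * \<bar>w t\<bar> - C * d)\<^sup>2 / K" using K_pos by simp
      also have "\<dots> = K * (w t)\<^sup>2 + (C * d)\<^sup>2 / K - 2 * (\<bar>w t\<bar> * (C * d))"
        using K_pos by (simp add: power2_diff field_simps power2_eq_square)
      finally show ?thesis by simp
    qed
    ultimately show "2 * w t * (- v t + R t) \<le> - K * (w t)\<^sup>2 + (C * d)\<^sup>2 / K"
      by (simp add: algebra_simps)
  qed (use K_pos t1 in auto)
  also have "\<dots> \<le> exp (- K * t_slide) * (C * d)\<^sup>2"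
  proof -
    have e: "exp (- K * (t1 - t_entry)) \<le> exp (- K * t_slide)"
      using ret_slide(1)[OF q1] K_pos by (simp add: t1_def)
    have "(w t_entry)\<^sup>2 \<le> (C * d)\<^sup>2"
      using vw(2)[of t_entry] t1 by (metis abs_le_square_iff abs_of_nonneg abs_ge_zero order_refl order_trans)
    moreover have "(C * d)\<^sup>2 / K / (- K) \<le> 0" using K_pos by (intro divide_nonneg_neg) auto
    ultimately have "(w t_entry)\<^sup>2 + (C * d)\<^sup>2 / K / (- K) \<le> (C * d)\<^sup>2" by linarith
    then have "exp (- K * (t1 - t_entry)) * ((w t_entry)\<^sup>2 + (C * d)\<^sup>2 / K / (- K))
        \<le> exp (- K * (t1 - t_entry)) * (C * d)\<^sup>2"
      by (rule mult_left_mono) simp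
    also have "\<dots> \<le> exp (- K * t_slide) * (C * d)\<^sup>2" using e by (rule mult_right_mono) simp
    finally show ?thesis .
  qed
  finally have "(w t1)\<^sup>2 \<le> d\<^sup>2 * (C\<^sup>2 * (exp (- K * t_slide) + 1 / K\<^sup>2))"
    using K_pos by (simp add: power_mult_distrib power2_eq_square algebra_simps)
  also have "\<dots> \<le> d\<^sup>2 * (1 / 4)"
    using K_large by (intro mult_left_mono) (auto simp: C_def)
  finally have "(w t1)\<^sup>2 \<le> (d / 2)\<^sup>2" by (simp add: power_divide)
  then have "\<bar>w t1\<bar> \<le> d / 2" using d0 by (metis abs_le_square_iff abs_of_nonneg half_gt_zero_iff le_less div_0)
  then show ?thesis
    by (simp add: w_def \<psi>_def t1_def u_def return_map_def d_def)
qed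

lemma return_map_contracts:
  assumes "q1 \<in> {0..h}" "q2 \<in> {0..h}"
  shows "\<bar>return_map q1 - return_map q2\<bar> \<le> \<bar>q1 - q2\<bar> / 2"
  using return_map_contracts_aux[of q1 q2] return_map_contracts_aux[of q2 q1] assms
  by (cases "ret q1 \<le> ret q2") (auto simp: abs_minus_commute)

lemma return_map_fixpoint: "\<exists>!q. q \<in> {0..h} \<and> return_map q = q"
proof -
  have "\<exists>!q\<in>{0..h}. return_map q = q"
  proof (rule Banach_fix[where c = "1 / 2"])
    show "complete {0..h}" by (rule compact_imp_complete) simp
    show "{0..h} \<noteq> {}" using sizes by simp
    show "return_map ` {0..h} \<subseteq> {0..h}" using return_map_range sizes by force
    show "dist (return_map x) (return_map y) \<le> 1 / 2 * dist x y" if "x \<in> {0..h}" "y \<in> {0..h}" for x y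
      using return_map_contracts[OF that] by (simp add: dist_real_def)
  qed auto
  then show ?thesis by blast
qed

end


section \<open>The attracting cycle\<close>

lemma periodic_int:
  fixes \<phi> :: "real \<Rightarrow> 'a"
  assumes "\<And>t. \<phi> (t + T) = \<phi> t"
  shows "\<phi> (t + of_int k * T) = \<phi> t"
proof (induction k rule: int_induct[where k = 0])
  case base
  then show ?case by simp
next
  case (step1 i)
  then show ?case using assms[of "t + of_int i * T"] by (simp add: algebra_simps)
next
  case (step2 i)
  then show ?case using assms[of "t + of_int (i - 1) * T"] by (simp add: algebra_simps)
qed

lemma periodic_representative:
  fixes \<phi> :: "real \<Rightarrow> 'a"
  assumes per: "\<And>t. \<phi> (t + T) = \<phi> t" and "0 < T"
  obtains u where "c \<le> u" "u < c + T" "\<phi> u = \<phi> t"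
proof -
  define k where "k = \<lfloor>(t - c) / T\<rfloor>"
  have "of_int k \<le> (t - c) / T" "(t - c) / T < of_int k + 1" unfolding k_def by linarith+
  then have "of_int k * T \<le> t - c" "t - c < (of_int k + 1) * T"
    using \<open>0 < T\<close> by (auto simp: pos_le_divide_eq pos_divide_less_eq)
  moreover have "\<phi> (t + of_int (- k) * T) = \<phi> t" by (rule periodic_int) (rule per)
  ultimately show ?thesis
    by (intro that[of "t + of_int (- k) * T"]) (auto simp: algebra_simps)
qed

lemma periodic_range:
  fixes \<phi> :: "real \<Rightarrow> 'a"
  assumes per: "\<And>t. \<phi> (t + T) = \<phi> t" and "0 < T"
  shows "range \<phi> = \<phi> ` {c..c + T}"
proof
  show "range \<phi> \<subseteq> \<phi> ` {c..c + T}"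
  proof
    fix x assume "x \<in> range \<phi>"
    then obtain t where "x = \<phi> t" by blast
    then show "x \<in> \<phi> ` {c..c + T}"
    proof -
      obtain u where "c \<le> u" "u < c + T" "\<phi> u = \<phi> t"
        by (rule periodic_representative[where \<phi> = \<phi> and T = T]) (use assms in auto)
      then show ?thesis using \<open>x = \<phi> t\<close> by (intro image_eqI[of _ _ u]) auto
    qed
  qed
qed auto

context contracting_loop
begin

text \<open>The orbit \<open>\<gamma>\<close> of the fixed point of the return map closes up after one turn.\<close>

definition "q_star = (THE q. q \<in> {0..h} \<and> return_map q = q)"

definition "\<gamma> = flow (- \<delta>, q_star)"

definition "period = ret q_star"

definition "cycle = range \<gamma>"

lemma q_star: "q_star \<in> {0..h}" "return_map q_star = q_star" "0 < q_star" "q_star < h"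
proof -
  have "q_star \<in> {0..h} \<and> return_map q_star = q_star"
    unfolding q_star_def using return_map_fixpoint by (rule theI')
  then show "q_star \<in> {0..h}" "return_map q_star = q_star" by auto
  then show "0 < q_star" "q_star < h" using return_map_range[of q_star] sizes by auto
qed

lemma period_pos: "0 < Tr" "Tr < period" "period \<le> T_max"
  using ret_facts(1,2)[OF q_star(1)] t_entry_gt fold_facts(1) by (auto simp: period_def)

lemma \<gamma>_0: "\<gamma> 0 = (- \<delta>, q_star)"
  by (simp add: \<gamma>_def flow_solves)

lemma \<gamma>_solves: "solution_on (rayleigh_field a g) \<gamma> UNIV"
  by (simp add: \<gamma>_def flow_solves)

lemma \<gamma>_periodic: "\<gamma> (t + period) = \<gamma> t"
  using flow_add[of "(- \<delta>, q_star)" period t] ret_facts(5)[OF q_star(1)]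
  by (simp add: \<gamma>_def period_def q_star(2) add.commute)

lemma cycle_eq: "cycle = \<gamma> ` {0..period}"
  unfolding cycle_def using periodic_range[of \<gamma> period 0] \<gamma>_periodic period_pos by simp

lemma cycle_compact: "compact cycle"
  unfolding cycle_eq \<gamma>_def by (intro compact_continuous_image flow_continuous) simp

lemma cycle_closed: "closed cycle" and cycle_nonempty: "cycle \<noteq> {}"
  using cycle_compact compact_imp_closed by (auto simp: cycle_def)

lemma \<gamma>_nonconstant: "\<gamma> t_entry \<noteq> \<gamma> 0"
proof -
  have "X q_star t_entry \<le> xd / 2" using entry_phase(4)[OF q_star(1), of t_entry] t_entry_gt by simp
  then have "fst (\<gamma> t_entry) < - \<delta>" using sizes by (simp add: \<gamma>_def)
  then show ?thesis by (auto simp: \<gamma>_0)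
qed

text \<open>Within one turn the distance to \<open>\<gamma>\<close> grows at most by the factor \<open>N\<close>, and at the end of the turn the
return map has brought the orbit closer to \<open>q_star\<close>, so the same bound serves for the next turn.\<close>

lemma section_infdist:
  assumes q: "q \<in> {0..h}" and "0 \<le> t"
  shows "infdist (flow (- \<delta>, q) t) cycle \<le> N * \<bar>q - q_star\<bar>"
proof -
  have "infdist (flow (- \<delta>, q) t) cycle \<le> N * \<bar>q - q_star\<bar>" if "q \<in> {0..h}" "0 \<le> t" "t \<le> real n * Tr" for n q t
    using that
  proof (induction n arbitrary: q t)
    have first: "infdist (flow (- \<delta>, q) t) cycle \<le> N * \<bar>q - q_star\<bar>"
      if "q \<in> {0..h}" "0 \<le> t" "t \<le> T_max" for q t
    proof -
      have "infdist (flow (- \<delta>, q) t) cycle \<le> dist (flow (- \<delta>, q) t) (\<gamma> t)"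
        by (rule infdist_le) (simp add: cycle_def)
      also have "\<dots> \<le> N * norm ((- \<delta>, q) - (- \<delta>, q_star))"
        unfolding dist_norm \<gamma>_def expansion_def by (rule flow_expansion[OF that(2,3)])
      finally show ?thesis by (simp add: norm_Pair)
    qed
    { case 0
      then show ?case using first[of q t] T_max_pos by simp }
    case (Suc n)
    show ?case
    proof (cases "t \<le> ret q")
      case True
      then show ?thesis using first[of q t] Suc.prems ret_facts(2)[of q] by simp
    next
      case False
      let ?q = "return_map q"
      have q': "?q \<in> {0..h}" using return_map_range[OF Suc.prems(1)] sizes by simp
      have "flow (- \<delta>, q) t = flow (- \<delta>, ?q) (t - ret q)"
        using flow_add[of "(- \<delta>, q)" "ret q" "t - ret q"] ret_facts(5)[OF Suc.prems(1)] by simp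
      moreover have "infdist (flow (- \<delta>, ?q) (t - ret q)) cycle \<le> N * \<bar>?q - q_star\<bar>"
        using q' False Suc.prems ret_facts(1)[OF Suc.prems(1)] t_entry_gt
        by (intro Suc.IH) (auto simp: distrib_right)
      moreover have "N * \<bar>?q - q_star\<bar> \<le> N * \<bar>q - q_star\<bar>"
      proof (rule mult_left_mono)
        have "\<bar>?q - q_star\<bar> \<le> \<bar>q - q_star\<bar> / 2"
          using return_map_contracts[OF Suc.prems(1) q_star(1)] unfolding q_star(2) .
        then show "\<bar>?q - q_star\<bar> \<le> \<bar>q - q_star\<bar>" using abs_ge_zero[of "q - q_star"] by argo
      qed (use N_ge_1 in simp)
      ultimately show ?thesis by simp
    qed
  qed
  moreover obtain n where "t / Tr \<le> real n" using real_arch_simple by blast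
  ultimately show ?thesis using assms period_pos(1) by (simp add: pos_divide_le_eq)
qed

text \<open>Each turn halves the distance to \<open>q_star\<close>.\<close>

lemma section_decay:
  assumes "q \<in> {0..h}"
  shows "\<exists>S. \<forall>t\<ge>S. infdist (flow (- \<delta>, q) t) cycle \<le> N * \<bar>q - q_star\<bar> * (1 / 2) ^ n"
  using assms
proof (induction n arbitrary: q)
  case 0
  then show ?case using section_infdist[OF 0] by (intro exI[of _ 0]) simp
next
  case (Suc n)
  let ?q = "return_map q"
  have "?q \<in> {0..h}" using return_map_range[OF Suc.prems] sizes by simp
  then obtain S where S: "\<And>t. S \<le> t \<Longrightarrow> infdist (flow (- \<delta>, ?q) t) cycle \<le> N * \<bar>?q - q_star\<bar> * (1 / 2) ^ n"
    using Suc.IH by blast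
  have "infdist (flow (- \<delta>, q) t) cycle \<le> N * \<bar>q - q_star\<bar> * (1 / 2) ^ Suc n" if "ret q + S \<le> t" for t
  proof -
    have "flow (- \<delta>, q) t = flow (- \<delta>, ?q) (t - ret q)"
      using flow_add[of "(- \<delta>, q)" "ret q" "t - ret q"] ret_facts(5)[OF Suc.prems] by simp
    then have "infdist (flow (- \<delta>, q) t) cycle \<le> N * \<bar>?q - q_star\<bar> * (1 / 2) ^ n"
      using S[of "t - ret q"] that by simp
    also have "\<dots> \<le> N * (\<bar>q - q_star\<bar> / 2) * (1 / 2) ^ n"
      using return_map_contracts[OF Suc.prems q_star(1)] q_star(2) N_ge_1
      by (intro mult_right_mono mult_left_mono) auto
    finally show ?thesis by simp
  qed
  then show ?case by blast
qed

lemma section_converges: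
  assumes q: "q \<in> {0..h}"
  shows "((\<lambda>t. infdist (flow (- \<delta>, q) t) cycle) \<longlongrightarrow> 0) at_top"
proof (rule tendstoI)
  fix r :: real assume "0 < r"
  define D where "D = N * \<bar>q - q_star\<bar> + 1"
  have D: "0 < D" using N_ge_1 by (simp add: D_def add_nonneg_pos)
  obtain n where n: "(1 / 2) ^ n < r / D"
    using real_arch_pow_inv[of "r / D" "1 / 2"] \<open>0 < r\<close> D by auto
  obtain S where S: "\<And>t. S \<le> t \<Longrightarrow> infdist (flow (- \<delta>, q) t) cycle \<le> N * \<bar>q - q_star\<bar> * (1 / 2) ^ n"
    using section_decay[OF q, of n] by blast
  have "infdist (flow (- \<delta>, q) t) cycle < r" if "S \<le> t" for t
  proof -
    have "N * \<bar>q - q_star\<bar> * (1 / 2) ^ n \<le> D * (1 / 2) ^ n"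
      by (intro mult_right_mono) (auto simp: D_def)
    also have "\<dots> < r" using n D by (simp add: pos_less_divide_eq mult.commute)
    finally show ?thesis using S[OF that] by simp
  qed
  then show "\<forall>\<^sub>F t in at_top. dist (infdist (flow (- \<delta>, q) t) cycle) 0 < r"
    unfolding eventually_at_top_linorder by (auto simp: infdist_nonneg dist_real_def)
qed

text \<open>The cycle crosses \<open>x = - \<delta>\<close> with positive velocity at an interior point of the section. An orbit
that starts close to the cycle follows it past its next crossing after a full turn, hence crosses the section
itself, close to \<open>q_star\<close>.\<close>

lemma reach_section:
  assumes "0 < \<mu>"
  shows "\<exists>\<rho>>0. \<forall>p. \<forall>c\<in>cycle. norm (p - c) < \<rho> \<longrightarrow>
    (\<exists>\<theta>\<ge>0. \<exists>q\<in>{0..h}. \<bar>q - q_star\<bar> \<le> \<mu> \<and> flow p \<theta> = (- \<delta>, q) \<and>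
       (\<forall>t\<in>{0..\<theta>}. infdist (flow p t) cycle \<le> \<mu>))"
proof -
  let ?T = period
  have T: "0 < ?T" using period_pos by simp
  define \<mu>' where "\<mu>' = min \<mu> (min q_star (h - q_star))"
  have \<mu>': "0 < \<mu>'" using \<open>0 < \<mu>\<close> q_star by (simp add: \<mu>'_def)
  have \<mu>'_le: "\<mu>' \<le> \<mu>" "\<mu>' \<le> q_star" "\<mu>' \<le> h - q_star" unfolding \<mu>'_def by linarith+
  have dX: "((\<lambda>t. fst (\<gamma> t)) has_real_derivative q_star + a) (at 0)"
    using flow_X[of "(- \<delta>, q_star)" 0] by (simp add: \<gamma>_def flow_solves)
  have slope: "0 < q_star + a" using q_star a_pos by simp
  obtain \<nu>1 where \<nu>1: "0 < \<nu>1" "\<And>u. 0 < u \<Longrightarrow> u < \<nu>1 \<Longrightarrow> - \<delta> < fst (\<gamma> u)"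
    using DERIV_pos_inc_right[OF dX slope] by (auto simp: \<gamma>_0)
  obtain \<nu>2 where \<nu>2: "0 < \<nu>2" "\<And>u. 0 < u \<Longrightarrow> u < \<nu>2 \<Longrightarrow> fst (\<gamma> (- u)) < - \<delta>"
    using DERIV_pos_inc_left[OF dX slope] by (auto simp: \<gamma>_0)
  have "isCont (\<lambda>t. snd (\<gamma> t)) 0"
    using flow_Y[of "(- \<delta>, q_star)" 0] unfolding \<gamma>_def by (rule DERIV_isCont)
  then obtain \<nu>3 where \<nu>3: "0 < \<nu>3" "\<And>u. \<bar>u\<bar> < \<nu>3 \<Longrightarrow> \<bar>snd (\<gamma> u) - q_star\<bar> < \<mu>' / 2"
    using half_gt_zero[OF \<mu>'] unfolding continuous_at_eps_delta dist_real_def \<gamma>_0 snd_conv diff_zero by metis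
  define \<nu> where "\<nu> = min (min \<nu>1 \<nu>2) (min \<nu>3 ?T) / 2"
  have \<nu>: "0 < \<nu>" "\<nu> < \<nu>1" "\<nu> < \<nu>2" "\<nu> < \<nu>3" "\<nu> < ?T"
    using \<nu>1 \<nu>2 \<nu>3 T unfolding \<nu>_def by linarith+
  define k where "k = min (min (fst (\<gamma> \<nu>) + \<delta>) (- \<delta> - fst (\<gamma> (- \<nu>)))) (\<mu>' / 2)"
  have k: "0 < k" using \<nu>1(2)[of \<nu>] \<nu>2(2)[of \<nu>] \<nu> \<mu>' by (simp add: k_def)
  have k_le: "k \<le> fst (\<gamma> \<nu>) + \<delta>" "k \<le> - \<delta> - fst (\<gamma> (- \<nu>))" "k \<le> \<mu>' / 2"
    unfolding k_def by linarith+
  define E where "E = exp (4 * (3 * ?T))"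
  show ?thesis
  proof (rule exI[of _ "k / E"], intro conjI allI ballI impI)
    show "0 < k / E" using k by (simp add: E_def)
    fix p c assume c: "c \<in> cycle" and pc: "norm (p - c) < k / E"
    obtain \<tau> where \<tau>: "\<tau> \<in> {0..?T}" "c = \<gamma> \<tau>" using c by (auto simp: cycle_eq)
    have \<gamma>_shift: "flow c t = \<gamma> (\<tau> + t)" for t by (simp add: \<tau> \<gamma>_def flow_add)
    have close: "norm (flow p t - \<gamma> (\<tau> + t)) < k" if "0 \<le> t" "t \<le> 3 * ?T" for t
    proof -
      have "norm (flow p t - flow c t) \<le> E * norm (p - c)"
        unfolding E_def by (rule flow_expansion[OF that])
      also have "\<dots> < k" using pc by (simp add: E_def field_simps)
      finally show ?thesis by (simp add: \<gamma>_shift)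
    qed
    have per2: "\<gamma> (2 * ?T + u) = \<gamma> u" for u
      using \<gamma>_periodic[of "?T + u"] \<gamma>_periodic[of u] by (simp add: algebra_simps)
    \<comment> \<open>Times just before and after phase \<open>2 * ?T\<close>, where the cycle crosses the section; both are nonnegative for every phase \<open>\<tau>\<close>.\<close>
    define t1 t2 where "t1 = 2 * ?T - \<tau> - \<nu>" and "t2 = 2 * ?T - \<tau> + \<nu>"
    have t12: "0 \<le> t1" "t1 \<le> t2" "t2 \<le> 3 * ?T" using \<tau> \<nu> by (auto simp: t1_def t2_def)
    have "fst (flow p t1) < - \<delta>"
    proof -
      have "\<gamma> (\<tau> + t1) = \<gamma> (- \<nu>)" using per2[of "- \<nu>"] by (simp add: t1_def)
      then have "norm (flow p t1 - \<gamma> (- \<nu>)) < k" using close[of t1] t12 by simp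
      then show ?thesis
        using abs_fst_le_norm[of "flow p t1 - \<gamma> (- \<nu>)"] k_le(2) unfolding fst_diff by argo
    qed
    moreover have "- \<delta> < fst (flow p t2)"
    proof -
      have "\<gamma> (\<tau> + t2) = \<gamma> \<nu>" using per2[of \<nu>] by (simp add: t2_def)
      then have "norm (flow p t2 - \<gamma> \<nu>) < k" using close[of t2] t12 by simp
      then show ?thesis
        using abs_fst_le_norm[of "flow p t2 - \<gamma> \<nu>"] k_le(1) unfolding fst_diff by argo
    qed
    ultimately obtain \<theta> where \<theta>: "t1 \<le> \<theta>" "\<theta> \<le> t2" "fst (flow p \<theta>) = - \<delta>"
      using IVT'[of "\<lambda>t. fst (flow p t)" t1 "- \<delta>" t2] t12
      by (force intro: continuous_intros flow_continuous)
    define q where "q = snd (flow p \<theta>)"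
    have q: "\<bar>q - q_star\<bar> < \<mu>'"
    proof -
      define u where "u = \<tau> + \<theta> - 2 * ?T"
      have "\<gamma> (\<tau> + \<theta>) = \<gamma> u" using per2[of u] by (simp add: u_def)
      then have "norm (flow p \<theta> - \<gamma> u) < k" using close[of \<theta>] \<theta> t12 by simp
      then have "\<bar>q - snd (\<gamma> u)\<bar> < \<mu>' / 2"
        using abs_snd_le_norm[of "flow p \<theta> - \<gamma> u"] k_le(3) unfolding q_def snd_diff by linarith
      moreover have "\<bar>snd (\<gamma> u) - q_star\<bar> < \<mu>' / 2"
        using \<theta> \<nu> by (intro \<nu>3(2)) (auto simp: u_def t1_def t2_def abs_less_iff)
      ultimately show ?thesis by argo
    qed
    have "infdist (flow p t) cycle \<le> \<mu>" if t: "t \<in> {0..\<theta>}" for t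
    proof -
      have "infdist (flow p t) cycle \<le> dist (flow p t) (\<gamma> (\<tau> + t))"
        by (rule infdist_le) (simp add: cycle_def)
      also have "\<dots> \<le> k" using close[of t] t \<theta> t12 by (simp add: dist_norm)
      also have "\<dots> \<le> \<mu>' / 2" by (rule k_le)
      also have "\<dots> \<le> \<mu>" using \<mu>' \<mu>'_le(1) by linarith
      finally show ?thesis .
    qed
    moreover have "q \<in> {0..h}" "\<bar>q - q_star\<bar> \<le> \<mu>"
      using q \<mu>'_le unfolding atLeastAtMost_iff by linarith+
    moreover have "flow p \<theta> = (- \<delta>, q)" using \<theta>(3) by (simp add: q_def prod_eq_iff)
    ultimately show "\<exists>\<theta>\<ge>0. \<exists>q\<in>{0..h}. \<bar>q - q_star\<bar> \<le> \<mu> \<and> flow p \<theta> = (- \<delta>, q) \<and>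
       (\<forall>t\<in>{0..\<theta>}. infdist (flow p t) cycle \<le> \<mu>)"
      using \<theta>(1) t12(1) by (intro exI[of _ \<theta>] conjI bexI[of _ q]) auto
  qed
qed

lemma flow_attracted:
  assumes "open V" "cycle \<subseteq> V"
  shows "\<exists>U. open U \<and> cycle \<subseteq> U \<and>
    (\<forall>p\<in>U. (\<forall>t\<ge>0. flow p t \<in> V) \<and> ((\<lambda>t. infdist (flow p t) cycle) \<longlongrightarrow> 0) at_top)"
proof -
  obtain r where r: "0 < r" "(\<Union>x\<in>cycle. ball x r) \<subseteq> V"
    using compact_subset_open_imp_ball_epsilon_subset[OF cycle_compact assms] by blast
  have inV: "z \<in> V" if "infdist z cycle < r" for z
  proof -
    obtain x where "x \<in> cycle" "infdist z cycle = dist z x"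
      using infdist_attains_inf[OF cycle_closed cycle_nonempty] by blast
    then show ?thesis using that r(2) by (force simp: dist_commute)
  qed
  define \<mu> where "\<mu> = r / (2 * N)"
  have \<mu>: "0 < \<mu>" "\<mu> < r" "N * \<mu> < r" using r N_ge_1 by (auto simp: \<mu>_def field_simps)
  obtain \<rho> where "0 < \<rho>" and \<rho>: "\<And>p c. c \<in> cycle \<Longrightarrow> norm (p - c) < \<rho> \<Longrightarrow>
      \<exists>\<theta>\<ge>0. \<exists>q\<in>{0..h}. \<bar>q - q_star\<bar> \<le> \<mu> \<and> flow p \<theta> = (- \<delta>, q) \<and>
       (\<forall>t\<in>{0..\<theta>}. infdist (flow p t) cycle \<le> \<mu>)"
    using reach_section[OF \<mu>(1)] by metis
  show ?thesis
  proof (intro exI[of _ "\<Union>c\<in>cycle. ball c \<rho>"] conjI ballI)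
    show "cycle \<subseteq> (\<Union>c\<in>cycle. ball c \<rho>)" using \<open>0 < \<rho>\<close> by auto
    fix p assume "p \<in> (\<Union>c\<in>cycle. ball c \<rho>)"
    then obtain c where "c \<in> cycle" "norm (p - c) < \<rho>" by (auto simp: dist_norm norm_minus_commute)
    then obtain \<theta> q where \<theta>: "0 \<le> \<theta>" and q: "q \<in> {0..h}" "\<bar>q - q_star\<bar> \<le> \<mu>" "flow p \<theta> = (- \<delta>, q)"
      and early: "\<And>t. t \<in> {0..\<theta>} \<Longrightarrow> infdist (flow p t) cycle \<le> \<mu>"
      using \<rho> by blast
    have late: "flow p t = flow (- \<delta>, q) (t - \<theta>)" for t
      using flow_add[of p \<theta> "t - \<theta>"] q(3) by simp
    show "\<forall>t\<ge>0. flow p t \<in> V"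
    proof (intro allI impI inV)
      fix t :: real assume "0 \<le> t"
      show "infdist (flow p t) cycle < r"
      proof (cases "t \<le> \<theta>")
        case True
        then show ?thesis using early[of t] \<open>0 \<le> t\<close> \<mu> by simp
      next
        case False
        then have "infdist (flow p t) cycle \<le> N * \<bar>q - q_star\<bar>"
          unfolding late[of t] by (intro section_infdist[OF q(1)]) simp
        also have "\<dots> \<le> N * \<mu>" using q(2) N_ge_1 by (intro mult_left_mono) auto
        finally show ?thesis using \<mu> by simp
      qed
    qed
    have "filterlim (\<lambda>t. t - \<theta>) at_top at_top"
      using filterlim_tendsto_add_at_top[OF tendsto_const[of "- \<theta>"] filterlim_ident] by simp
    from filterlim_compose[OF section_converges[OF q(1)] this]
    show "((\<lambda>t. infdist (flow p t) cycle) \<longlongrightarrow> 0) at_top" unfolding late[symmetric] .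
  qed auto
qed

text \<open>The distance of a periodic solution to the cycle is periodic, so it can tend to 0 only by being 0.\<close>

lemma periodic_attracted_eq_cycle:
  assumes \<phi>: "solution_on (rayleigh_field a g) \<phi> UNIV" and "0 < P" and per: "\<And>t. \<phi> (t + P) = \<phi> t"
    and lim: "((\<lambda>t. infdist (\<phi> t) cycle) \<longlongrightarrow> 0) at_top"
  shows "range \<phi> = cycle"
proof -
  have "infdist (\<phi> 0) cycle = 0"
  proof (rule LIMSEQ_unique)
    have "filterlim (\<lambda>n. real n * P) at_top sequentially"
      using \<open>0 < P\<close> by (intro filterlim_at_top_mult_tendsto_pos[OF tendsto_const] filterlim_real_sequentially)
    from filterlim_compose[OF lim this]
    show "(\<lambda>n. infdist (\<phi> (real n * P)) cycle) \<longlonglongrightarrow> 0" .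
    have "\<phi> (real n * P) = \<phi> 0" for n
      using periodic_int[of \<phi> P 0 "int n", OF per] by simp
    then show "(\<lambda>n. infdist (\<phi> (real n * P)) cycle) \<longlonglongrightarrow> infdist (\<phi> 0) cycle" by simp
  qed
  then have "\<phi> 0 \<in> cycle" using in_closed_iff_infdist_zero[OF cycle_closed cycle_nonempty] by blast
  then obtain \<tau> where \<tau>: "\<phi> 0 = \<gamma> \<tau>" by (auto simp: cycle_def)
  have "\<phi> = (\<lambda>t. \<gamma> (t + \<tau>))"
    using flow_unique[OF \<phi>] flow_unique[OF solution_on_shift[OF \<gamma>_solves, of \<tau>]] \<tau> by simp
  then have "range \<phi> = range (\<lambda>t. \<gamma> (t + \<tau>))" by simp
  also have "\<dots> = cycle" unfolding cycle_def
    by (auto simp: image_iff) (metis diff_add_cancel)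
  finally show ?thesis .
qed

lemma through_section_eq_cycle:
  assumes \<phi>: "solution_on (rayleigh_field a g) \<phi> UNIV" and "0 < P" and per: "\<And>t. \<phi> (t + P) = \<phi> t"
    and q: "\<phi> t0 = (- \<delta>, q)" "q \<in> {0..h}"
  shows "range \<phi> = cycle"
proof -
  have sh: "solution_on (rayleigh_field a g) (\<lambda>t. \<phi> (t + t0)) UNIV" by (rule solution_on_shift[OF \<phi>])
  have "(\<lambda>t. \<phi> (t + t0)) = flow (- \<delta>, q)" using flow_unique[OF sh] q by simp
  then have "((\<lambda>t. infdist (\<phi> (t + t0)) cycle) \<longlongrightarrow> 0) at_top"
    using section_converges[OF q(2)] by metis
  then have "range (\<lambda>t. \<phi> (t + t0)) = cycle"
    by (intro periodic_attracted_eq_cycle[OF sh \<open>0 < P\<close>]) (use per[of "_ + t0"] in \<open>auto simp: algebra_simps\<close>)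
  moreover have "range (\<lambda>t. \<phi> (t + t0)) = range \<phi>"
    by (auto simp: image_iff) (metis diff_add_cancel)
  ultimately show ?thesis by simp
qed

end


section \<open>Periodic orbits of the full system\<close>

lemma rayleigh_solution_cong:
  assumes "solution_on (rayleigh_field a f) \<phi> I" "\<And>t. t \<in> I \<Longrightarrow> g (snd (\<phi> t)) = f (snd (\<phi> t))"
  shows "solution_on (rayleigh_field a g) \<phi> I"
  using assms by (auto simp: rayleigh_solution_on_iff)

lemma periodic_increasing_constant:
  fixes E :: "real \<Rightarrow> real"
  assumes der: "\<And>t. (E has_real_derivative D t) (at t)" and "\<And>t. 0 \<le> D t"
    and per: "\<And>t. E (t + P) = E t" and "0 < P"
  shows "D t = 0"
proof -
  have mono: "E u \<le> E v" if "u \<le> v" for u v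
    using that der assms(2) by (intro DERIV_nonneg_imp_nondecreasing[of u v E]) auto
  have const: "E v = E 0" for v
  proof -
    obtain k :: nat where k: "\<bar>v\<bar> / P \<le> real k" using real_arch_simple by blast
    then have "\<bar>v\<bar> \<le> real k * P" using \<open>0 < P\<close> by (simp add: pos_divide_le_eq)
    moreover have "E (0 + of_int (int k) * P) = E 0" "E (0 + of_int (- int k) * P) = E 0"
      by (rule periodic_int, rule per)+
    ultimately show ?thesis
      using mono[of v "real k * P"] mono[of "- (real k * P)" v] by (simp add: abs_le_iff)
  qed
  have "E = (\<lambda>_. E 0)" using const by blast
  then have "(E has_real_derivative 0) (at t)" by (metis DERIV_const)
  then show ?thesis using der DERIV_unique by blast
qed

text \<open>The actual nonlinearity \<open>f\<close> grows exponentially, so the flow is defined by a globally Lipschitz \<open>g\<close>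
that agrees with \<open>f\<close> up to height 2, well above the cycle. The last conditions describe the shape of \<open>f\<close>
and serve to locate arbitrary periodic orbits: \<open>f_roof\<close> bounds their height, and the other two compare \<open>f\<close>
with its value at the equilibrium height \<open>- a\<close>.\<close>

locale truncated_loop = contracting_loop a g L b B e \<delta> h \<kappa> s M m K
  for a :: real and g :: "real \<Rightarrow> real" and L b B e \<delta> h \<kappa> s M m K :: real +
  fixes f :: "real \<Rightarrow> real"
  assumes g_eq: "\<And>y. y \<le> 2 \<Longrightarrow> g y = f y"
    and f_one_sided: "\<And>y z. (y - z) * (f y - f z) \<le> 3 * (y - z)\<^sup>2"
    and f_0: "f 0 = 0"
    and f_increasing: "\<And>y z. y < z \<Longrightarrow> z \<le> 0 \<Longrightarrow> f y < f z"
    and f_roof: "\<And>y. h \<le> y \<Longrightarrow> f y < - M"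
    and f_hump: "\<And>y z. 0 \<le> y \<Longrightarrow> y \<le> z \<Longrightarrow> - \<delta> \<le> f z \<Longrightarrow> f (- a) < f y"
begin

abbreviation "F \<equiv> rayleigh_field a f"

lemma F_one_sided: "inner (p - q) (F p - F q) \<le> 3 * (norm (p - q))\<^sup>2"
  by (rule rayleigh_one_sided[OF f_one_sided]) simp

lemma truncate: "solution_on F \<phi> I \<Longrightarrow> (\<And>t. t \<in> I \<Longrightarrow> snd (\<phi> t) \<le> 2) \<Longrightarrow> solution_on (rayleigh_field a g) \<phi> I"
  by (erule rayleigh_solution_cong) (simp add: g_eq)

lemma untruncate: "solution_on (rayleigh_field a g) \<phi> I \<Longrightarrow> (\<And>t. t \<in> I \<Longrightarrow> snd (\<phi> t) \<le> 2) \<Longrightarrow> solution_on F \<phi> I"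
  by (erule rayleigh_solution_cong) (simp add: g_eq)

lemma cycle_roof: "z \<in> cycle \<Longrightarrow> snd z \<le> h"
  using ret_slide(4)[OF q_star(1)] by (auto simp: cycle_eq \<gamma>_def period_def)

lemma cycle_periodic_orbit: "periodic_orbit F cycle"
  unfolding periodic_orbit_def
proof (rule exI[of _ \<gamma>], rule exI[of _ period], intro conjI allI)
  show "solution_on F \<gamma> UNIV"
  proof (rule untruncate[OF \<gamma>_solves])
    show "snd (\<gamma> t) \<le> 2" for t using cycle_roof[of "\<gamma> t"] sizes by (simp add: cycle_def)
  qed
  show "0 < period" using period_pos by simp
  show "\<exists>t. \<gamma> t \<noteq> \<gamma> 0" using \<gamma>_nonconstant by blast
qed (auto simp: cycle_def \<gamma>_periodic)

text \<open>Asking also for height below 2 keeps the orbits inside the region where both systems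
agree.\<close>

lemma cycle_attracts:
  assumes "open V" "cycle \<subseteq> V"
  shows "\<exists>U. open U \<and> cycle \<subseteq> U \<and> (\<forall>p\<in>U. solution_on F (flow p) {0..} \<and>
    (\<forall>t\<ge>0. flow p t \<in> V \<and> snd (flow p t) < 2) \<and> ((\<lambda>t. infdist (flow p t) cycle) \<longlongrightarrow> 0) at_top)"
proof -
  have "open (V \<inter> {z. snd z < 2})"
    using assms(1) by (intro open_Int open_Collect_less continuous_intros)
  moreover have "cycle \<subseteq> V \<inter> {z. snd z < 2}" using assms(2) cycle_roof sizes by force
  ultimately obtain U where U: "open U" "cycle \<subseteq> U"
    and p: "\<And>p. p \<in> U \<Longrightarrow> (\<forall>t\<ge>0. flow p t \<in> V \<inter> {z. snd z < 2}) \<and> ((\<lambda>t. infdist (flow p t) cycle) \<longlongrightarrow> 0) at_top"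
    using flow_attracted[of "V \<inter> {z. snd z < 2}"] by blast
  show ?thesis
  proof (intro exI[of _ U] conjI U ballI)
    fix z assume z: "z \<in> U"
    have "solution_on (rayleigh_field a g) (flow z) {0..}"
      using flow_solves(2) by (rule solution_on_subset) simp
    then show "solution_on F (flow z) {0..}"
      by (rule untruncate) (use p[OF z] in \<open>auto simp: less_imp_le\<close>)
    show "\<forall>t\<ge>0. flow z t \<in> V \<and> snd (flow z t) < 2" "((\<lambda>t. infdist (flow z t) cycle) \<longlongrightarrow> 0) at_top"
      using p[OF z] by auto
  qed
qed

lemma cycle_attracting: "attracting F cycle"
  unfolding attracting_def
proof (intro allI impI)
  fix V assume "open V \<and> cycle \<subseteq> V"
  then have "open V" "cycle \<subseteq> V" by auto
  from cycle_attracts[OF this] obtain U where U: "open U \<and> cycle \<subseteq> U \<and> (\<forall>p\<in>U. solution_on F (flow p) {0..} \<and>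
    (\<forall>t\<ge>0. flow p t \<in> V \<and> snd (flow p t) < 2) \<and> ((\<lambda>t. infdist (flow p t) cycle) \<longlongrightarrow> 0) at_top)" ..
  show "\<exists>U. open U \<and> cycle \<subseteq> U \<and> (\<forall>p\<in>U. \<exists>\<phi>. \<phi> 0 = p \<and> solution_on F \<phi> {0..} \<and>
      (\<forall>t\<ge>0. \<phi> t \<in> V) \<and> ((\<lambda>t. infdist (\<phi> t) cycle) \<longlongrightarrow> 0) at_top)"
  proof (intro exI[of _ U] conjI ballI)
    fix p assume "p \<in> U"
    with U have "solution_on F (flow p) {0..} \<and>
        (\<forall>t\<ge>0. flow p t \<in> V \<and> snd (flow p t) < 2) \<and> ((\<lambda>t. infdist (flow p t) cycle) \<longlongrightarrow> 0) at_top"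
      by blast
    then show "\<exists>\<phi>. \<phi> 0 = p \<and> solution_on F \<phi> {0..} \<and>
      (\<forall>t\<ge>0. \<phi> t \<in> V) \<and> ((\<lambda>t. infdist (\<phi> t) cycle) \<longlongrightarrow> 0) at_top"
      by (intro exI[of _ "flow p"]) (simp add: flow_solves)
  qed (use U in auto)
qed

lemma cycle_limit_cycle: "limit_cycle F cycle"
  unfolding limit_cycle_def
proof (intro conjI cycle_periodic_orbit)
  from cycle_attracts[OF open_UNIV subset_UNIV] obtain U where "open U \<and> cycle \<subseteq> U \<and> (\<forall>p\<in>U. solution_on F (flow p) {0..} \<and>
    (\<forall>t\<ge>0. flow p t \<in> UNIV \<and> snd (flow p t) < 2) \<and> ((\<lambda>t. infdist (flow p t) cycle) \<longlongrightarrow> 0) at_top)" ..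
  then have U: "open U" "cycle \<subseteq> U" and p: "\<And>p. p \<in> U \<Longrightarrow> solution_on F (flow p) {0..} \<and>
    (\<forall>t\<ge>0. snd (flow p t) < 2) \<and> ((\<lambda>t. infdist (flow p t) cycle) \<longlongrightarrow> 0) at_top"
    by auto
  have "D = cycle" if D: "periodic_orbit F D" "D \<inter> U \<noteq> {}" for D
  proof -
    obtain \<phi> P where \<phi>: "solution_on F \<phi> UNIV" "0 < P" and per: "\<And>t. \<phi> (t + P) = \<phi> t" and D': "D = range \<phi>"
      using D(1) unfolding periodic_orbit_def by blast
    obtain t0 where t0: "\<phi> t0 \<in> U" using D(2) D' by blast
    define \<psi> where "\<psi> = (\<lambda>t. \<phi> (t + t0))"
    have \<psi>: "solution_on F \<psi> UNIV" unfolding \<psi>_def by (rule solution_on_shift[OF \<phi>(1)])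
    have per': "\<psi> (t + P) = \<psi> t" for t using per[of "t + t0"] by (simp add: \<psi>_def algebra_simps)
    have "\<psi> 0 \<in> U" using t0 by (simp add: \<psi>_def)
    note p0 = p[OF this]
    have forward: "\<psi> t = flow (\<psi> 0) t" if "0 \<le> t" for t
      by (rule forward_uniqueness[OF F_one_sided _ solution_on_subset[OF \<psi>]])
        (use p0 that in \<open>auto simp: flow_solves\<close>)
    have "snd (\<psi> t) \<le> 2" for t
    proof -
      obtain u where "0 \<le> u" "\<psi> u = \<psi> t"
        by (rule periodic_representative[where \<phi> = \<psi> and T = P and c = 0 and t = t]) (use per' \<phi>(2) in auto)
      then show ?thesis using forward[of u] p0 by (metis less_imp_le)
    qed
    then have \<psi>g: "solution_on (rayleigh_field a g) \<psi> UNIV" by (intro truncate[OF \<psi>])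
    have "((\<lambda>t. infdist (\<psi> t) cycle) \<longlongrightarrow> 0) at_top"
    proof (rule Lim_transform_eventually)
      show "((\<lambda>t. infdist (flow (\<psi> 0) t) cycle) \<longlongrightarrow> 0) at_top" using p0 by blast
      show "\<forall>\<^sub>F t in at_top. infdist (flow (\<psi> 0) t) cycle = infdist (\<psi> t) cycle"
        by (rule eventually_at_top_linorderI[of 0]) (simp add: forward[symmetric])
    qed
    then have "range \<psi> = cycle" by (rule periodic_attracted_eq_cycle[OF \<psi>g \<phi>(2) per'])
    moreover have "range \<psi> = D" unfolding D' \<psi>_def by (auto simp: image_iff) (metis diff_add_cancel)
    ultimately show ?thesis by simp
  qed
  then show "\<exists>U. open U \<and> cycle \<subseteq> U \<and> (\<forall>D. periodic_orbit F D \<and> D \<inter> U \<noteq> {} \<longrightarrow> D = cycle)"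
    using U by blast
qed

text \<open>Let \<open>E\<close> be the squared distance to the equilibrium \<open>(f (- a), - a)\<close>. Along solutions
\<open>E' = 2 (y + a) (f y - f (- a))\<close>, which is positive for \<open>y \<le> 0\<close> other than \<open>- a\<close>, and for \<open>y > 0\<close> as
long as \<open>f y > f (- a)\<close>. So an orbit that does not climb to heights where \<open>f\<close> is strongly negative never
loses energy, and can only be periodic if it is the equilibrium.\<close>

lemma energy_forces_crossing:
  assumes \<phi>: "solution_on F \<phi> UNIV" and "0 < P" and per: "\<And>t. \<phi> (t + P) = \<phi> t" and nonconst: "\<phi> t' \<noteq> \<phi> 0"
    and top: "\<And>t. snd (\<phi> t) \<le> snd (\<phi> t0)"
  shows "0 \<le> snd (\<phi> t0) \<and> f (snd (\<phi> t0)) < - \<delta>"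
proof (rule ccontr)
  assume neg: "\<not> ?thesis"
  have growth: "0 < (y + a) * (f y - f (- a))" if "y \<le> snd (\<phi> t0)" "y \<noteq> - a" for y
  proof (cases "y \<le> 0")
    case True
    then show ?thesis using f_increasing[of y "- a"] f_increasing[of "- a" y] that a_pos
      by (cases "y < - a") (auto intro: mult_neg_neg mult_pos_pos)
  next
    case False
    then have "f (- a) < f y" using neg that by (intro f_hump[of y "snd (\<phi> t0)"]) auto
    then show ?thesis using False a_pos by simp
  qed
  have X: "((\<lambda>t. fst (\<phi> t)) has_real_derivative snd (\<phi> t) + a) (at t)"
    and Y: "((\<lambda>t. snd (\<phi> t)) has_real_derivative - fst (\<phi> t) + f (snd (\<phi> t))) (at t)" for t
    using \<phi> by (auto simp: rayleigh_solution_on_iff)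
  define E where "E t = (fst (\<phi> t) - f (- a))\<^sup>2 + (snd (\<phi> t) + a)\<^sup>2" for t
  have dE: "(E has_real_derivative 2 * ((snd (\<phi> t) + a) * (f (snd (\<phi> t)) - f (- a)))) (at t)" for t
    unfolding E_def by (auto intro!: derivative_eq_intros X Y simp: algebra_simps)
  have nonneg: "0 \<le> 2 * ((snd (\<phi> t) + a) * (f (snd (\<phi> t)) - f (- a)))" for t
    using growth[OF top[of t]] by (cases "snd (\<phi> t) = - a") (auto simp: less_imp_le)
  have zero: "2 * ((snd (\<phi> t) + a) * (f (snd (\<phi> t)) - f (- a))) = 0" for t
    by (rule periodic_increasing_constant[OF dE nonneg _ \<open>0 < P\<close>]) (simp add: E_def per)
  have Ya: "snd (\<phi> t) = - a" for t
    using growth[OF top[of t]] zero[of t] by fastforce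
  have "(\<lambda>t. snd (\<phi> t)) = (\<lambda>_. - a)" using Ya by blast
  then have "- fst (\<phi> t) + f (- a) = 0" for t
    using DERIV_unique[OF Y[of t]] Ya by (metis DERIV_const)
  then have "\<phi> t = (f (- a), - a)" for t using Ya by (simp add: prod_eq_iff)
  then show False using nonconst by simp
qed

text \<open>At its highest point a periodic orbit is on the nullcline \<open>x = f y\<close>. In a ball of radius at most \<open>M\<close> this
puts the highest point below \<open>h\<close>, and the energy argument puts it to the left of the section with
\<open>y \<ge> 0\<close>. From there the orbit drifts to the right at speed at least \<open>a\<close>, and it cannot drop below
\<open>y = 0\<close> while \<open>x < 0\<close>; so it meets the section, from which every orbit converges to the cycle.\<close>

lemma periodic_orbit_in_ball:
  assumes D: "periodic_orbit F D" "D \<subseteq> cball 0 r" and rM: "r \<le> M"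
  shows "D = cycle"
proof -
  obtain \<phi> P t' where \<phi>: "solution_on F \<phi> UNIV" "0 < P" and per: "\<And>t. \<phi> (t + P) = \<phi> t"
    and t': "\<phi> t' \<noteq> \<phi> 0" and D': "D = range \<phi>"
    using D(1) unfolding periodic_orbit_def by blast
  have X: "((\<lambda>t. fst (\<phi> t)) has_real_derivative snd (\<phi> t) + a) (at t)"
    and Y: "((\<lambda>t. snd (\<phi> t)) has_real_derivative - fst (\<phi> t) + f (snd (\<phi> t))) (at t)" for t
    using \<phi> by (auto simp: rayleigh_solution_on_iff)
  have inball: "\<bar>fst (\<phi> t)\<bar> \<le> r" for t
  proof -
    have "\<phi> t \<in> cball 0 r" using D(2) D' by blast
    then have "norm (\<phi> t) \<le> r" by simp
    then show ?thesis using abs_fst_le_norm[of "\<phi> t"] by simp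
  qed
  have "continuous_on {0..P} (\<lambda>t. snd (\<phi> t))"
    using Y by (meson DERIV_continuous continuous_at_imp_continuous_on)
  then obtain t0 where t0: "t0 \<in> {0..P}" "\<And>t. t \<in> {0..P} \<Longrightarrow> snd (\<phi> t) \<le> snd (\<phi> t0)"
    using continuous_attains_sup[of "{0..P}" "\<lambda>t. snd (\<phi> t)"] \<phi>(2) by auto
  have top: "snd (\<phi> t) \<le> snd (\<phi> t0)" for t
  proof -
    obtain u where "0 \<le> u" "u < 0 + P" "\<phi> u = \<phi> t"
      by (rule periodic_representative[where \<phi> = \<phi> and T = P and c = 0 and t = t]) (use per \<phi>(2) in auto)
    then show ?thesis using t0(2)[of u] by simp
  qed
  have crit: "- fst (\<phi> t0) + f (snd (\<phi> t0)) = 0"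
    by (rule DERIV_local_max[OF Y[of t0], of 1]) (use top in auto)
  have roof: "snd (\<phi> t0) < h"
  proof (rule ccontr)
    assume "\<not> ?thesis"
    then have "f (snd (\<phi> t0)) < - M" by (intro f_roof) simp
    then show False using crit inball[of t0] rM by (simp add: abs_le_iff)
  qed
  have cross: "0 \<le> snd (\<phi> t0)" "fst (\<phi> t0) < - \<delta>"
    using energy_forces_crossing[OF \<phi> per t' top] crit by auto
  have below: "snd (\<phi> t) < h" for t using top[of t] roof by simp
  have \<phi>g: "solution_on (rayleigh_field a g) \<phi> UNIV"
  proof (rule truncate[OF \<phi>(1)])
    show "snd (\<phi> t) \<le> 2" for t using below[of t] sizes(5,6) by linarith
  qed
  have \<phi>_flow: "\<phi> = flow (\<phi> 0)" by (rule flow_unique[OF \<phi>g])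
  have up: "0 \<le> snd (\<phi> t)" if "t0 \<le> t" "t \<le> t1" and left: "\<And>u. u \<in> {t0..t1} \<Longrightarrow> fst (\<phi> u) \<le> - \<delta>" for t t1
  proof -
    have "0 \<le> snd (\<phi> t) \<and> 0 \<le> snd (\<phi> t)"
    proof (rule joint_barrier[where ?w1.0 = "\<lambda>t. snd (\<phi> t)" and ?w2.0 = "\<lambda>t. snd (\<phi> t)" and ?t0.0 = t0 and ?t1.0 = t1])
      fix u assume "u \<in> {t0..t1}"
      show "((\<lambda>t. snd (\<phi> t)) has_real_derivative - fst (\<phi> u) + f (snd (\<phi> u))) (at u)" by (rule Y)
      then show "((\<lambda>t. snd (\<phi> t)) has_real_derivative - fst (\<phi> u) + f (snd (\<phi> u))) (at u)" .
      assume "snd (\<phi> u) = 0"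
      then show "0 < - fst (\<phi> u) + f (snd (\<phi> u))" using left[OF \<open>u \<in> {t0..t1}\<close>] f_0 sizes by simp
      then show "0 < - fst (\<phi> u) + f (snd (\<phi> u))" .
    qed (use that cross in auto)
    then show ?thesis by simp
  qed
  define v where "v = t0 + r / a"
  have r0: "0 \<le> r" using inball[of 0] by simp
  have v: "t0 \<le> v" using r0 a_pos by (simp add: v_def)
  have "\<exists>w\<in>{t0..v}. - \<delta> \<le> fst (\<phi> w)"
  proof (rule ccontr)
    assume none: "\<not> ?thesis"
    then have left: "fst (\<phi> u) \<le> - \<delta>" if "u \<in> {t0..v}" for u using that by force
    have "(0 + a) * (v - t0) \<le> fst (flow (\<phi> 0) v) - fst (flow (\<phi> 0) t0)"
      using v up[OF _ _ left] by (intro X_lower) (auto simp flip: \<phi>_flow)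
    then have "r \<le> fst (\<phi> v) - fst (\<phi> t0)" using a_pos by (simp add: v_def flip: \<phi>_flow)
    then have "0 \<le> fst (\<phi> v)" using inball[of t0] by (simp add: abs_le_iff)
    then show False using left[of v] v sizes by simp
  qed
  then obtain w where w: "w \<in> {t0..v}" "- \<delta> \<le> fst (\<phi> w)" by blast
  have "continuous_on {t0..w} (\<lambda>t. fst (\<phi> t))"
    using X by (meson DERIV_continuous continuous_at_imp_continuous_on)
  then obtain t1 where t1: "t1 \<in> {t0..w}" "fst (\<phi> t1) = - \<delta>" "\<And>u. u \<in> {t0..t1} \<Longrightarrow> fst (\<phi> u) \<le> - \<delta>"
    using first_hit[of t0 w "\<lambda>t. fst (\<phi> t)" "- \<delta>"] w cross by auto
  have "snd (\<phi> t1) \<in> {0..h}" using up[of t1 t1] t1 below[of t1] by simp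
  moreover have "\<phi> t1 = (- \<delta>, snd (\<phi> t1))" using t1(2) by (simp add: prod_eq_iff)
  ultimately show ?thesis
    unfolding D' by (intro through_section_eq_cycle[OF \<phi>g \<phi>(2) per])
qed

end

section \<open>Distance to the singular cycle\<close>

lemma hausdorff_distance_bounds:
  assumes "A \<noteq> {}" "B \<noteq> {}" "\<And>x. x \<in> A \<Longrightarrow> infdist x B \<le> \<eta>" "\<And>y. y \<in> B \<Longrightarrow> infdist y A \<le> \<eta>"
  shows "0 \<le> hausdorff_distance A B" "hausdorff_distance A B \<le> \<eta>"
proof -
  show "hausdorff_distance A B \<le> \<eta>"
    unfolding hausdorff_distance_def using assms by (auto intro!: cSUP_least)
  obtain x where x: "x \<in> A" using assms by blast
  have "bdd_above ((\<lambda>x. infdist x B) ` A)" using assms by (intro bdd_aboveI2) auto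
  then have "infdist x B \<le> (SUP x\<in>A. infdist x B)" using x by (intro cSUP_upper)
  then show "0 \<le> hausdorff_distance A B"
    unfolding hausdorff_distance_def using infdist_nonneg[of x B] by linarith
qed

lemma infdist_le_coords:
  fixes z :: "real \<times> real"
  assumes "(u, v) \<in> A"
  shows "infdist z A \<le> \<bar>fst z - u\<bar> + \<bar>snd z - v\<bar>"
proof -
  have "infdist z A \<le> dist z (u, v)" using assms by (rule infdist_le)
  also have "\<dots> \<le> \<bar>fst z - u\<bar> + \<bar>snd z - v\<bar>"
    using norm_Pair_le[of "fst z - u" "snd z - v"] by (simp add: dist_norm minus_prod_def)
  finally show ?thesis .
qed

context contracting_loop
begin

text \<open>The cycle follows the fold orbit until its return and \<open>[x_d, 0] \<times> {0}\<close> afterwards.\<close>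

lemma cycle_near_singular:
  assumes "z \<in> cycle"
  shows "infdist z (singular_cycle a b) \<le> 2 * \<kappa>"
proof -
  obtain t where t: "t \<in> {0..period}" "z = \<gamma> t" using assms by (auto simp: cycle_eq)
  show ?thesis
  proof (cases "t \<le> Tr")
    case True
    have "infdist z (singular_cycle a b) \<le> dist z (fold_orbit a b t)"
      using t True by (intro infdist_le) (simp add: singular_cycle_def)
    also have "\<dots> \<le> \<kappa>" using fold_shadowing[OF q_star(1), of t] t True by (simp add: dist_norm \<gamma>_def)
    finally show ?thesis using sizes by simp
  next
    case False
    then have t': "t \<in> {Tr..ret q_star}" "t \<in> {0..ret q_star}" using t by (auto simp: period_def)
    have X: "xd - \<kappa> \<le> fst z" "fst z \<le> - \<delta>" and Y: "- \<kappa> \<le> snd z" "snd z \<le> h"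
      using ret_slide(3,5,6)[OF q_star(1) t'(1)] ret_slide(4)[OF q_star(1) t'(2)] by (auto simp: t(2) \<gamma>_def)
    have "(max (fst z) xd, 0) \<in> singular_cycle a b"
      using X fold_facts(4) sizes by (auto simp: singular_cycle_def)
    from infdist_le_coords[OF this, of z] show ?thesis using X Y sizes by (simp add: max_def split: if_splits)
  qed
qed

text \<open>Points \<open>(x, 0)\<close> of the segment away from its two ends are approached by the intermediate value
theorem: after the return, the \<open>x\<close>-coordinate of the cycle runs through all values up to \<open>- \<delta>\<close>.\<close>

lemma singular_near_cycle:
  assumes "z \<in> singular_cycle a b"
  shows "infdist z cycle \<le> 2 * \<kappa>"
proof -
  consider t where "t \<in> {0..Tr}" "z = fold_orbit a b t" | x where "x \<in> {xd..0}" "z = (x, 0)"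
    using assms by (auto simp: singular_cycle_def)
  then show ?thesis
  proof cases
    case 1
    have "infdist z cycle \<le> dist z (\<gamma> t)" by (rule infdist_le) (simp add: cycle_def)
    also have "\<dots> \<le> \<kappa>" using fold_shadowing[OF q_star(1) 1(1)] 1 by (simp add: dist_norm norm_minus_commute \<gamma>_def)
    finally show ?thesis using sizes by simp
  next
    case 2
    have on: "(fst (\<gamma> t), snd (\<gamma> t)) \<in> cycle" for t by (simp add: cycle_def)
    note bound = infdist_le_coords[OF on]
    have T: "Tr < ret q_star" using period_pos by (simp add: period_def)
    have Yret: "\<bar>Y q_star t\<bar> \<le> \<kappa>" if "t \<in> {Tr..ret q_star}" for t
      using ret_slide(3)[OF q_star(1) that] ret_slide(4)[OF q_star(1), of t] that period_pos(1) sizes by simp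
    have "\<exists>t. \<bar>x - fst (\<gamma> t)\<bar> \<le> \<kappa> \<and> \<bar>snd (\<gamma> t)\<bar> \<le> \<kappa>"
    proof (cases "- \<delta> \<le> x")
      case True
      then show ?thesis using 2 q_star sizes by (intro exI[of _ 0]) (simp add: \<gamma>_0)
    next
      case False
      show ?thesis
      proof (cases "x \<le> X q_star Tr")
        case True
        then show ?thesis using at_return[OF q_star(1)] 2 by (intro exI[of _ Tr]) (auto simp: \<gamma>_def)
      next
        case False
        then have "\<exists>t\<ge>Tr. t \<le> ret q_star \<and> X q_star t = x"
          using \<open>\<not> - \<delta> \<le> x\<close> ret_facts(3)[OF q_star(1)] T
          by (intro IVT') (auto intro: continuous_intros flow_continuous)
        then obtain t where "t \<in> {Tr..ret q_star}" "X q_star t = x" by auto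
        then show ?thesis using Yret[of t] sizes by (intro exI[of _ t]) (simp add: \<gamma>_def)
      qed
    qed
    then obtain t where "\<bar>x - fst (\<gamma> t)\<bar> \<le> \<kappa>" "\<bar>snd (\<gamma> t)\<bar> \<le> \<kappa>" by blast
    then show ?thesis using bound[of z t] 2 by simp
  qed
qed

lemma hausdorff_cycle:
  "0 \<le> hausdorff_distance cycle (singular_cycle a b)" "hausdorff_distance cycle (singular_cycle a b) \<le> 2 * \<kappa>"
proof -
  have "singular_cycle a b \<noteq> {}" using fold_facts(1) by (auto simp: singular_cycle_def)
  from hausdorff_distance_bounds[OF cycle_nonempty this, of "2 * \<kappa>"]
  show "0 \<le> hausdorff_distance cycle (singular_cycle a b)" "hausdorff_distance cycle (singular_cycle a b) \<le> 2 * \<kappa>"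
    using cycle_near_singular singular_near_cycle by blast+
qed

end


section \<open>The exponential nonlinearity\<close>

definition lc_force :: "real \<Rightarrow> real \<Rightarrow> real \<Rightarrow> real" where
  "lc_force b \<epsilon> y = b * y * (2 - exp (y / \<epsilon>))"

text \<open>The derivative of \<open>lc_force\<close>.\<close>

definition lc_slope :: "real \<Rightarrow> real \<Rightarrow> real \<Rightarrow> real" where
  "lc_slope b \<epsilon> y = b * (2 - exp (y / \<epsilon>) * (1 + y / \<epsilon>))"

context
  fixes b \<epsilon> :: real
  assumes b: "0 < b" "b < 1" and eps: "0 < \<epsilon>"
begin

lemma lc_force_deriv: "(lc_force b \<epsilon> has_real_derivative lc_slope b \<epsilon> y) (at y)"
  unfolding lc_force_def[abs_def] lc_slope_def using eps
  by (auto intro!: derivative_eq_intros simp: field_simps)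

lemma lc_force_mvt:
  assumes "y < z"
  obtains \<xi> where "y < \<xi>" "\<xi> < z" "lc_force b \<epsilon> z - lc_force b \<epsilon> y = (z - y) * lc_slope b \<epsilon> \<xi>"
  using MVT2[OF assms, of "lc_force b \<epsilon>" "lc_slope b \<epsilon>"] lc_force_deriv by blast

lemma lc_force_one_sided_if_slope_le:
  assumes slope: "\<And>\<xi>. min y z < \<xi> \<Longrightarrow> \<xi> < max y z \<Longrightarrow> lc_slope b \<epsilon> \<xi> \<le> c"
  shows "(y - z) * (lc_force b \<epsilon> y - lc_force b \<epsilon> z) \<le> c * (y - z)\<^sup>2"
proof -
  have main: "(u - v) * (lc_force b \<epsilon> u - lc_force b \<epsilon> v) \<le> c * (u - v)\<^sup>2"
    if lt: "u < v" and sl: "\<And>\<xi>. u < \<xi> \<Longrightarrow> \<xi> < v \<Longrightarrow> lc_slope b \<epsilon> \<xi> \<le> c" for u v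
  proof -
    obtain \<xi> where \<xi>: "u < \<xi>" "\<xi> < v" "lc_force b \<epsilon> v - lc_force b \<epsilon> u = (v - u) * lc_slope b \<epsilon> \<xi>"
      using lc_force_mvt[OF lt] by blast
    have "(u - v) * (lc_force b \<epsilon> u - lc_force b \<epsilon> v) = (v - u) * (lc_force b \<epsilon> v - lc_force b \<epsilon> u)"
      by (simp add: algebra_simps)
    also have "\<dots> = lc_slope b \<epsilon> \<xi> * (u - v)\<^sup>2"
      unfolding \<xi>(3) by (simp add: power2_eq_square algebra_simps)
    also have "\<dots> \<le> c * (u - v)\<^sup>2" using sl[OF \<xi>(1,2)] by (intro mult_right_mono) auto
    finally show ?thesis .
  qed
  consider "y < z" | "y = z" | "z < y" by linarith
  then show ?thesis
  proof cases
    case 1 then show ?thesis using main[of y z] slope by simp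
  next
    case 3
    then have "(z - y) * (lc_force b \<epsilon> z - lc_force b \<epsilon> y) \<le> c * (z - y)\<^sup>2" using main[of z y] slope by simp
    then show ?thesis by (simp add: algebra_simps power2_commute)
  qed simp
qed

text \<open>This bounds \<open>lc_slope\<close> above uniformly in \<open>\<epsilon>\<close>: the term \<open>- exp s * (1 + s)\<close> is never larger than 1.\<close>

lemma exp_times_le_1: "exp (s::real) * (- 1 - s) \<le> 1"
proof -
  have "exp s * (- 1 - s) \<le> exp s * exp (- s)"
    using exp_ge_add_one_self[of "- s"] by (intro mult_left_mono) auto
  then show ?thesis by (simp flip: exp_add)
qed

lemma lc_slope_le_3: "lc_slope b \<epsilon> y \<le> 3"
proof -
  have "2 - exp (y / \<epsilon>) * (1 + y / \<epsilon>) \<le> 3"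
    using exp_times_le_1[of "y / \<epsilon>"] by (simp add: algebra_simps)
  then have "lc_slope b \<epsilon> y \<le> b * 3" unfolding lc_slope_def using b by (intro mult_left_mono) auto
  then show ?thesis using b by simp
qed

lemma lc_slope_pos:
  assumes "y \<le> 0"
  shows "0 < lc_slope b \<epsilon> y"
proof -
  let ?s = "y / \<epsilon>"
  have s: "?s \<le> 0" using assms eps by (simp add: divide_nonpos_pos)
  have "exp ?s * (1 + ?s) \<le> exp ?s * exp ?s"
    using exp_ge_add_one_self[of ?s] by (intro mult_left_mono) auto
  also have "\<dots> \<le> 1 * 1" using s by (intro mult_mono) auto
  finally show ?thesis unfolding lc_slope_def using b by (intro mult_pos_pos) auto
qed

lemma lc_slope_le_minus:
  assumes "0 < K" "\<epsilon> * ln (2 + K / b) \<le> y"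
  shows "lc_slope b \<epsilon> y \<le> - K"
proof -
  have Kb: "0 < K / b" using assms(1) b by simp
  have le: "ln (2 + K / b) \<le> y / \<epsilon>" using assms(2) eps by (simp add: pos_le_divide_eq mult.commute)
  then have "2 + K / b \<le> exp (y / \<epsilon>)" using Kb by (metis add_pos_pos exp_le_cancel_iff exp_ln zero_less_numeral)
  moreover have "0 \<le> y / \<epsilon>" using le ln_ge_zero[of "2 + K / b"] Kb by linarith
  ultimately have "(2 + K / b) * 1 \<le> exp (y / \<epsilon>) * (1 + y / \<epsilon>)"
    using Kb by (intro mult_mono) auto
  then have "lc_slope b \<epsilon> y \<le> b * (2 - (2 + K / b))"
    unfolding lc_slope_def using b by (intro mult_left_mono) auto
  then show ?thesis using b by simp
qed

lemma lc_force_one_sided: "(y - z) * (lc_force b \<epsilon> y - lc_force b \<epsilon> z) \<le> 3 * (y - z)\<^sup>2"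
  by (rule lc_force_one_sided_if_slope_le) (rule lc_slope_le_3)

lemma lc_force_increasing:
  assumes "y < z" "z \<le> 0"
  shows "lc_force b \<epsilon> y < lc_force b \<epsilon> z"
proof -
  obtain \<xi> where "y < \<xi>" "\<xi> < z" and eq: "lc_force b \<epsilon> z - lc_force b \<epsilon> y = (z - y) * lc_slope b \<epsilon> \<xi>"
    using lc_force_mvt[OF assms(1)] by blast
  then have "0 < (z - y) * lc_slope b \<epsilon> \<xi>" using assms lc_slope_pos[of \<xi>] by (intro mult_pos_pos) auto
  then show ?thesis using eq by simp
qed

lemma lc_force_contracting:
  assumes "0 < K" "\<epsilon> * ln (2 + K / b) \<le> y" "\<epsilon> * ln (2 + K / b) \<le> z"
  shows "(y - z) * (lc_force b \<epsilon> y - lc_force b \<epsilon> z) \<le> - K * (y - z)\<^sup>2"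
  by (rule lc_force_one_sided_if_slope_le) (use assms in \<open>auto intro: lc_slope_le_minus\<close>)

text \<open>The exponential term is \<open>b * \<bar>y\<bar> * exp (y / \<epsilon>)\<close>, and \<open>\<sigma> * exp (- \<sigma>) \<le> 1\<close> for \<open>\<sigma> = - y / \<epsilon>\<close>.\<close>

lemma lc_force_near_linear:
  assumes "y \<le> 0"
  shows "\<bar>lc_force b \<epsilon> y - 2 * b * y\<bar> \<le> \<epsilon>"
proof -
  let ?s = "- y / \<epsilon>"
  have "?s * exp (- ?s) \<le> exp ?s * exp (- ?s)"
    using exp_ge_add_one_self[of ?s] by (intro mult_right_mono) auto
  then have "?s * exp (- ?s) \<le> 1" by (simp flip: exp_add)
  define Z where "Z = - y * exp (y / \<epsilon>)"
  have "Z \<le> \<epsilon>" using \<open>?s * exp (- ?s) \<le> 1\<close> eps by (simp add: Z_def field_simps)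
  moreover have "0 \<le> Z" unfolding Z_def using assms by (intro mult_nonneg_nonneg) auto
  ultimately have "0 \<le> b * Z" "b * Z \<le> 1 * \<epsilon>"
    using b by (simp, intro mult_mono) auto
  moreover have "lc_force b \<epsilon> y - 2 * b * y = b * Z"
    by (simp add: lc_force_def Z_def algebra_simps)
  ultimately show ?thesis by simp
qed

lemma lc_force_lower_left:
  assumes "y \<le> 0"
  shows "2 * b * y \<le> lc_force b \<epsilon> y"
proof -
  have "0 \<le> b * (- y * exp (y / \<epsilon>))" using assms b by (intro mult_nonneg_nonneg) auto
  then show ?thesis by (simp add: lc_force_def algebra_simps)
qed

lemma lc_force_lower_right:
  assumes "0 < K" "0 \<le> y" "y \<le> \<epsilon> * ln (2 + K / b)"
  shows "- (\<epsilon> * ln (2 + K / b) * (2 * b + K)) \<le> lc_force b \<epsilon> y"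
proof -
  have Kb: "0 < K / b" using assms(1) b by simp
  have "y / \<epsilon> \<le> ln (2 + K / b)" using assms(3) eps by (simp add: pos_divide_le_eq mult.commute)
  then have "exp (y / \<epsilon>) \<le> 2 + K / b" using Kb by (metis add_pos_pos exp_le_cancel_iff exp_ln zero_less_numeral)
  then have "(b * y) * exp (y / \<epsilon>) \<le> (b * (\<epsilon> * ln (2 + K / b))) * (2 + K / b)"
    using assms b by (intro mult_mono) auto
  also have "\<dots> = \<epsilon> * ln (2 + K / b) * (2 * b + K)" using b by (simp add: field_simps)
  finally have "b * y * exp (y / \<epsilon>) \<le> \<epsilon> * ln (2 + K / b) * (2 * b + K)" .
  moreover have "0 \<le> b * y * 2" using assms b by simp
  ultimately show ?thesis unfolding lc_force_def right_diff_distrib by linarith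
qed

lemma lc_force_roof:
  assumes "0 < h" "0 < M" "\<epsilon> \<le> h / (2 + (M + 1) / (b * h))" "h \<le> y"
  shows "lc_force b \<epsilon> y < - M"
proof -
  have D: "0 < 2 + (M + 1) / (b * h)" using assms b by (intro add_pos_nonneg divide_nonneg_nonneg) auto
  have "(2 + (M + 1) / (b * h)) * \<epsilon> \<le> h" using assms(3) D by (simp add: pos_le_divide_eq mult.commute)
  then have "2 + (M + 1) / (b * h) \<le> h / \<epsilon>" using eps by (simp add: pos_le_divide_eq)
  also have "\<dots> \<le> y / \<epsilon>" using assms(4) eps by (intro divide_right_mono) auto
  also have "\<dots> \<le> exp (y / \<epsilon>)" using exp_ge_add_one_self[of "y / \<epsilon>"] by linarith
  finally have e: "2 - exp (y / \<epsilon>) \<le> - ((M + 1) / (b * h))" by simp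
  have "lc_force b \<epsilon> y \<le> b * y * (- ((M + 1) / (b * h)))"
    unfolding lc_force_def using e assms b by (intro mult_left_mono) auto
  also have "\<dots> \<le> b * h * (- ((M + 1) / (b * h)))"
    using assms b by (intro mult_right_mono_neg mult_left_mono) auto
  also have "\<dots> = - (M + 1)" using assms b by simp
  finally show ?thesis by simp
qed

lemma lc_force_at_minus_a:
  assumes "0 < a"
  shows "lc_force b \<epsilon> (- a) \<le> - (a * b)"
proof -
  have "exp (- a / \<epsilon>) \<le> 1" using assms eps by simp
  then have "a * b * exp (- a / \<epsilon>) \<le> a * b * 1" using assms b by (intro mult_left_mono) auto
  then show ?thesis by (simp add: lc_force_def algebra_simps)
qed

text \<open>The force is nonnegative up to height \<open>\<epsilon> * ln 2\<close> and decreasing afterwards.\<close>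

lemma lc_force_hump:
  assumes "0 \<le> y" "y \<le> z" "c \<le> lc_force b \<epsilon> z" "c \<le> 0"
  shows "c \<le> lc_force b \<epsilon> y"
proof (cases "exp (y / \<epsilon>) \<le> 2")
  case True
  then have "0 \<le> lc_force b \<epsilon> y" unfolding lc_force_def using assms b by (intro mult_nonneg_nonneg) auto
  then show ?thesis using assms by simp
next
  case False
  have "exp (y / \<epsilon>) \<le> exp (z / \<epsilon>)" using assms eps by (simp add: divide_right_mono)
  then have "(b * y) * (exp (y / \<epsilon>) - 2) \<le> (b * z) * (exp (z / \<epsilon>) - 2)"
    using False assms b by (intro mult_mono mult_left_mono) auto
  then have "lc_force b \<epsilon> z \<le> lc_force b \<epsilon> y" by (simp add: lc_force_def algebra_simps)
  then show ?thesis using assms by simp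
qed

lemma lc_truncation_one_sided:
  "(y - z) * (lc_force b \<epsilon> (min y 2) - lc_force b \<epsilon> (min z 2)) \<le> 3 * (y - z)\<^sup>2"
proof -
  have main: "(u - v) * (lc_force b \<epsilon> (min u 2) - lc_force b \<epsilon> (min v 2)) \<le> 3 * (u - v)\<^sup>2" if "v \<le> u" for u v
  proof (cases "min v 2 < min u 2")
    case True
    obtain \<xi> where \<xi>: "lc_force b \<epsilon> (min u 2) - lc_force b \<epsilon> (min v 2) = (min u 2 - min v 2) * lc_slope b \<epsilon> \<xi>"
      using lc_force_mvt[OF True] by blast
    also have "\<dots> \<le> (min u 2 - min v 2) * 3" using True lc_slope_le_3[of \<xi>] by (intro mult_left_mono) auto
    also have "\<dots> \<le> (u - v) * 3" using that by (intro mult_right_mono) (auto simp: min_def)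
    finally have "(u - v) * (lc_force b \<epsilon> (min u 2) - lc_force b \<epsilon> (min v 2)) \<le> (u - v) * ((u - v) * 3)"
      using that by (intro mult_left_mono) auto
    then show ?thesis by (simp add: power2_eq_square algebra_simps)
  next
    case False
    then have "min u 2 = min v 2" using that by (auto simp: min_def split: if_splits)
    then show ?thesis by simp
  qed
  show ?thesis
  proof (cases "z \<le> y")
    case False
    then have "(z - y) * (lc_force b \<epsilon> (min z 2) - lc_force b \<epsilon> (min y 2)) \<le> 3 * (z - y)\<^sup>2" using main[of y z] by simp
    then show ?thesis by (simp add: algebra_simps power2_commute)
  qed (rule main)
qed

lemma lc_truncation_lipschitz:
  "(3 + exp (2 / \<epsilon>) * (1 + 2 / \<epsilon>))-lipschitz_on UNIV (\<lambda>y. lc_force b \<epsilon> (min y 2))"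
proof (rule lipschitz_onI)
  let ?L = "3 + exp (2 / \<epsilon>) * (1 + 2 / \<epsilon>)"
  show L: "0 \<le> ?L" using eps by simp
  have slope: "\<bar>lc_slope b \<epsilon> \<xi>\<bar> \<le> ?L" if "\<xi> \<le> 2" for \<xi>
  proof -
    let ?s = "\<xi> / \<epsilon>"
    have s: "?s \<le> 2 / \<epsilon>" using that eps by (simp add: divide_right_mono)
    have "exp ?s * (1 + ?s) \<le> exp (2 / \<epsilon>) * (1 + 2 / \<epsilon>)"
    proof (cases "0 \<le> 1 + ?s")
      case True
      then show ?thesis using s by (intro mult_mono) auto
    next
      case False
      then have "exp ?s * (1 + ?s) \<le> 0" by (intro mult_nonneg_nonpos) auto
      moreover have "0 \<le> exp (2 / \<epsilon>) * (1 + 2 / \<epsilon>)" using eps by simp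
      ultimately show ?thesis by linarith
    qed
    then have "- ?L \<le> 2 - exp ?s * (1 + ?s)" by simp
    then have "b * (- ?L) \<le> lc_slope b \<epsilon> \<xi>" unfolding lc_slope_def using b by (intro mult_left_mono) auto
    then have "- lc_slope b \<epsilon> \<xi> \<le> b * ?L" unfolding mult_minus_right by linarith
    also have "\<dots> \<le> 1 * ?L" using b L by (intro mult_right_mono) auto
    finally have "- lc_slope b \<epsilon> \<xi> \<le> ?L" by simp
    moreover have "lc_slope b \<epsilon> \<xi> \<le> ?L" using lc_slope_le_3[of \<xi>] eps by (smt (verit) divide_pos_pos exp_gt_zero mult_pos_pos)
    ultimately show ?thesis by (rule abs_leI[rotated])
  qed
  have main: "\<bar>lc_force b \<epsilon> (min u 2) - lc_force b \<epsilon> (min v 2)\<bar> \<le> ?L * \<bar>u - v\<bar>" if "v \<le> u" for u v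
  proof (cases "min v 2 < min u 2")
    case True
    obtain \<xi> where \<xi>: "\<xi> < min u 2" "lc_force b \<epsilon> (min u 2) - lc_force b \<epsilon> (min v 2) = (min u 2 - min v 2) * lc_slope b \<epsilon> \<xi>"
      using lc_force_mvt[OF True] by blast
    have "\<bar>lc_force b \<epsilon> (min u 2) - lc_force b \<epsilon> (min v 2)\<bar> = \<bar>min u 2 - min v 2\<bar> * \<bar>lc_slope b \<epsilon> \<xi>\<bar>"
      unfolding \<xi>(2) by (rule abs_mult)
    also have "\<dots> \<le> \<bar>u - v\<bar> * ?L"
    proof (rule mult_mono)
      show "\<bar>lc_slope b \<epsilon> \<xi>\<bar> \<le> ?L" using \<xi>(1) by (intro slope) simp
    qed (auto simp: min_def)
    finally show ?thesis by (simp add: mult.commute)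
  next
    case False
    then have "min u 2 = min v 2" using that by (auto simp: min_def split: if_splits)
    then show ?thesis using L by simp
  qed
  show "dist (lc_force b \<epsilon> (min y 2)) (lc_force b \<epsilon> (min z 2)) \<le> ?L * dist y z" for y z
    using main[of z y] main[of y z] by (cases "z \<le> y") (auto simp: dist_real_def abs_minus_commute)
qed

end

section \<open>Choice of the small parameters\<close>

text \<open>Both terms are at most a constant multiple of \<open>1 / K\<close> for \<open>K \<ge> 1\<close>.\<close>

lemma contraction_rate_exists:
  fixes C \<tau> :: real
  assumes "0 < \<tau>"
  shows "\<exists>K>0. C\<^sup>2 * (exp (- K * \<tau>) + 1 / K\<^sup>2) \<le> 1 / 4"
proof -
  define K where "K = max 1 (4 * C\<^sup>2 * (1 / \<tau> + 1))"
  have K: "1 \<le> K" "4 * C\<^sup>2 * (1 / \<tau> + 1) \<le> K" by (auto simp: K_def)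
  have "K * \<tau> \<le> exp (K * \<tau>)" using exp_ge_add_one_self[of "K * \<tau>"] by linarith
  then have "1 / exp (K * \<tau>) \<le> 1 / (K * \<tau>)" using K assms by (intro divide_left_mono) auto
  then have "exp (- K * \<tau>) \<le> 1 / \<tau> / K" by (simp add: exp_minus field_simps)
  moreover have "1 / K\<^sup>2 \<le> 1 / K" using K by (intro divide_left_mono) (auto simp: power2_eq_square)
  ultimately have "exp (- K * \<tau>) + 1 / K\<^sup>2 \<le> (1 / \<tau> + 1) / K" by (simp add: add_divide_distrib)
  then have "C\<^sup>2 * (exp (- K * \<tau>) + 1 / K\<^sup>2) \<le> C\<^sup>2 * ((1 / \<tau> + 1) / K)" by (intro mult_left_mono) auto
  also have "\<dots> \<le> 1 / 4" using K by (simp add: field_simps)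
  finally show ?thesis using K by (intro exI[of _ K]) auto
qed

lemma singular_cycle_compact:
  assumes "0 < b" "b < 1" "0 < a"
  shows "compact (singular_cycle a b)" "singular_cycle a b \<noteq> {}"
proof -
  have "continuous_on {0..return_time a b} (fold_orbit a b)"
    using fold_orbit_solution[OF assms] unfolding solution_on_UNIV_iff
    by (meson continuous_at_imp_continuous_on has_vector_derivative_continuous)
  then show "compact (singular_cycle a b)"
    unfolding singular_cycle_def by (intro compact_Un compact_continuous_image compact_Times) auto
  show "singular_cycle a b \<noteq> {}" using fold_return(1)[OF assms] by (auto simp: singular_cycle_def)
qed

text \<open>The order of choice matters: the damping rate \<open>K\<close> depends on \<open>a\<close>, \<open>b\<close> and the size of the singular
cycle alone, then \<open>\<kappa>\<close> is made small relative to \<open>\<eta>\<close> and the geometry, then the section (of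
height \<open>h\<close>, placed at \<open>\<delta> = h\<close>) relative to \<open>\<kappa>\<close>, and finally \<open>\<epsilon>\<close> relative to all of these. Uniqueness
among all periodic orbits in the ball is part of the conclusion so that the cycles
obtained for different \<open>\<eta>\<close> can be identified.\<close>

lemma le_corbeiller_cycle_near_singular:
  fixes a b r \<eta> :: real
  assumes b: "0 < b" "b < 1" and a: "0 < a" and large: "singular_cycle a b \<subseteq> ball 0 r" and "0 < \<eta>"
  shows "\<exists>\<epsilon>\<^sub>0>0. \<forall>\<epsilon>\<in>{0<..<\<epsilon>\<^sub>0}. \<exists>C. limit_cycle (le_corbeiller a b \<epsilon>) C \<and> C \<subseteq> cball 0 r \<and>
    attracting (le_corbeiller a b \<epsilon>) C \<and>
    (\<forall>D. periodic_orbit (le_corbeiller a b \<epsilon>) D \<and> D \<subseteq> cball 0 r \<longrightarrow> D = C) \<and>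
    0 \<le> hausdorff_distance C (singular_cycle a b) \<and> hausdorff_distance C (singular_cycle a b) \<le> \<eta>"
proof -
  define T xd N where "T = return_time a b" and "xd = x_d a b" and "N = expansion a b"
  have T: "0 < T" and xd: "xd < 0" using fold_return[OF b a] by (auto simp: T_def xd_def)
  have N: "0 < N" by (simp add: N_def expansion_def)
  note compact = singular_cycle_compact[OF b a]
  obtain z0 where z0: "z0 \<in> singular_cycle a b" "\<And>z. z \<in> singular_cycle a b \<Longrightarrow> norm z \<le> norm z0"
    using continuous_attains_sup[OF compact, of norm] continuous_on_norm_id by blast
  have r: "norm z0 < r" using z0 large by auto
  define B where "B = norm z0"
  have B: "norm (fold_orbit a b t) \<le> B" if "t \<in> {0..T}" for t
    using z0(2)[of "fold_orbit a b t"] that by (simp add: B_def T_def singular_cycle_def)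
  obtain m where m: "0 < m" "\<And>t. t \<in> {T / 4..3 * T / 4} \<Longrightarrow> snd (fold_orbit a b t) \<le> - m"
  proof -
    have "continuous_on {T / 4..3 * T / 4} (\<lambda>t. snd (fold_orbit a b t))"
      using fold_orbit_solution[OF b a] unfolding solution_on_UNIV_iff
      by (intro continuous_intros) (meson continuous_at_imp_continuous_on has_vector_derivative_continuous)
    then obtain t where t: "t \<in> {T / 4..3 * T / 4}"
        "\<And>u. u \<in> {T / 4..3 * T / 4} \<Longrightarrow> snd (fold_orbit a b u) \<le> snd (fold_orbit a b t)"
      using continuous_attains_sup[of "{T / 4..3 * T / 4}" "\<lambda>t. snd (fold_orbit a b t)"] T by auto
    moreover have "snd (fold_orbit a b t) < 0"
      using t(1) T fold_return(3)[OF b a, of t] by (simp add: T_def)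
    ultimately show ?thesis by (intro that[of "- snd (fold_orbit a b t)"]) auto
  qed
  have "0 < slide_time a b"
    unfolding slide_time_def using xd a by (intro divide_pos_pos) (auto simp: xd_def)
  from contraction_rate_exists[OF this, of "shift_factor a b B"]
  obtain K where K: "0 < K" "(shift_factor a b B)\<^sup>2 * (exp (- K * slide_time a b) + 1 / K\<^sup>2) \<le> 1 / 4"
    by blast
  have E: "0 < 1 + 8 * (a + 1) / (- xd)" using a xd by (intro add_pos_pos divide_pos_pos) auto
  define V where "V = (- xd / 2) / (1 + 8 * (a + 1) / (- xd))"
  have V: "0 < V" unfolding V_def using xd E by (intro divide_pos_pos) auto
  have pos: "0 < a / 2" "0 < - xd / 16" "0 < m / 2" "0 < \<eta> / 2" "0 < (r - B) / 2" "0 < a * b / 2"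
    using a b xd m \<open>0 < \<eta>\<close> r by (auto simp: B_def)
  define A where "A = {1, a / 2, - xd / 16, m / 2, V, \<eta> / 2, (r - B) / 2, a * b / 2}"
  have A: "finite A" "A \<noteq> {}" by (simp_all add: A_def)
  define \<kappa> where "\<kappa> = Min A"
  \<comment> \<open>Membership gives positivity: all elements are positive.\<close>
  have "\<kappa> \<in> A" unfolding \<kappa>_def using A by (rule Min_in)
  have \<kappa>: "0 < \<kappa>" "\<kappa> \<le> 1" "\<kappa> \<le> a / 2" "\<kappa> \<le> - xd / 16" "\<kappa> \<le> m / 2"
      "\<kappa> \<le> V" "\<kappa> \<le> \<eta> / 2" "\<kappa> \<le> (r - B) / 2" "\<kappa> \<le> a * b / 2"
  proof -
    show "0 < \<kappa>" using \<open>\<kappa> \<in> A\<close> pos V unfolding A_def by (elim insertE emptyE) simp_all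
    have le: "\<kappa> \<le> x" if "x \<in> A" for x unfolding \<kappa>_def using A(1) that by (rule Min_le)
    show "\<kappa> \<le> 1" "\<kappa> \<le> a / 2" "\<kappa> \<le> - xd / 16" "\<kappa> \<le> m / 2" "\<kappa> \<le> V" "\<kappa> \<le> \<eta> / 2"
      "\<kappa> \<le> (r - B) / 2" "\<kappa> \<le> a * b / 2"
      by (rule le, unfold A_def, blast)+
  qed
  define h where "h = min (\<kappa> * exp (- (7 / 2 * T)) / 2) (a * T / (8 * N))"
  have h: "0 < h" "h \<le> \<kappa> * exp (- (7 / 2 * T)) / 2" "h \<le> a * T / (8 * N)"
    using \<kappa> a T N by (auto simp: h_def)
  have h\<kappa>: "h \<le> \<kappa>"
  proof -
    have "\<kappa> * exp (- (7 / 2 * T)) \<le> \<kappa> * 1" using \<kappa> T by (intro mult_left_mono) auto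
    then show ?thesis using h \<kappa> by linarith
  qed
  have hsq: "exp (7 * T) * (h\<^sup>2 + h\<^sup>2 + h\<^sup>2) \<le> \<kappa>\<^sup>2"
  proof -
    have "h\<^sup>2 \<le> (\<kappa> * exp (- (7 / 2 * T)) / 2)\<^sup>2" using h by (intro power_mono) auto
    also have "\<dots> = \<kappa>\<^sup>2 * exp (- (7 * T)) / 4"
      by (simp add: power_mult_distrib power_divide flip: exp_double)
    finally have "exp (7 * T) * (h\<^sup>2 + h\<^sup>2 + h\<^sup>2) \<le> exp (7 * T) * (3 * (\<kappa>\<^sup>2 * exp (- (7 * T)) / 4))"
      by (intro mult_left_mono) auto
    also have "\<dots> = 3 / 4 * \<kappa>\<^sup>2" by (simp add: exp_minus field_simps)
    also have "\<dots> \<le> \<kappa>\<^sup>2" by simp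
    finally show ?thesis .
  qed
  \<comment> \<open>The roof has to repel both in a neighbourhood of the singular cycle and in the given ball.\<close>
  define M where "M = max (B + 1) r"
  have M: "B + 1 \<le> M" "r \<le> M" by (simp_all add: M_def)
  then have M0: "0 < M" using norm_ge_zero[of z0] unfolding B_def by linarith
  define l where "l = ln (2 + K / b)"
  have l: "0 < l" 
  proof -
    have "0 < K / b" using K b by simp
    then show ?thesis unfolding l_def by (intro ln_gt_zero) linarith
  qed
  define \<epsilon>0 where "\<epsilon>0 = min h (min (h / (l * (1 + 2 * b + K))) (h / (2 + (M + 1) / (b * h))))"
  have den: "0 < l * (1 + 2 * b + K)" "0 < 2 + (M + 1) / (b * h)"
    using l b K M0 h by (intro mult_pos_pos add_pos_pos divide_pos_pos; simp)+
  have \<epsilon>0: "0 < \<epsilon>0" "\<epsilon>0 \<le> h" "\<epsilon>0 \<le> h / (l * (1 + 2 * b + K))" "\<epsilon>0 \<le> h / (2 + (M + 1) / (b * h))"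
    using h(1) den by (simp_all add: \<epsilon>0_def min.coboundedI1 min.coboundedI2)
  show ?thesis
  proof (intro exI[of _ \<epsilon>0] conjI ballI)
    fix \<epsilon> assume "\<epsilon> \<in> {0<..<\<epsilon>0}"
    then have eps: "0 < \<epsilon>" "\<epsilon> \<le> h" "\<epsilon> < h / (l * (1 + 2 * b + K))" "\<epsilon> \<le> h / (2 + (M + 1) / (b * h))"
      using \<epsilon>0 by auto
    define s where "s = \<epsilon> * l"
    have s0: "0 < s" using eps l by (simp add: s_def)
    have sK: "s * (1 + 2 * b + K) < h"
      using eps(3) den(1) by (simp add: s_def pos_less_divide_eq mult.assoc)
    have "s * 1 \<le> s * (1 + 2 * b + K)" "s * (2 * b + K) \<le> s * (1 + 2 * b + K)"
      using s0 b K by (intro mult_left_mono; simp)+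
    then have s: "s < h" "s * (2 * b + K) < h" using sK by simp_all
    let ?g = "\<lambda>y. lc_force b \<epsilon> (min y 2)"
    have low: "- h < lc_force b \<epsilon> y" if "0 \<le> y" "y \<le> s" for y
      using lc_force_lower_right[OF b eps(1) K(1) that(1)] that(2) s(2) by (simp add: s_def l_def)
    interpret truncated_loop a ?g "3 + exp (2 / \<epsilon>) * (1 + 2 / \<epsilon>)" b B \<epsilon> h h \<kappa> s M m K "lc_force b \<epsilon>"
    proof
      show "0 < a" "0 < b" "b < 1" "0 < K" by fact+
      show "(3 + exp (2 / \<epsilon>) * (1 + 2 / \<epsilon>))-lipschitz_on UNIV ?g"
        by (rule lc_truncation_lipschitz[OF b eps(1)])
      show "(y - z) * (?g y - ?g z) \<le> 3 * (y - z)\<^sup>2" for y z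
        by (rule lc_truncation_one_sided[OF b eps(1)])
      show "norm (fold_orbit a b t) \<le> B" if "t \<in> {0..return_time a b}" for t
        using B that by (simp add: T_def)
      show "\<bar>?g y - 2 * b * y\<bar> \<le> \<epsilon>" if "y \<le> 0" for y
        using lc_force_near_linear[OF b eps(1) that] that by simp
      show "x_d a b / 4 < ?g y" if "- \<kappa> \<le> y" "y \<le> s" for y
      proof (cases "y \<le> 0")
        case True
        have "b * (- y) \<le> 1 * \<kappa>" using b that True \<kappa> by (intro mult_mono) auto
        then have "- (2 * \<kappa>) \<le> 2 * b * y" by simp
        then show ?thesis
          using lc_force_lower_left[OF b eps(1) True] True \<kappa> xd by (simp add: xd_def[symmetric])
      next
        case False
        then show ?thesis using low[of y] that s h\<kappa> \<kappa> xd by (simp add: xd_def[symmetric])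
      qed
      show "- h < ?g s" using low[of s] s0 s h\<kappa> \<kappa> by simp
      show "?g h < - M" using lc_force_roof[OF b eps(1) h(1) M0 eps(4), of h] h\<kappa> \<kappa> by simp
      show "B + 1 \<le> M" by fact
      show "0 < h" "h \<le> \<kappa>" "0 < s" "s < h" "\<kappa> \<le> 1" "\<kappa> \<le> a / 2" "0 \<le> \<epsilon>" by (fact | use eps in simp)+
      show "\<epsilon> \<le> 1" using eps(2) h\<kappa> \<kappa>(2) by linarith
      show "\<kappa> \<le> - x_d a b / 4" using \<kappa> xd by (simp add: xd_def)
      show "\<kappa> * (1 + 8 * (a + 1) / - x_d a b) \<le> - x_d a b / 2"
        using \<kappa>(6) E unfolding V_def xd_def by (subst (asm) pos_le_divide_eq) auto
      show "exp (7 * return_time a b) * (h\<^sup>2 + h\<^sup>2 + \<epsilon>\<^sup>2) \<le> \<kappa>\<^sup>2"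
      proof -
        have "exp (7 * T) * (h\<^sup>2 + h\<^sup>2 + \<epsilon>\<^sup>2) \<le> exp (7 * T) * (h\<^sup>2 + h\<^sup>2 + h\<^sup>2)"
          using eps by (intro mult_left_mono add_left_mono power_mono) auto
        also note hsq
        finally show ?thesis unfolding T_def .
      qed
      show "snd (fold_orbit a b t) \<le> - m" if "t \<in> {return_time a b / 4..3 * return_time a b / 4}" for t
        using m(2) that by (simp add: T_def)
      show "\<kappa> < m" using \<kappa> m by simp
      show "(y - z) * (?g y - ?g z) \<le> - K * (y - z)\<^sup>2" if "y \<in> {s..h}" "z \<in> {s..h}" for y z
        using lc_force_contracting[OF b eps(1) K(1), of y z] that h\<kappa> \<kappa> by (simp add: s_def l_def)
      show "2 * expansion a b * h / a \<le> return_time a b / 4"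
        using h(3) N a by (simp add: N_def[symmetric] T_def[symmetric] field_simps)
      show "(shift_factor a b B)\<^sup>2 * (exp (- K * slide_time a b) + 1 / K\<^sup>2) \<le> 1 / 4" by fact
      show "?g y = lc_force b \<epsilon> y" if "y \<le> 2" for y using that by simp
      show "(y - z) * (lc_force b \<epsilon> y - lc_force b \<epsilon> z) \<le> 3 * (y - z)\<^sup>2" for y z
        by (rule lc_force_one_sided[OF b eps(1)])
      show "lc_force b \<epsilon> 0 = 0" by (simp add: lc_force_def)
      show "lc_force b \<epsilon> y < lc_force b \<epsilon> z" if "y < z" "z \<le> 0" for y z
        by (rule lc_force_increasing[OF b eps(1) that])
      show "lc_force b \<epsilon> y < - M" if "h \<le> y" for y
        by (rule lc_force_roof[OF b eps(1) h(1) M0 eps(4) that])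
      show "lc_force b \<epsilon> (- a) < lc_force b \<epsilon> y" if "0 \<le> y" "y \<le> z" "- h \<le> lc_force b \<epsilon> z" for y z
      proof -
        have "- h \<le> lc_force b \<epsilon> y" using lc_force_hump[OF b eps(1) that] h by simp
        moreover have "h < a * b" using h\<kappa> \<kappa>(1,9) by linarith
        ultimately show ?thesis using lc_force_at_minus_a[OF b eps(1) a] by linarith
      qed
    qed
    have F: "le_corbeiller a b \<epsilon> = rayleigh_field a (lc_force b \<epsilon>)"
      unfolding le_corbeiller_eq lc_force_def[abs_def] ..
    have "cycle \<subseteq> cball 0 r"
    proof
      fix z assume "z \<in> cycle"
      then have "infdist z (singular_cycle a b) \<le> 2 * \<kappa>" by (rule cycle_near_singular)
      then obtain x where x: "x \<in> singular_cycle a b" "dist z x \<le> 2 * \<kappa>"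
        using infdist_attains_inf[OF compact_imp_closed[OF compact(1)] compact(2), of z] by metis
      then have "norm z \<le> norm x + 2 * \<kappa>" using norm_triangle_sub[of z x] by (simp add: dist_norm)
      also have "\<dots> \<le> r" using z0(2)[OF x(1)] \<kappa>(8) by (simp add: B_def)
      finally show "z \<in> cball 0 r" by simp
    qed
    moreover have "2 * \<kappa> \<le> \<eta>" using \<kappa>(7) by simp
    ultimately show "\<exists>C. limit_cycle (le_corbeiller a b \<epsilon>) C \<and> C \<subseteq> cball 0 r \<and>
      attracting (le_corbeiller a b \<epsilon>) C \<and>
      (\<forall>D. periodic_orbit (le_corbeiller a b \<epsilon>) D \<and> D \<subseteq> cball 0 r \<longrightarrow> D = C) \<and>
      0 \<le> hausdorff_distance C (singular_cycle a b) \<and> hausdorff_distance C (singular_cycle a b) \<le> \<eta>"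
      unfolding F
      using cycle_limit_cycle cycle_attracting periodic_orbit_in_ball[OF _ _ M(2)] hausdorff_cycle
      by (intro exI[of _ cycle]) (auto intro: order_trans)
  qed (rule \<epsilon>0)
qed

theorem theorem1p5:
  fixes a b r :: real
  assumes "0 < b" and "b < 1" and "0 < a"
    and large: "singular_cycle a b \<subseteq> interior (cball 0 r)"
  shows "\<exists>\<epsilon>\<^sub>0>0. \<exists>\<Gamma> :: real \<Rightarrow> (real \<times> real) set.
     (\<forall>\<epsilon>\<in>{0<..<\<epsilon>\<^sub>0}.
        limit_cycle (le_corbeiller a b \<epsilon>) (\<Gamma> \<epsilon>) \<and> \<Gamma> \<epsilon> \<subseteq> cball 0 r \<and>
        (\<forall>C. limit_cycle (le_corbeiller a b \<epsilon>) C \<and> C \<subseteq> cball 0 r \<longrightarrow> C = \<Gamma> \<epsilon>) \<and>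
        attracting (le_corbeiller a b \<epsilon>) (\<Gamma> \<epsilon>)) \<and>
     ((\<lambda>\<epsilon>. hausdorff_distance (\<Gamma> \<epsilon>) (singular_cycle a b)) \<longlongrightarrow> 0) (at_right 0)"
proof -
  define good where "good \<epsilon> C \<longleftrightarrow> limit_cycle (le_corbeiller a b \<epsilon>) C \<and> C \<subseteq> cball 0 r \<and>
    attracting (le_corbeiller a b \<epsilon>) C \<and>
    (\<forall>D. periodic_orbit (le_corbeiller a b \<epsilon>) D \<and> D \<subseteq> cball 0 r \<longrightarrow> D = C)" for \<epsilon> C
  have ball: "singular_cycle a b \<subseteq> ball 0 r" using large by (simp add: interior_cball)
  have near: "\<exists>\<epsilon>\<^sub>0>0. \<forall>\<epsilon>\<in>{0<..<\<epsilon>\<^sub>0}. \<exists>C. good \<epsilon> C \<and>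
      0 \<le> hausdorff_distance C (singular_cycle a b) \<and> hausdorff_distance C (singular_cycle a b) \<le> \<eta>"
    if "0 < \<eta>" for \<eta>
    using le_corbeiller_cycle_near_singular[OF assms(1-3) ball that] by (simp add: good_def conj_assoc)
  have unique: "C = D" if "good \<epsilon> C" "good \<epsilon> D" for \<epsilon> C D
    using that by (auto simp: good_def limit_cycle_def)
  define \<Gamma> where "\<Gamma> \<epsilon> = (SOME C. good \<epsilon> C)" for \<epsilon>
  have \<Gamma>: "\<Gamma> \<epsilon> = C" if "good \<epsilon> C" for \<epsilon> C
    unfolding \<Gamma>_def using that unique by (metis someI)
  obtain \<epsilon>0 where \<epsilon>0: "0 < \<epsilon>0" "\<And>\<epsilon>. \<epsilon> \<in> {0<..<\<epsilon>0} \<Longrightarrow> \<exists>C. good \<epsilon> C"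
    using near[of 1] by fastforce
  have "good \<epsilon> (\<Gamma> \<epsilon>)" if "\<epsilon> \<in> {0<..<\<epsilon>0}" for \<epsilon> using \<epsilon>0(2)[OF that] \<Gamma> by metis
  then have main: "\<forall>\<epsilon>\<in>{0<..<\<epsilon>0}. limit_cycle (le_corbeiller a b \<epsilon>) (\<Gamma> \<epsilon>) \<and> \<Gamma> \<epsilon> \<subseteq> cball 0 r \<and>
        (\<forall>C. limit_cycle (le_corbeiller a b \<epsilon>) C \<and> C \<subseteq> cball 0 r \<longrightarrow> C = \<Gamma> \<epsilon>) \<and>
        attracting (le_corbeiller a b \<epsilon>) (\<Gamma> \<epsilon>)"
    by (simp add: good_def limit_cycle_def)
  have "((\<lambda>\<epsilon>. hausdorff_distance (\<Gamma> \<epsilon>) (singular_cycle a b)) \<longlongrightarrow> 0) (at_right 0)"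
  proof (rule tendstoI)
    fix e :: real assume "0 < e"
    then obtain \<epsilon>1 where \<epsilon>1: "0 < \<epsilon>1" "\<And>\<epsilon>. \<epsilon> \<in> {0<..<\<epsilon>1} \<Longrightarrow> \<exists>C. good \<epsilon> C \<and>
      0 \<le> hausdorff_distance C (singular_cycle a b) \<and> hausdorff_distance C (singular_cycle a b) \<le> e / 2"
      using near[of "e / 2"] by (meson half_gt_zero)
    have "dist (hausdorff_distance (\<Gamma> \<epsilon>) (singular_cycle a b)) 0 < e" if "0 < \<epsilon>" "\<epsilon> < \<epsilon>1" for \<epsilon>
      using \<epsilon>1(2)[of \<epsilon>] that \<Gamma> \<open>0 < e\<close> by (force simp: dist_real_def)
    then show "\<forall>\<^sub>F \<epsilon> in at_right 0. dist (hausdorff_distance (\<Gamma> \<epsilon>) (singular_cycle a b)) 0 < e"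
      unfolding eventually_at_right_field using \<epsilon>1(1) by blast
  qed
  with main \<epsilon>0(1) show ?thesis by (intro exI[of _ \<epsilon>0] exI[of _ \<Gamma>] conjI)
qed

end
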